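(* Assume that the material characteristics (in particular $\kappa$) are fixed and that $\liminf_{h\to0}\lambda_h^->0$ and $\limsup_{h\to0}\lambda_h^+<+\infty$. Let $r\in(0,1)$, let $\mathfrak{p}^{(\infty)}\in\mathbb{V}_h(\Sigma)$ be the unique solution of $(\mathrm{Id}+\Pi S_h)\mathfrak{p}^{(\infty)}=\mathfrak{f}$, and let $\gamma_h:=\inf_{\mathfrak{w}\in\mathbb{V}_h(\Sigma)\setminus\{0\}}\|(\mathrm{Id}+\Pi S_h)\mathfrak{w}\|_{t_h}/\|\mathfrak{w}\|_{t_h}$. Let $(u^{(n)},\mathfrak{p}^{(n)})\in\mathbb{V}_h(\Omega)\times\mathbb{V}_h(\Sigma)$ be defined, from a given $\mathfrak{p}^{(0)}\neq\mathfrak{p}^{(\infty)}$, by (i) $a(u^{(n)},v)-i\,t_h(u^{(n)}|_\Sigma,v|_\Sigma)=t_h(\mathfrak{p}^{(n)},v|_\Sigma)+\ell(v)$ for all $v\in\mathbb{V}_h(\Omega)$, $n\ge0$; (ii) $\mathfrak{p}^{(n)}=(1-r)\mathfrak{p}^{(n-1)}-r\,\Pi(\mathfrak{p}^{(n-1)}+2i\,u^{(n-1)}|_\Sigma)$, $n\ge1$. Then $0<\liminf_{h\to0}\gamma_h$, and for any $0<\gamma_\star<\liminf_{h\to0}\gamma_h$ there exists $h_\star>0$ such that $$\frac{\|\mathfrak{p}^{(n)}-\mathfrak{p}^{(\infty)}\|_{t_h}}{\|\mathfrak{p}^{(0)}-\mathfrak{p}^{(\infty)}\|_{t_h}}\le\big(1-r(1-r)\gamma_\star^2\big)^{n/2}\qquad\forall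 h\in(0,h_\star),\ \forall n\ge0.$$
   Context: Coefficients. Let $d\in\{1,2,3\}$, $\Omega\subset\mathbb{R}^d$ a bounded polygonal/polyhedral domain, $\kappa:\Omega\to\mathbb{C}$ and $\mu:\Omega\to(0,+\infty)$ measurable with $\mathrm{Re}\,\kappa\ge0$, $\mathrm{Im}\,\kappa\ge0$ in $\Omega$, $\kappa_\infty:=\max(1,\|\kappa\|_{L^\infty(\Omega)})<\infty$, $\|\mu\|_{L^\infty(\Omega)}+\|\mu^{-1}\|_{L^\infty(\Omega)}<\infty$ (boundary integrals below use the boundary values of $\kappa$). Let $f\in L^2(\Omega)$, $g\in L^2(\partial\Omega)$. Norm: $\|v\|_{H^1(\omega)}^2:=\|\nabla v\|_{L^2(\omega)}^2+\kappa_\infty^2\|v\|_{L^2(\omega)}^2$. Mesh and spaces. $\mathcal{T}_h(\Omega)$ is a regular simplicial triangulation of $\Omega$ with mesh width $h$; for fixed $k\ge1$, $V_h(\Omega)$ is the space of continuous complex-valued functions on $\overline\Omega$ that are polynomials of degree $\le k$ on each cell. For each $h$, $\overline\Omega=\cup_{j=1}^J\overline{\Omega}_j^h$ with pairwise disjoint polyhedral $\Omega_j^h$ (possibly depending on $h$) whose closures are unions of mesh cells; $\Gamma_j^h:=\partial\Omega_j^h$, $\Sigma:=\cup_j\Gamma_j^h$ (cross-points allowed). $V_h(\Omega_j^h)$, $V_h(\Gamma_j^h)$ are the spaces of restrictions of functions of $V_h(\Omega)$. $\mathbb{H}^1(\Omega):=\{u\in L^2(\Omega):u|_{\Omega_j^h}\in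 H^1(\Omega_j^h)\ \forall j\}$ with $\|u\|_{\mathbb{H}^1(\Omega)}^2:=\sum_j\|u|_{\Omega_j^h}\|_{H^1(\Omega_j^h)}^2$; $\mathbb{V}_h(\Omega):=\{u\in L^2(\Omega): u|_{\Omega_j^h}\in V_h(\Omega_j^h)\ \forall j\}$; $v|_\Sigma:=(v|_{\Gamma_1^h},\dots,v|_{\Gamma_J^h})$ with traces from the interior of $\Omega_j^h$. $\mathbb{V}_h(\Sigma):=V_h(\Gamma_1^h)\times\cdots\times V_h(\Gamma_J^h)$ and $V_h(\Sigma):=\{v|_\Sigma: v\in V_h(\Omega)\}$. For $\mathfrak{q}\in\mathbb{V}_h(\Sigma)$, $\|\mathfrak{q}\|_{\rho_h}^2:=\sum_{j}\min\{\|v\|_{H^1(\Omega_j^h)}^2: v\in V_h(\Omega_j^h),\ v|_{\Gamma_j^h}=q_j\}$. Forms. With interior traces on $\partial\Omega_j^h\cap\partial\Omega$, $a(u,v):=\sum_{j}\big(\int_{\Omega_j^h}\mu\nabla u\cdot\nabla\overline v-\kappa^2u\overline v\,dx-i\int_{\partial\Omega_j^h\cap\partial\Omega}\kappa u\overline v\,d\sigma\big)$ and $\ell(v):=\sum_{j}\big(\int_{\Omega_j^h}f\overline v\,dx+\int_{\partial\Omega_j^h\cap\partial\Omega}g\overline v\,d\sigma\big)$. Assumptions. $\alpha_h:=\inf_{u\in V_h(\Omega)\setminus\{0\}}\sup_{v\in V_h(\Omega)\setminus\{0\}}\frac{|a(u,v)|}{\|u\|_{H^1(\Omega)}\|v\|_{H^1(\Omega)}}>0$.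 The form $t_h(\cdot,\cdot)$ is a scalar product on $\mathbb{V}_h(\Sigma)$ (linear in the first, antilinear in the second argument), $\|\mathfrak{w}\|_{t_h}:=\sqrt{t_h(\mathfrak{w},\mathfrak{w})}$, and $\lambda_h^-:=\inf\|\mathfrak{w}\|_{t_h}/\|\mathfrak{w}\|_{\rho_h}$, $\lambda_h^+:=\sup\|\mathfrak{w}\|_{t_h}/\|\mathfrak{w}\|_{\rho_h}$ over $\mathfrak{w}\in\mathbb{V}_h(\Sigma)\setminus\{0\}$. Operators. $\Pi:\mathbb{V}_h(\Sigma)\to\mathbb{V}_h(\Sigma)$ is such that $(\mathrm{Id}+\Pi)/2$ is the $t_h$-orthogonal projector onto $V_h(\Sigma)$. $S_h(\mathfrak{p}):=\mathfrak{p}+2i\,w|_\Sigma$, where $w\in\mathbb{V}_h(\Omega)$ is the unique solution of $a(w,v)-i\,t_h(w|_\Sigma,v|_\Sigma)=t_h(\mathfrak{p},v|_\Sigma)$ for all $v\in\mathbb{V}_h(\Omega)$. $\mathfrak{f}:=-2i\,\Pi(u_\star|_\Sigma)$, where $u_\star\in\mathbb{V}_h(\Omega)$ is the unique solution of $a(u_\star,v)-i\,t_h(u_\star|_\Sigma,v|_\Sigma)=\ell(v)$ for all $v\in\mathbb{V}_h(\Omega)$.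
   Formalization: The formal theorem also assumes that liminf of α_h is positive as h→0, and that the norm of a(·,·) on the broken space 𝕍_h(Ω) stays bounded as h→0; with α_h>0 and fixed coefficients alone, γ_h can tend to 0 (resonant κ, or thin h-dependent subdomains at the boundary). *)

theory Defs
  imports
    "HOL-Analysis.Analysis"
    "HOL-Probability.Essential_Supremum"
    "HOL-Library.Function_Algebras"
begin

text \<open>
  Elements of the continuous finite element spaces are functions \<open>real^'n \<Rightarrow> complex\<close> that
  vanish outside the closed set (closure or boundary of a domain) on which they live, so that
  equality of functions is equality on that set.  A broken function \<open>u\<close> on the domain is
  identified with the tuple of its restrictions to the subdomains, each extended continuously
  to the closure of the subdomain, and a multi-trace with the tuple of its components.
  Both kinds of tuples are functions \<open>nat \<Rightarrow> real^'n \<Rightarrow> complex\<close> that vanish outside the index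
  range \<open>{1..J}\<close>.
\<close>

definition restr :: "'a set \<Rightarrow> ('a \<Rightarrow> complex) \<Rightarrow> 'a \<Rightarrow> complex" where
  "restr A v = (\<lambda>x. if x \<in> A then v x else 0)"

definition cmul :: "complex \<Rightarrow> (nat \<Rightarrow> 'a \<Rightarrow> complex) \<Rightarrow> nat \<Rightarrow> 'a \<Rightarrow> complex" where
  "cmul c q = (\<lambda>j x. c * q j x)"


subsection \<open>Surface measure\<close>

text \<open>
  The \<open>s\<close>-dimensional Hausdorff outer measure, normalised so as to agree with
  the Lebesgue measure when \<open>s\<close> is the dimension of the space.  For \<open>s = 0\<close> it counts points.
\<close>

definition hausdorff_outer :: "nat \<Rightarrow> 'a::metric_space set \<Rightarrow> ennreal" where
  "hausdorff_outer s A =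
     (SUP \<delta>\<in>{0::real<..}.
        INF U\<in>{U :: nat \<Rightarrow> 'a set. A \<subseteq> (\<Union>i. U i) \<and> (\<forall>i. bounded (U i) \<and> diameter (U i) \<le> \<delta>)}.
          (\<Sum>i. if U i = {} then 0 else ennreal (unit_ball_vol (real s) * (diameter (U i) / 2) ^ s)))"

definition surface_measure :: "(real^'n) measure" where
  "surface_measure = measure_of UNIV (sets borel) (hausdorff_outer (CARD('n) - 1))"


subsection \<open>Domains, meshes and partitions\<close>

text \<open>Polyhedral sets are bounded and coincide with the interior of their closure.\<close>

definition polyhedral :: "(real^'n) set \<Rightarrow> bool" where
  "polyhedral S \<longleftrightarrow>
     S \<noteq> {} \<and> (\<exists>F. finite F \<and> (\<forall>\<tau>\<in>F. int CARD('n) simplex \<tau>) \<and> S = interior (\<Union>F))"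

definition polyhedral_domain :: "(real^'n) set \<Rightarrow> bool" where
  "polyhedral_domain S \<longleftrightarrow> polyhedral S \<and> connected S"

record 'a decomposition =
  cells :: "'a set set"
  num_sub :: nat
  subdom :: "nat \<Rightarrow> 'a set"

text \<open>
  The predicate \<^const>\<open>triangulation\<close> contains the regularity of the mesh: two cells
  meet in a common face.  No shape regularity is required.
\<close>

definition mesh_decomposition ::
    "(real^'n) set \<Rightarrow> real \<Rightarrow> (real^'n) decomposition \<Rightarrow> bool" where
  "mesh_decomposition \<Omega> h D \<longleftrightarrow>
     triangulation (cells D) \<and>
     (\<forall>\<tau>\<in>cells D. int CARD('n) simplex \<tau>) \<and>
     \<Union>(cells D) = closure \<Omega> \<and>
     Max (diameter ` cells D) = h \<and>
     (\<forall>j\<in>{1..num_sub D}. polyhedral (subdom D j) \<and>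
        (\<exists>C\<subseteq>cells D. closure (subdom D j) = \<Union>C)) \<and>
     (\<forall>i\<in>{1..num_sub D}. \<forall>j\<in>{1..num_sub D}. i \<noteq> j \<longrightarrow> subdom D i \<inter> subdom D j = {}) \<and>
     (\<Union>j\<in>{1..num_sub D}. closure (subdom D j)) = closure \<Omega>"


subsection \<open>Coefficients and data\<close>

definition L2_on :: "'a measure \<Rightarrow> 'a set \<Rightarrow> ('a \<Rightarrow> complex) \<Rightarrow> bool" where
  "L2_on M A f \<longleftrightarrow> set_borel_measurable M A f \<and> set_integrable M A (\<lambda>x. (cmod (f x))\<^sup>2)"

definition kappa_inf :: "(real^'n) set \<Rightarrow> (real^'n \<Rightarrow> complex) \<Rightarrow> real" where
  "kappa_inf \<Omega> \<kappa> = max 1 (real_of_ereal (esssup (lebesgue_on \<Omega>) (\<lambda>x. ereal (cmod (\<kappa> x)))))"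

text \<open>
  The values of \<open>\<kappa>\<close> on \<open>frontier \<Omega>\<close> are its boundary values; being independent of the
  values in \<open>\<Omega>\<close> for a merely measurable \<open>\<kappa>\<close>, they carry their own sign, measurability and
  boundedness conditions.
\<close>

definition admissible_coefficients ::
    "(real^'n) set \<Rightarrow> (real^'n \<Rightarrow> complex) \<Rightarrow> (real^'n \<Rightarrow> real) \<Rightarrow> bool" where
  "admissible_coefficients \<Omega> \<kappa> \<mu> \<longleftrightarrow>
     \<kappa> \<in> borel_measurable (lebesgue_on \<Omega>) \<and>
     \<mu> \<in> borel_measurable (lebesgue_on \<Omega>) \<and>
     (\<forall>x\<in>\<Omega>. \<mu> x > 0) \<and>
     (\<forall>x\<in>\<Omega>. Re (\<kappa> x) \<ge> 0 \<and> Im (\<kappa> x) \<ge> 0) \<and>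
     esssup (lebesgue_on \<Omega>) (\<lambda>x. ereal (cmod (\<kappa> x))) < \<infinity> \<and>
     esssup (lebesgue_on \<Omega>) (\<lambda>x. ereal (\<mu> x)) < \<infinity> \<and>
     esssup (lebesgue_on \<Omega>) (\<lambda>x. ereal (inverse (\<mu> x))) < \<infinity> \<and>
     set_borel_measurable borel (frontier \<Omega>) \<kappa> \<and>
     bounded (\<kappa> ` frontier \<Omega>) \<and>
     (\<forall>x\<in>frontier \<Omega>. Re (\<kappa> x) \<ge> 0 \<and> Im (\<kappa> x) \<ge> 0)"


subsection \<open>Finite element spaces\<close>

definition poly_of_degree_le :: "nat \<Rightarrow> (real^'n \<Rightarrow> complex) \<Rightarrow> bool" where
  "poly_of_degree_le k p \<longleftrightarrow>
     (\<exists>c :: ('n \<Rightarrow> nat) \<Rightarrow> complex.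
        p = (\<lambda>x. \<Sum>\<alpha> | sum \<alpha> UNIV \<le> k. c \<alpha> * (\<Prod>i\<in>UNIV. complex_of_real (x $ i) ^ \<alpha> i)))"

definition Vh :: "(real^'n) set \<Rightarrow> nat \<Rightarrow> (real^'n) decomposition \<Rightarrow> (real^'n \<Rightarrow> complex) set" where
  "Vh \<Omega> k D =
     {v. continuous_on (closure \<Omega>) v \<and>
         (\<forall>\<tau>\<in>cells D. \<exists>p. poly_of_degree_le k p \<and> (\<forall>x\<in>\<tau>. v x = p x)) \<and>
         (\<forall>x. x \<notin> closure \<Omega> \<longrightarrow> v x = 0)}"

definition Vh_sub ::
    "(real^'n) set \<Rightarrow> nat \<Rightarrow> (real^'n) decomposition \<Rightarrow> nat \<Rightarrow> (real^'n \<Rightarrow> complex) set" where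
  "Vh_sub \<Omega> k D j = restr (closure (subdom D j)) ` Vh \<Omega> k D"

definition Vh_bd ::
    "(real^'n) set \<Rightarrow> nat \<Rightarrow> (real^'n) decomposition \<Rightarrow> nat \<Rightarrow> (real^'n \<Rightarrow> complex) set" where
  "Vh_bd \<Omega> k D j = restr (frontier (subdom D j)) ` Vh \<Omega> k D"

definition broken_Vh ::
    "(real^'n) set \<Rightarrow> nat \<Rightarrow> (real^'n) decomposition \<Rightarrow> (nat \<Rightarrow> real^'n \<Rightarrow> complex) set" where
  "broken_Vh \<Omega> k D =
     {u. (\<forall>j\<in>{1..num_sub D}. u j \<in> Vh_sub \<Omega> k D j) \<and> (\<forall>j. j \<notin> {1..num_sub D} \<longrightarrow> u j = 0)}"

definition multi_trace ::
    "(real^'n) set \<Rightarrow> nat \<Rightarrow> (real^'n) decomposition \<Rightarrow> (nat \<Rightarrow> real^'n \<Rightarrow> complex) set" where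
  "multi_trace \<Omega> k D =
     {q. (\<forall>j\<in>{1..num_sub D}. q j \<in> Vh_bd \<Omega> k D j) \<and> (\<forall>j. j \<notin> {1..num_sub D} \<longrightarrow> q j = 0)}"

definition to_broken ::
    "(real^'n) decomposition \<Rightarrow> (real^'n \<Rightarrow> complex) \<Rightarrow> nat \<Rightarrow> real^'n \<Rightarrow> complex" where
  "to_broken D v = (\<lambda>j. if j \<in> {1..num_sub D} then restr (closure (subdom D j)) v else 0)"

definition trace_on ::
    "(real^'n) decomposition \<Rightarrow> (nat \<Rightarrow> real^'n \<Rightarrow> complex) \<Rightarrow> nat \<Rightarrow> real^'n \<Rightarrow> complex" where
  "trace_on D u = (\<lambda>j. if j \<in> {1..num_sub D} then restr (frontier (subdom D j)) (u j) else 0)"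

definition single_trace ::
    "(real^'n) set \<Rightarrow> nat \<Rightarrow> (real^'n) decomposition \<Rightarrow> (nat \<Rightarrow> real^'n \<Rightarrow> complex) set" where
  "single_trace \<Omega> k D = (\<lambda>v. trace_on D (to_broken D v)) ` Vh \<Omega> k D"


subsection \<open>Norms and forms\<close>

text \<open>
  A continuous piecewise polynomial function is differentiable in the interior of every cell,
  hence almost everywhere, and there its classical gradient is its weak gradient.
\<close>

definition grad :: "(real^'n \<Rightarrow> complex) \<Rightarrow> real^'n \<Rightarrow> complex^'n" where
  "grad v x = (\<chi> i. frechet_derivative v (at x) (axis i 1))"

definition h1_norm :: "real \<Rightarrow> (real^'n) set \<Rightarrow> (real^'n \<Rightarrow> complex) \<Rightarrow> real" where
  "h1_norm kinf \<omega> v =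
     sqrt ((LINT x:\<omega>|lebesgue. (norm (grad v x))\<^sup>2) + kinf\<^sup>2 * (LINT x:\<omega>|lebesgue. (cmod (v x))\<^sup>2))"

definition broken_h1_norm ::
    "real \<Rightarrow> (real^'n) decomposition \<Rightarrow> (nat \<Rightarrow> real^'n \<Rightarrow> complex) \<Rightarrow> real" where
  "broken_h1_norm kinf D u = sqrt (\<Sum>j=1..num_sub D. (h1_norm kinf (subdom D j) (u j))\<^sup>2)"

text \<open>The infimum below is a minimum: the affine space of liftings is finite-dimensional.\<close>

definition rho_norm ::
    "(real^'n) set \<Rightarrow> (real^'n \<Rightarrow> complex) \<Rightarrow> nat \<Rightarrow> (real^'n) decomposition \<Rightarrow>
     (nat \<Rightarrow> real^'n \<Rightarrow> complex) \<Rightarrow> real" where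
  "rho_norm \<Omega> \<kappa> k D q =
     sqrt (\<Sum>j=1..num_sub D.
       INF v\<in>{v \<in> Vh_sub \<Omega> k D j. restr (frontier (subdom D j)) v = q j}.
         (h1_norm (kappa_inf \<Omega> \<kappa>) (subdom D j) v)\<^sup>2)"

definition form_a ::
    "(real^'n) set \<Rightarrow> (real^'n \<Rightarrow> complex) \<Rightarrow> (real^'n \<Rightarrow> real) \<Rightarrow> (real^'n) decomposition \<Rightarrow>
     (nat \<Rightarrow> real^'n \<Rightarrow> complex) \<Rightarrow> (nat \<Rightarrow> real^'n \<Rightarrow> complex) \<Rightarrow> complex" where
  "form_a \<Omega> \<kappa> \<mu> D u v =
     (\<Sum>j=1..num_sub D.
        (LINT x:subdom D j|lebesgue.
           complex_of_real (\<mu> x) * (\<Sum>i\<in>UNIV. grad (u j) x $ i * cnj (grad (v j) x $ i))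
           - (\<kappa> x)\<^sup>2 * u j x * cnj (v j x))
        - \<i> * (LINT x:(frontier (subdom D j) \<inter> frontier \<Omega>)|surface_measure.
                 \<kappa> x * u j x * cnj (v j x)))"

definition form_l ::
    "(real^'n) set \<Rightarrow> (real^'n \<Rightarrow> complex) \<Rightarrow> (real^'n \<Rightarrow> complex) \<Rightarrow> (real^'n) decomposition \<Rightarrow>
     (nat \<Rightarrow> real^'n \<Rightarrow> complex) \<Rightarrow> complex" where
  "form_l \<Omega> f g D v =
     (\<Sum>j=1..num_sub D.
        (LINT x:subdom D j|lebesgue. f x * cnj (v j x))
        + (LINT x:(frontier (subdom D j) \<inter> frontier \<Omega>)|surface_measure. g x * cnj (v j x)))"

definition infsup_alpha ::
    "(real^'n) set \<Rightarrow> (real^'n \<Rightarrow> complex) \<Rightarrow> (real^'n \<Rightarrow> real) \<Rightarrow> nat \<Rightarrow> (real^'n) decomposition \<Rightarrow>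
     ereal" where
  "infsup_alpha \<Omega> \<kappa> \<mu> k D =
     (INF u\<in>Vh \<Omega> k D - {0}. SUP v\<in>Vh \<Omega> k D - {0}.
        ereal (cmod (form_a \<Omega> \<kappa> \<mu> D (to_broken D u) (to_broken D v)) /
               (h1_norm (kappa_inf \<Omega> \<kappa>) \<Omega> u * h1_norm (kappa_inf \<Omega> \<kappa>) \<Omega> v)))"

text \<open>
  Norm of the form \<open>a\<close> on the broken finite element space.  The coefficients alone do not
  bound it uniformly in \<open>h\<close> when the subdomains depend on \<open>h\<close>: because of the boundary
  integral it involves the trace constants of the subdomains touching the boundary, which
  degenerate for thin subdomains.
\<close>

definition cont_modulus ::
    "(real^'n) set \<Rightarrow> (real^'n \<Rightarrow> complex) \<Rightarrow> (real^'n \<Rightarrow> real) \<Rightarrow> nat \<Rightarrow> (real^'n) decomposition \<Rightarrow>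
     ereal" where
  "cont_modulus \<Omega> \<kappa> \<mu> k D =
     (SUP u\<in>broken_Vh \<Omega> k D - {0}. SUP v\<in>broken_Vh \<Omega> k D - {0}.
        ereal (cmod (form_a \<Omega> \<kappa> \<mu> D u v) /
               (broken_h1_norm (kappa_inf \<Omega> \<kappa>) D u * broken_h1_norm (kappa_inf \<Omega> \<kappa>) D v)))"


subsection \<open>Impedance and exchange operator\<close>

definition is_scalar_product ::
    "(nat \<Rightarrow> 'a \<Rightarrow> complex) set \<Rightarrow>
     ((nat \<Rightarrow> 'a \<Rightarrow> complex) \<Rightarrow> (nat \<Rightarrow> 'a \<Rightarrow> complex) \<Rightarrow> complex) \<Rightarrow> bool" where
  "is_scalar_product X t \<longleftrightarrow>
     (\<forall>x\<in>X. \<forall>y\<in>X. \<forall>z\<in>X. t (x + y) z = t x z + t y z) \<and>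
     (\<forall>c. \<forall>x\<in>X. \<forall>y\<in>X. t (cmul c x) y = c * t x y) \<and>
     (\<forall>x\<in>X. \<forall>y\<in>X. t y x = cnj (t x y)) \<and>
     (\<forall>x\<in>X. x \<noteq> 0 \<longrightarrow> Re (t x x) > 0)"

definition t_norm ::
    "((nat \<Rightarrow> 'a \<Rightarrow> complex) \<Rightarrow> (nat \<Rightarrow> 'a \<Rightarrow> complex) \<Rightarrow> complex) \<Rightarrow> (nat \<Rightarrow> 'a \<Rightarrow> complex) \<Rightarrow> real" where
  "t_norm t w = sqrt (Re (t w w))"

definition orthogonal_projector ::
    "((nat \<Rightarrow> 'a \<Rightarrow> complex) \<Rightarrow> (nat \<Rightarrow> 'a \<Rightarrow> complex) \<Rightarrow> complex) \<Rightarrow>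
     (nat \<Rightarrow> 'a \<Rightarrow> complex) set \<Rightarrow> (nat \<Rightarrow> 'a \<Rightarrow> complex) set \<Rightarrow>
     ((nat \<Rightarrow> 'a \<Rightarrow> complex) \<Rightarrow> (nat \<Rightarrow> 'a \<Rightarrow> complex)) \<Rightarrow> bool" where
  "orthogonal_projector t X Y P \<longleftrightarrow> (\<forall>q\<in>X. P q \<in> Y \<and> (\<forall>y\<in>Y. t (q - P q) y = 0))"

definition exchange_operator ::
    "(real^'n) set \<Rightarrow> nat \<Rightarrow> (real^'n) decomposition \<Rightarrow>
     ((nat \<Rightarrow> real^'n \<Rightarrow> complex) \<Rightarrow> (nat \<Rightarrow> real^'n \<Rightarrow> complex) \<Rightarrow> complex) \<Rightarrow>
     ((nat \<Rightarrow> real^'n \<Rightarrow> complex) \<Rightarrow> (nat \<Rightarrow> real^'n \<Rightarrow> complex)) \<Rightarrow> bool" where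
  "exchange_operator \<Omega> k D t Pih \<longleftrightarrow>
     Pih ` multi_trace \<Omega> k D \<subseteq> multi_trace \<Omega> k D \<and>
     orthogonal_projector t (multi_trace \<Omega> k D) (single_trace \<Omega> k D) (\<lambda>q. cmul (1/2) (q + Pih q))"

definition lambda_minus ::
    "(real^'n) set \<Rightarrow> (real^'n \<Rightarrow> complex) \<Rightarrow> nat \<Rightarrow> (real^'n) decomposition \<Rightarrow>
     ((nat \<Rightarrow> real^'n \<Rightarrow> complex) \<Rightarrow> (nat \<Rightarrow> real^'n \<Rightarrow> complex) \<Rightarrow> complex) \<Rightarrow> ereal" where
  "lambda_minus \<Omega> \<kappa> k D t =
     (INF w\<in>multi_trace \<Omega> k D - {0}. ereal (t_norm t w / rho_norm \<Omega> \<kappa> k D w))"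

definition lambda_plus ::
    "(real^'n) set \<Rightarrow> (real^'n \<Rightarrow> complex) \<Rightarrow> nat \<Rightarrow> (real^'n) decomposition \<Rightarrow>
     ((nat \<Rightarrow> real^'n \<Rightarrow> complex) \<Rightarrow> (nat \<Rightarrow> real^'n \<Rightarrow> complex) \<Rightarrow> complex) \<Rightarrow> ereal" where
  "lambda_plus \<Omega> \<kappa> k D t =
     (SUP w\<in>multi_trace \<Omega> k D - {0}. ereal (t_norm t w / rho_norm \<Omega> \<kappa> k D w))"


subsection \<open>Local solves, scattering operator and skeleton equation\<close>

definition solves_local ::
    "(real^'n) set \<Rightarrow> (real^'n \<Rightarrow> complex) \<Rightarrow> (real^'n \<Rightarrow> real) \<Rightarrow> nat \<Rightarrow> (real^'n) decomposition \<Rightarrow>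
     ((nat \<Rightarrow> real^'n \<Rightarrow> complex) \<Rightarrow> (nat \<Rightarrow> real^'n \<Rightarrow> complex) \<Rightarrow> complex) \<Rightarrow>
     ((nat \<Rightarrow> real^'n \<Rightarrow> complex) \<Rightarrow> complex) \<Rightarrow> (nat \<Rightarrow> real^'n \<Rightarrow> complex) \<Rightarrow> bool" where
  "solves_local \<Omega> \<kappa> \<mu> k D t L w \<longleftrightarrow>
     w \<in> broken_Vh \<Omega> k D \<and>
     (\<forall>v\<in>broken_Vh \<Omega> k D.
        form_a \<Omega> \<kappa> \<mu> D w v - \<i> * t (trace_on D w) (trace_on D v) = L v)"

definition local_solution ::
    "(real^'n) set \<Rightarrow> (real^'n \<Rightarrow> complex) \<Rightarrow> (real^'n \<Rightarrow> real) \<Rightarrow> nat \<Rightarrow> (real^'n) decomposition \<Rightarrow>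
     ((nat \<Rightarrow> real^'n \<Rightarrow> complex) \<Rightarrow> (nat \<Rightarrow> real^'n \<Rightarrow> complex) \<Rightarrow> complex) \<Rightarrow>
     ((nat \<Rightarrow> real^'n \<Rightarrow> complex) \<Rightarrow> complex) \<Rightarrow> nat \<Rightarrow> real^'n \<Rightarrow> complex" where
  "local_solution \<Omega> \<kappa> \<mu> k D t L = (THE w. solves_local \<Omega> \<kappa> \<mu> k D t L w)"

definition scattering ::
    "(real^'n) set \<Rightarrow> (real^'n \<Rightarrow> complex) \<Rightarrow> (real^'n \<Rightarrow> real) \<Rightarrow> nat \<Rightarrow> (real^'n) decomposition \<Rightarrow>
     ((nat \<Rightarrow> real^'n \<Rightarrow> complex) \<Rightarrow> (nat \<Rightarrow> real^'n \<Rightarrow> complex) \<Rightarrow> complex) \<Rightarrow>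
     (nat \<Rightarrow> real^'n \<Rightarrow> complex) \<Rightarrow> nat \<Rightarrow> real^'n \<Rightarrow> complex" where
  "scattering \<Omega> \<kappa> \<mu> k D t p =
     p + cmul (2 * \<i>) (trace_on D (local_solution \<Omega> \<kappa> \<mu> k D t (\<lambda>v. t p (trace_on D v))))"

definition skeleton_rhs ::
    "(real^'n) set \<Rightarrow> (real^'n \<Rightarrow> complex) \<Rightarrow> (real^'n \<Rightarrow> real) \<Rightarrow>
     (real^'n \<Rightarrow> complex) \<Rightarrow> (real^'n \<Rightarrow> complex) \<Rightarrow> nat \<Rightarrow> (real^'n) decomposition \<Rightarrow>
     ((nat \<Rightarrow> real^'n \<Rightarrow> complex) \<Rightarrow> (nat \<Rightarrow> real^'n \<Rightarrow> complex) \<Rightarrow> complex) \<Rightarrow>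
     ((nat \<Rightarrow> real^'n \<Rightarrow> complex) \<Rightarrow> (nat \<Rightarrow> real^'n \<Rightarrow> complex)) \<Rightarrow>
     nat \<Rightarrow> real^'n \<Rightarrow> complex" where
  "skeleton_rhs \<Omega> \<kappa> \<mu> f g k D t Pih =
     cmul (- 2 * \<i>) (Pih (trace_on D (local_solution \<Omega> \<kappa> \<mu> k D t (form_l \<Omega> f g D))))"

definition skeleton_solution ::
    "(real^'n) set \<Rightarrow> (real^'n \<Rightarrow> complex) \<Rightarrow> (real^'n \<Rightarrow> real) \<Rightarrow>
     (real^'n \<Rightarrow> complex) \<Rightarrow> (real^'n \<Rightarrow> complex) \<Rightarrow> nat \<Rightarrow> (real^'n) decomposition \<Rightarrow>
     ((nat \<Rightarrow> real^'n \<Rightarrow> complex) \<Rightarrow> (nat \<Rightarrow> real^'n \<Rightarrow> complex) \<Rightarrow> complex) \<Rightarrow>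
     ((nat \<Rightarrow> real^'n \<Rightarrow> complex) \<Rightarrow> (nat \<Rightarrow> real^'n \<Rightarrow> complex)) \<Rightarrow>
     nat \<Rightarrow> real^'n \<Rightarrow> complex" where
  "skeleton_solution \<Omega> \<kappa> \<mu> f g k D t Pih =
     (THE p. p \<in> multi_trace \<Omega> k D \<and>
        p + Pih (scattering \<Omega> \<kappa> \<mu> k D t p) = skeleton_rhs \<Omega> \<kappa> \<mu> f g k D t Pih)"

definition gamma_h ::
    "(real^'n) set \<Rightarrow> (real^'n \<Rightarrow> complex) \<Rightarrow> (real^'n \<Rightarrow> real) \<Rightarrow> nat \<Rightarrow> (real^'n) decomposition \<Rightarrow>
     ((nat \<Rightarrow> real^'n \<Rightarrow> complex) \<Rightarrow> (nat \<Rightarrow> real^'n \<Rightarrow> complex) \<Rightarrow> complex) \<Rightarrow>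
     ((nat \<Rightarrow> real^'n \<Rightarrow> complex) \<Rightarrow> (nat \<Rightarrow> real^'n \<Rightarrow> complex)) \<Rightarrow> ereal" where
  "gamma_h \<Omega> \<kappa> \<mu> k D t Pih =
     (INF w\<in>multi_trace \<Omega> k D - {0}.
        ereal (t_norm t (w + Pih (scattering \<Omega> \<kappa> \<mu> k D t w)) / t_norm t w))"

end

theory Submission
  imports Defs
begin

text \<open>
  Subtracting the fixed point, the iteration becomes \<open>e \<mapsto> (1 - r) e - r T e\<close> with
  \<open>T = \<Pi> S\<close> on the multi-trace space with the norm of \<open>t\<close>.  Two facts give the rate.

  First, \<open>T\<close> is nonexpansive.  Testing the local problem that defines \<open>S p\<close> with its own solution
  \<open>w\<close> gives \<open>\<parallel>S p\<parallel>\<^sup>2 = \<parallel>p\<parallel>\<^sup>2 + 4 Im a(w,w)\<close>, and \<open>Im a(w,w) \<le> 0\<close> because the medium and the boundary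
  condition only absorb (\<open>tnorm_scatter_le\<close>); \<open>\<Pi>\<close> is an orthogonal reflection, hence an isometry.
  For a nonexpansive map the identity
  \<open>\<parallel>(1 - r) e - r T e\<parallel>\<^sup>2 = (1 - r) \<parallel>e\<parallel>\<^sup>2 + r \<parallel>T e\<parallel>\<^sup>2 - r (1 - r) \<parallel>e + T e\<parallel>\<^sup>2\<close>
  shows that one step multiplies \<open>\<parallel>e\<parallel>\<^sup>2\<close> by at most \<open>1 - r (1 - r) \<gamma>\<^sup>2\<close> as soon as
  \<open>\<parallel>(Id + T) e\<parallel> \<ge> \<gamma> \<parallel>e\<parallel>\<close> (\<open>relaxation_step\<close>).

  Second, \<open>Id + T\<close> is bounded below with a constant that depends only on the inf-sup constant, the
  norm of \<open>a\<close> and the two constants that compare \<open>t\<close> with the minimal extension norm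
  (\<open>skel_lower_bound\<close>).  Put \<open>f = (Id + T) p\<close>, let \<open>w\<close> be the local solution with data \<open>p\<close> and
  let \<open>P\<close> be the projector onto the single traces.  Then \<open>f - P f = -2 i (w - P w)\<close> on the skeleton,
  so the jump of \<open>w\<close> is controlled by \<open>f\<close>, and \<open>a(w,v) = t(f,v) / 2\<close> for every conforming \<open>v\<close>.  Removing
  from \<open>w\<close> a cheap lifting of its jump leaves a conforming function, to which the inf-sup condition
  applies; so \<open>w\<close> is controlled by \<open>f\<close>.  Testing the local problem with a lifting of \<open>p\<close> finally
  controls \<open>p\<close> by \<open>w\<close>.  As \<open>h \<rightarrow> 0\<close> the upper constants stay
  bounded and the lower ones bounded away from zero, so the lower bound is uniform.

  Both arguments are carried out in the abstract locale \<open>impedance_coupling\<close>.  That the finite element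
  spaces satisfy its axioms rests on three points: the integrals in \<open>a\<close> converge, for which the boundary
  must have finite surface measure (\<open>surface_measure_frontier_finite\<close>); the spaces are
  finite-dimensional, so that uniqueness gives solvability; and a broken function with a
  single-valued trace is conforming (\<open>gluing\<close>).
\<close>

section \<open>Linear algebra on finite-dimensional subspaces\<close>

context vector_space
begin

text \<open>
  The map \<open>s\<close> is the action of scalars on the target: multiplication for linear maps, multiplication
  with the conjugate for antilinear ones.
\<close>

lemma sum_additive_on:
  assumes U: "subspace U"
    and T: "\<And>x y. x \<in> U \<Longrightarrow> y \<in> U \<Longrightarrow> T (x + y) = T x + T y"
      "\<And>c x. x \<in> U \<Longrightarrow> T (scale c x) = s c (T x)"
    and z: "T 0 = 0" and "finite E" "E \<subseteq> U"
  shows "T (\<Sum>e\<in>E. scale (c e) e) = (\<Sum>e\<in>E. s (c e) (T e))"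
  using \<open>finite E\<close> \<open>E \<subseteq> U\<close>
proof (induction E)
  case (insert x F)
  have "(\<Sum>e\<in>F. scale (c e) e) \<in> U" "scale (c x) x \<in> U"
    using insert.prems U by (auto intro!: subspace_sum subspace_scale)
  then show ?case using insert T by simp
qed (simp add: z)

lemma finite_basis_of_subspace:
  assumes "subspace U" "finite G" "U \<subseteq> span G"
  obtains E where "finite E" "E \<subseteq> U" "independent E" "span E = U"
proof -
  obtain E where E: "E \<subseteq> U" "independent E" "U \<subseteq> span E"
    using maximal_independent_subset by blast
  have "finite E"
    using independent_span_bound[OF assms(2) E(2)] E(1) assms(3) by blast
  moreover have "span E = U"
    using E assms(1) by (simp add: span_minimal subset_antisym)
  ultimately show ?thesis using that E by blast
qed

text \<open>
  The map is linear only on the subspace, and the ambient function space is infinite-dimensional.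
  The image of a basis is independent of the same cardinality, so it must span: another
  independent vector would exceed the number of generators.
\<close>

lemma injective_imp_surjective_on_subspace:
  assumes U: "subspace U" and G: "finite G" "U \<subseteq> span G"
    and add: "\<And>x y. x \<in> U \<Longrightarrow> y \<in> U \<Longrightarrow> T (x + y) = T x + T y"
    and scale: "\<And>c x. x \<in> U \<Longrightarrow> T (scale c x) = scale c (T x)"
    and into: "\<And>x. x \<in> U \<Longrightarrow> T x \<in> U"
    and inj: "\<And>x. x \<in> U \<Longrightarrow> T x = 0 \<Longrightarrow> x = 0"
  shows "T ` U = U"
proof -
  obtain E where E: "finite E" "E \<subseteq> U" "independent E" "span E = U"
    using finite_basis_of_subspace[OF U G] .
  have T0: "T 0 = 0"
    using scale[of 0 0] subspace_0[OF U] by simp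
  have injT: "inj_on T U"
  proof (rule inj_onI)
    fix x y assume xy: "x \<in> U" "y \<in> U" "T x = T y"
    have "T (x + scale (-1) y) = T x + scale (-1) (T y)"
      using add[OF xy(1) subspace_scale[OF U xy(2)], of "-1"] scale[OF xy(2), of "-1"] by metis
    then have "T (x + scale (-1) y) = 0"
      using xy(3) by simp
    then have "x + scale (-1) y = 0"
      using inj[OF subspace_add[OF U xy(1) subspace_scale[OF U xy(2)]]] by blast
    then show "x = y" by simp
  qed
  have ind: "independent (T ` E)"
  proof
    assume "dependent (T ` E)"
    then obtain c v where c: "v \<in> T ` E" "c v \<noteq> 0" "(\<Sum>v\<in>T ` E. scale (c v) v) = 0"
      using E(1) by (auto simp: dependent_finite)
    have "0 = (\<Sum>e\<in>E. scale (c (T e)) (T e))"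
      using c(3) injT E(2) by (subst (asm) sum.reindex) (auto intro: inj_on_subset)
    also have "\<dots> = T (\<Sum>e\<in>E. scale (c (T e)) e)"
      using sum_additive_on[OF U add scale T0 E(1,2), of "\<lambda>e. c (T e)"] by simp
    finally have "T (\<Sum>e\<in>E. scale (c (T e)) e) = 0" by simp
    moreover have "(\<Sum>e\<in>E. scale (c (T e)) e) \<in> U"
      using E(2) U by (auto intro!: subspace_sum subspace_scale)
    ultimately have "(\<Sum>e\<in>E. scale (c (T e)) e) = 0"
      using inj by blast
    then have "\<forall>e\<in>E. c (T e) = 0"
      using E(1,3) dependent_finite[OF E(1)] by metis
    then show False using c by auto
  qed
  have "card (T ` E) = card E"
    using injT E(2) by (meson card_image inj_on_subset)
  have "U \<subseteq> span (T ` E)"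
  proof (rule subsetI, rule ccontr)
    fix x assume x: "x \<in> U" "x \<notin> span (T ` E)"
    have "independent (insert x (T ` E))"
      using independent_insertI[OF x(2) ind] .
    moreover have "insert x (T ` E) \<subseteq> span E" unfolding E(4) using into E(2) x by auto
    ultimately have "card (insert x (T ` E)) \<le> card E"
      using independent_span_bound[OF E(1)] by blast
    moreover have "x \<notin> T ` E" using x(2) span_base by blast
    ultimately show False
      using E(1) \<open>card (T ` E) = card E\<close> by simp
  qed
  moreover have "subspace (T ` U)"
  proof (rule subspaceI)
    show "0 \<in> T ` U" using imageI[OF subspace_0[OF U], of T] T0 by simp
    show "x + y \<in> T ` U" if "x \<in> T ` U" "y \<in> T ` U" for x y
      using that add[symmetric] subspace_add[OF U] by fastforce
    show "scale c x \<in> T ` U" if "x \<in> T ` U" for c x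
      using that scale[symmetric] subspace_scale[OF U] by fastforce
  qed
  then have "span (T ` E) \<subseteq> T ` U"
    using E(2) by (intro span_minimal) auto
  ultimately have "U \<subseteq> T ` U" by simp
  then show ?thesis using into by auto
qed

end

text \<open>
  With a basis \<open>E\<close>, the map sending \<open>x\<close> to the combination of the \<open>e\<close> in \<open>E\<close> with coefficients \<open>\<beta> x e\<close> is an
  endomorphism, so the dual space never has to be mentioned; nondegeneracy is its injectivity.
  For a sesquilinear form \<open>s\<close> is conjugation.
\<close>

lemma (in vector_space) nondegenerate_form_solvable:
  fixes \<beta> :: "'b \<Rightarrow> 'b \<Rightarrow> 'a" and s :: "'a \<Rightarrow> 'a \<Rightarrow> 'a"
  assumes U: "subspace U" and G: "finite G" "U \<subseteq> span G"
    and add: "\<And>x y v. x \<in> U \<Longrightarrow> y \<in> U \<Longrightarrow> v \<in> U \<Longrightarrow> \<beta> (x + y) v = \<beta> x v + \<beta> y v"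
    and scale: "\<And>c x v. x \<in> U \<Longrightarrow> v \<in> U \<Longrightarrow> \<beta> (scale c x) v = c * \<beta> x v"
    and add': "\<And>x v w. x \<in> U \<Longrightarrow> v \<in> U \<Longrightarrow> w \<in> U \<Longrightarrow> \<beta> x (v + w) = \<beta> x v + \<beta> x w"
    and scale': "\<And>c x v. x \<in> U \<Longrightarrow> v \<in> U \<Longrightarrow> \<beta> x (scale c v) = s c (\<beta> x v)"
    and nondeg: "\<And>x. x \<in> U \<Longrightarrow> (\<And>v. v \<in> U \<Longrightarrow> \<beta> x v = 0) \<Longrightarrow> x = 0"
    and L: "\<And>v w. v \<in> U \<Longrightarrow> w \<in> U \<Longrightarrow> L (v + w) = L v + L w"
      "\<And>c v. v \<in> U \<Longrightarrow> L (scale c v) = s c (L v)"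
  shows "\<exists>x\<in>U. \<forall>v\<in>U. \<beta> x v = L v"
proof -
  obtain E where E: "finite E" "E \<subseteq> U" "independent E" "span E = U"
    using finite_basis_of_subspace[OF U G] .
  have U0: "0 \<in> U" using subspace_0[OF U] .
  have \<beta>0: "\<beta> x 0 = 0" if "x \<in> U" for x
    using add'[OF that U0 U0] by (metis add.right_neutral add_left_cancel)
  have L0: "L 0 = 0"
    using L(1)[OF U0 U0] by (metis add.right_neutral add_left_cancel)
  have expand: "\<exists>c. v = (\<Sum>e\<in>E. scale (c e) e)" if "v \<in> U" for v
    using that E span_finite[OF E(1)] by auto
  have coeff: "\<forall>e\<in>E. c e = d e" if "(\<Sum>e\<in>E. scale (c e) e) = (\<Sum>e\<in>E. scale (d e) e)" for c d
  proof -
    have "(\<Sum>e\<in>E. scale (c e - d e) e) = 0"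
      using that by (simp add: scale_left_diff_distrib sum_subtractf)
    then have "\<forall>e\<in>E. c e - d e = 0"
      using E(3) dependent_finite[OF E(1)] by metis
    then show ?thesis by simp
  qed
  define T where "T = (\<lambda>x. \<Sum>e\<in>E. scale (\<beta> x e) e)"
  have "T ` U = U"
  proof (rule injective_imp_surjective_on_subspace[OF U G])
    show "T (x + y) = T x + T y" if "x \<in> U" "y \<in> U" for x y
      unfolding T_def sum.distrib[symmetric]
      using that E(2) by (intro sum.cong) (auto simp: add scale_left_distrib)
    show "T (scale c x) = scale c (T x)" if "x \<in> U" for c x
      unfolding T_def scale_sum_right
      using that E(2) by (intro sum.cong) (auto simp: scale)
    show "T x \<in> U" for x
      unfolding T_def using E(2) U by (auto intro!: subspace_sum subspace_scale)
    show "x = 0" if x: "x \<in> U" "T x = 0" for x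
    proof (rule nondeg[OF x(1)])
      fix v assume "v \<in> U"
      then obtain c where c: "v = (\<Sum>e\<in>E. scale (c e) e)" using expand by blast
      have "\<forall>e\<in>E. \<beta> x e = 0"
        using x(2) coeff[of "\<beta> x" "\<lambda>_. 0"] by (simp add: T_def)
      moreover have "s c 0 = 0" for c
        using scale'[OF x(1) U0, of c] \<beta>0[OF x(1)] by simp
      ultimately show "\<beta> x v = 0"
        unfolding c
        using sum_additive_on[OF U add'[OF x(1)] scale'[OF x(1)] \<beta>0[OF x(1)] E(1,2), of c] by simp
    qed
  qed
  moreover have "(\<Sum>e\<in>E. scale (L e) e) \<in> U"
    using E(2) U by (auto intro!: subspace_sum subspace_scale)
  ultimately obtain x where x: "x \<in> U" "T x = (\<Sum>e\<in>E. scale (L e) e)"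
    by (metis imageE)
  have "\<beta> x v = L v" if "v \<in> U" for v
  proof -
    obtain c where c: "v = (\<Sum>e\<in>E. scale (c e) e)" using expand \<open>v \<in> U\<close> by blast
    have "\<forall>e\<in>E. \<beta> x e = L e"
      using x(2) coeff by (simp add: T_def)
    then show ?thesis
      unfolding c
      using sum_additive_on[OF U add'[OF x(1)] scale'[OF x(1)] \<beta>0[OF x(1)] E(1,2), of c]
        sum_additive_on[OF U L L0 E(1,2), of c] by simp
  qed
  then show ?thesis using x(1) by blast
qed

section \<open>Coupling of local problems through an impedance\<close>

text \<open>
  \<open>B\<close> is the space of broken functions, \<open>V\<close> its conforming subspace, \<open>M\<close> and \<open>S\<close> are the spaces of
  multi-traces and of single traces.  Assumption \<open>conforming\<close> is the link between them: single-valued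
  traces characterise conforming functions.  The last assumptions
  say that \<open>(Id + Pi)/2\<close> is the orthogonal projector onto \<open>S\<close>; linearity and isometry of \<open>Pi\<close> follow.
\<close>

locale impedance_coupling = vector_space scale
  for scale :: "complex \<Rightarrow> 'v::ab_group_add \<Rightarrow> 'v" +
  fixes B M V S :: "'v set" and tr :: "'v \<Rightarrow> 'v" and a t :: "'v \<Rightarrow> 'v \<Rightarrow> complex"
    and Pi :: "'v \<Rightarrow> 'v"
  assumes B: "subspace B" and V: "subspace V" and fin_dim: "\<exists>G. finite G \<and> B \<subseteq> span G"
    and tr_add: "\<And>u v. u \<in> B \<Longrightarrow> v \<in> B \<Longrightarrow> tr (u + v) = tr u + tr v"
    and tr_scale: "\<And>c u. u \<in> B \<Longrightarrow> tr (scale c u) = scale c (tr u)"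
    and tr_image: "tr ` B = M" and S_def: "S = tr ` V"
    and V_subset: "V \<subseteq> B" and conforming: "\<And>b. b \<in> B \<Longrightarrow> tr b \<in> S \<Longrightarrow> b \<in> V"
    and a_add: "\<And>u v w. u \<in> B \<Longrightarrow> v \<in> B \<Longrightarrow> w \<in> B \<Longrightarrow> a (u + v) w = a u w + a v w"
    and a_scale: "\<And>c u v. u \<in> B \<Longrightarrow> v \<in> B \<Longrightarrow> a (scale c u) v = c * a u v"
    and a_add_right: "\<And>u v w. u \<in> B \<Longrightarrow> v \<in> B \<Longrightarrow> w \<in> B \<Longrightarrow> a u (v + w) = a u v + a u w"
    and a_scale_right: "\<And>c u v. u \<in> B \<Longrightarrow> v \<in> B \<Longrightarrow> a u (scale c v) = cnj c * a u v"
    and a_dissipative: "\<And>u. u \<in> B \<Longrightarrow> Im (a u u) \<le> 0"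
    and a_injective: "\<And>u. u \<in> V \<Longrightarrow> (\<And>v. v \<in> V \<Longrightarrow> a u v = 0) \<Longrightarrow> u = 0"
    and t_add: "\<And>x y z. x \<in> M \<Longrightarrow> y \<in> M \<Longrightarrow> z \<in> M \<Longrightarrow> t (x + y) z = t x z + t y z"
    and t_scale: "\<And>c x y. x \<in> M \<Longrightarrow> y \<in> M \<Longrightarrow> t (scale c x) y = c * t x y"
    and t_sym: "\<And>x y. x \<in> M \<Longrightarrow> y \<in> M \<Longrightarrow> t y x = cnj (t x y)"
    and t_pos: "\<And>x. x \<in> M \<Longrightarrow> x \<noteq> 0 \<Longrightarrow> 0 < Re (t x x)"
    and Pi_into: "\<And>q. q \<in> M \<Longrightarrow> Pi q \<in> M"
    and Pi_half: "\<And>q. q \<in> M \<Longrightarrow> scale (1/2) (q + Pi q) \<in> S"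
    and Pi_orth: "\<And>q s. q \<in> M \<Longrightarrow> s \<in> S \<Longrightarrow> t (q - scale (1/2) (q + Pi q)) s = 0"
begin

definition tnorm :: "'v \<Rightarrow> real" where "tnorm w = sqrt (Re (t w w))"

definition proj :: "'v \<Rightarrow> 'v" where "proj q = scale (1/2) (q + Pi q)"

definition solves :: "('v \<Rightarrow> complex) \<Rightarrow> 'v \<Rightarrow> bool" where
  "solves L w \<longleftrightarrow> w \<in> B \<and> (\<forall>v\<in>B. a w v - \<i> * t (tr w) (tr v) = L v)"

definition sol :: "('v \<Rightarrow> complex) \<Rightarrow> 'v" where "sol L = (THE w. solves L w)"

definition scatter :: "'v \<Rightarrow> 'v" where
  "scatter p = p + scale (2 * \<i>) (tr (sol (\<lambda>v. t p (tr v))))"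

lemma tr_zero: "tr 0 = 0"
  using tr_scale[OF subspace_0[OF B], of 0] by simp

lemma tr_image_subspace: "subspace (tr ` W)" if "subspace W" "W \<subseteq> B"
proof (rule subspaceI)
  show "0 \<in> tr ` W" using tr_zero subspace_0[OF that(1)] by (metis imageI)
  show "x + y \<in> tr ` W" if xy: "x \<in> tr ` W" "y \<in> tr ` W" for x y
  proof -
    obtain u v where uv: "u \<in> W" "v \<in> W" "x = tr u" "y = tr v" using xy by blast
    have "x + y = tr (u + v)"
      using uv tr_add that \<open>W \<subseteq> B\<close> by (simp add: subset_iff)
    then show ?thesis using uv subspace_add[OF \<open>subspace W\<close>] by blast
  qed
  show "scale c x \<in> tr ` W" if x: "x \<in> tr ` W" for c x
  proof -
    obtain u where u: "u \<in> W" "x = tr u" using x by blast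
    have "scale c x = tr (scale c u)"
      using u tr_scale \<open>W \<subseteq> B\<close> by (simp add: subset_iff)
    then show ?thesis using u subspace_scale[OF \<open>subspace W\<close>] by blast
  qed
qed

lemma M: "subspace M" and S: "subspace S"
  using tr_image_subspace[OF B] tr_image_subspace[OF V V_subset] by (auto simp: tr_image S_def)

lemma S_subset: "S \<subseteq> M"
  using V_subset by (auto simp: S_def simp flip: tr_image)

lemma tr_mem [simp]: "u \<in> B \<Longrightarrow> tr u \<in> M"
  using tr_image by blast

lemmas M_closed [simp] = subspace_add[OF M] subspace_diff[OF M] subspace_scale[OF M] subspace_0[OF M]
lemmas B_closed [simp] = subspace_add[OF B] subspace_diff[OF B] subspace_scale[OF B] subspace_0[OF B]

lemma S_mem [simp]: "s \<in> S \<Longrightarrow> s \<in> M"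
  using S_subset by blast

lemma tr_diff: "tr (u - v) = tr u - tr v" if "u \<in> B" "v \<in> B"
proof -
  have "tr (u - v + v) = tr (u - v) + tr v" using that by (intro tr_add) auto
  then show ?thesis by simp
qed

lemma a_diff: "a (u - v) w = a u w - a v w" if "u \<in> B" "v \<in> B" "w \<in> B"
proof -
  have "a (u - v + v) w = a (u - v) w + a v w" using that by (intro a_add) auto
  then show ?thesis by simp
qed

lemma t_diff: "t (x - y) z = t x z - t y z" if "x \<in> M" "y \<in> M" "z \<in> M"
proof -
  have "t (x - y + y) z = t (x - y) z + t y z" using that by (intro t_add) auto
  then show ?thesis by simp
qed

lemma t_add_right: "t z (x + y) = t z x + t z y" if "x \<in> M" "y \<in> M" "z \<in> M"
proof -
  have "t z (x + y) = cnj (t (x + y) z)" using that by (intro t_sym) auto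
  also have "\<dots> = cnj (t x z) + cnj (t y z)" using that by (simp add: t_add)
  also have "\<dots> = t z x + t z y" using that by (metis t_sym)
  finally show ?thesis .
qed

lemma t_diff_right: "t z (x - y) = t z x - t z y" if "x \<in> M" "y \<in> M" "z \<in> M"
proof -
  have "t z (x - y + y) = t z (x - y) + t z y" using that by (intro t_add_right) auto
  then show ?thesis by simp
qed

lemma t_scale_right: "t z (scale c x) = cnj c * t z x" if "x \<in> M" "z \<in> M"
proof -
  have "t z (scale c x) = cnj (t (scale c x) z)" using that by (intro t_sym) auto
  also have "\<dots> = cnj c * cnj (t x z)" using that by (simp add: t_scale)
  also have "\<dots> = cnj c * t z x" using that by (metis t_sym)
  finally show ?thesis .
qed

lemmas t_expand = t_add t_diff t_scale t_add_right t_diff_right t_scale_right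

lemma t_zero: "x \<in> M \<Longrightarrow> t 0 x = 0" "x \<in> M \<Longrightarrow> t x 0 = 0"
  using t_scale[of x x 0] t_scale_right[of x x 0] by simp_all

lemma t_self: "x \<in> M \<Longrightarrow> t x x = of_real ((tnorm x)\<^sup>2)" "x \<in> M \<Longrightarrow> 0 \<le> Re (t x x)"
proof -
  assume x: "x \<in> M"
  show pos: "0 \<le> Re (t x x)"
    using t_pos[OF x] t_zero(1)[OF x] by (cases "x = 0") (auto intro: less_imp_le)
  have "Im (t x x) = - Im (t x x)"
    using t_sym[OF x x] by (metis cnj.simps(2))
  then have "t x x = of_real (Re (t x x))"
    by (simp add: complex_eq_iff)
  then show "t x x = of_real ((tnorm x)\<^sup>2)"
    using pos by (simp add: tnorm_def)
qed

lemma tnorm_sq: "x \<in> M \<Longrightarrow> (tnorm x)\<^sup>2 = Re (t x x)"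
  using t_self by (simp add: tnorm_def)

lemma tnorm_nonneg [simp]: "x \<in> M \<Longrightarrow> 0 \<le> tnorm x"
  using t_self by (simp add: tnorm_def)

lemma tnorm_pos: "x \<in> M \<Longrightarrow> x \<noteq> 0 \<Longrightarrow> 0 < tnorm x"
  using t_pos by (simp add: tnorm_def)

lemma tnorm_zero [simp]: "tnorm 0 = 0"
  using t_zero(1)[of 0] by (simp add: tnorm_def)

lemma tnorm_zero_iff: "x \<in> M \<Longrightarrow> tnorm x = 0 \<longleftrightarrow> x = 0"
  using tnorm_pos[of x] by fastforce

lemma Re_t_commute: "x \<in> M \<Longrightarrow> y \<in> M \<Longrightarrow> Re (t y x) = Re (t x y)"
  using t_sym[of x y] by simp

lemma tnorm_add_sq:
  "x \<in> M \<Longrightarrow> y \<in> M \<Longrightarrow> (tnorm (x + y))\<^sup>2 = (tnorm x)\<^sup>2 + 2 * Re (t x y) + (tnorm y)\<^sup>2"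
  using Re_t_commute[of x y] by (simp add: tnorm_sq t_expand)

lemma tnorm_scale: "x \<in> M \<Longrightarrow> tnorm (scale c x) = cmod c * tnorm x"
proof (rule power2_eq_imp_eq)
  assume x: "x \<in> M"
  have "t (scale c x) (scale c x) = of_real ((cmod c)\<^sup>2 * (tnorm x)\<^sup>2)"
    using x t_self(1)[OF x] complex_norm_square[of c] by (simp add: t_expand mult.assoc)
  then show "(tnorm (scale c x))\<^sup>2 = (cmod c * tnorm x)\<^sup>2"
    using x by (simp add: tnorm_sq power_mult_distrib)
qed auto

lemma tnorm_real_combination:
  assumes "x \<in> M" "y \<in> M"
  shows "(tnorm (scale (of_real b) x + scale (of_real c) y))\<^sup>2
    = b\<^sup>2 * (tnorm x)\<^sup>2 + 2 * b * c * Re (t x y) + c\<^sup>2 * (tnorm y)\<^sup>2"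
  using assms by (simp add: tnorm_add_sq tnorm_scale t_scale t_scale_right power_mult_distrib)

lemma t_Cauchy_Schwarz:
  assumes x: "x \<in> M" and y: "y \<in> M"
  shows "cmod (t x y) \<le> tnorm x * tnorm y"
proof (cases "y = 0")
  case False
  define N where "N = (tnorm y)\<^sup>2"
  have N: "N > 0" "t y y = of_real N"
    using tnorm_pos[OF y False] t_self(1)[OF y] by (auto simp: N_def)
  define z where "z = x - scale (t x y / of_real N) y"
  have z: "z \<in> M" using x y by (simp add: z_def)
  have "t y x = cnj (t x y)" by (rule t_sym[OF x y])
  then have "t z z = t x x - t x y * cnj (t x y) / of_real N"
    using x y N by (simp add: z_def t_expand algebra_simps)
  also have "\<dots> = of_real ((tnorm x)\<^sup>2 - (cmod (t x y))\<^sup>2 / N)"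
    using t_self(1)[OF x] complex_norm_square[of "t x y"] by simp
  finally have "0 \<le> (tnorm x)\<^sup>2 - (cmod (t x y))\<^sup>2 / N"
    using t_self(2)[OF z] by simp
  then have "(cmod (t x y))\<^sup>2 \<le> (tnorm x * tnorm y)\<^sup>2"
    using N(1) by (simp add: field_simps N_def)
  then show ?thesis
    by (rule power2_le_imp_le) (use x y in auto)
qed (use x in \<open>simp add: t_zero tnorm_def\<close>)

subsection \<open>Local problems\<close>

lemma tr_solves_norm:
  assumes p: "p \<in> M" and w: "solves (\<lambda>v. t p (tr v)) w"
  shows "a w w - \<i> * of_real ((tnorm (tr w))\<^sup>2) = t p (tr w)"
proof -
  have "a w w - \<i> * t (tr w) (tr w) = t p (tr w)" "w \<in> B"
    using w by (simp_all add: solves_def)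
  then show ?thesis using t_self(1)[of "tr w"] by simp
qed

text \<open>
  Dissipation forces the trace of a homogeneous solution to vanish.  It is then conforming, and the
  injectivity of \<open>a\<close> on conforming functions finishes the argument.
\<close>

lemma solves_zero_unique:
  assumes w: "solves (\<lambda>v. 0) w"
  shows "w = 0"
proof -
  have wB: "w \<in> B" using w by (simp add: solves_def)
  have "a w w - \<i> * t (tr w) (tr w) = 0" using w wB by (simp add: solves_def)
  then have "a w w = \<i> * of_real ((tnorm (tr w))\<^sup>2)"
    using t_self(1)[of "tr w"] wB by simp
  then have "(tnorm (tr w))\<^sup>2 \<le> 0"
    using a_dissipative[OF wB] by simp
  then have tr0: "tr w = 0"
    using tnorm_zero_iff[of "tr w"] wB by simp
  then have wV: "w \<in> V"
    using conforming[OF wB] subspace_0[OF S] by simp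
  show "w = 0"
  proof (rule a_injective[OF wV])
    fix v assume "v \<in> V"
    then have v: "v \<in> B" using V_subset by blast
    then show "a w v = 0" using w tr0 t_zero(1)[of "tr v"] by (simp add: solves_def)
  qed
qed

lemma solves_diff:
  assumes "solves L w" "solves L' w'"
  shows "solves (\<lambda>v. L v - L' v) (w - w')"
proof -
  have w: "w \<in> B" "w' \<in> B" using assms by (auto simp: solves_def)
  have "a (w - w') v - \<i> * t (tr (w - w')) (tr v) = L v - L' v" if v: "v \<in> B" for v
  proof -
    have eq: "L v = a w v - \<i> * t (tr w) (tr v)" "L' v = a w' v - \<i> * t (tr w') (tr v)"
      using assms v by (auto simp: solves_def)
    show ?thesis
      using w v unfolding eq by (simp add: a_diff tr_diff t_diff right_diff_distrib)
  qed
  then show ?thesis using w by (simp add: solves_def)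
qed

lemma solves_add:
  assumes "solves L w" "solves L' w'"
  shows "solves (\<lambda>v. L v + L' v) (w + w')"
proof -
  have w: "w \<in> B" "w' \<in> B" using assms by (auto simp: solves_def)
  have "a (w + w') v - \<i> * t (tr (w + w')) (tr v) = L v + L' v" if v: "v \<in> B" for v
  proof -
    have eq: "L v = a w v - \<i> * t (tr w) (tr v)" "L' v = a w' v - \<i> * t (tr w') (tr v)"
      using assms v by (auto simp: solves_def)
    show ?thesis
      using w v unfolding eq by (simp add: a_add tr_add t_add distrib_left)
  qed
  then show ?thesis using w by (simp add: solves_def)
qed

lemma solves_scale:
  assumes "solves L w"
  shows "solves (\<lambda>v. c * L v) (scale c w)"
proof -
  have w: "w \<in> B" using assms by (auto simp: solves_def)
  have "a (scale c w) v - \<i> * t (tr (scale c w)) (tr v) = c * L v" if v: "v \<in> B" for v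
  proof -
    have eq: "L v = a w v - \<i> * t (tr w) (tr v)"
      using assms v by (auto simp: solves_def)
    show ?thesis
      using w v unfolding eq by (simp add: a_scale tr_scale t_scale right_diff_distrib)
  qed
  then show ?thesis using w by (simp add: solves_def)
qed

lemma solves_unique: "solves L w \<Longrightarrow> solves L w' \<Longrightarrow> w = w'"
  using solves_zero_unique[of "w - w'"] solves_diff[of L w L w'] by simp

lemma sol_eq: "solves L w \<Longrightarrow> sol L = w"
  unfolding sol_def by (rule the_equality) (auto intro: solves_unique)

lemma solves_exists:
  assumes "\<And>v w. v \<in> B \<Longrightarrow> w \<in> B \<Longrightarrow> L (v + w) = L v + L w"
    and "\<And>c v. v \<in> B \<Longrightarrow> L (scale c v) = cnj c * L v"
  shows "solves L (sol L)"
proof -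
  obtain G where G: "finite G" "B \<subseteq> span G" using fin_dim by blast
  have "\<exists>x\<in>B. \<forall>v\<in>B. a x v - \<i> * t (tr x) (tr v) = L v"
  proof (rule nondegenerate_form_solvable[OF B G, where s = "\<lambda>c. (*) (cnj c)"])
    show "x = 0" if "x \<in> B" "\<And>v. v \<in> B \<Longrightarrow> a x v - \<i> * t (tr x) (tr v) = 0" for x
      using that by (intro solves_zero_unique) (simp add: solves_def)
  qed (simp_all add: assms a_add a_add_right a_scale a_scale_right tr_add tr_scale t_expand
        algebra_simps)
  then obtain w where "solves L w" by (auto simp: solves_def)
  then show ?thesis using sol_eq by simp
qed

abbreviation local_sol :: "'v \<Rightarrow> 'v" where "local_sol p \<equiv> sol (\<lambda>v. t p (tr v))"

lemma local_sol: "p \<in> M \<Longrightarrow> solves (\<lambda>v. t p (tr v)) (local_sol p)"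
  by (rule solves_exists) (simp_all add: tr_add tr_scale t_expand)

lemma local_sol_mem [simp]: "p \<in> M \<Longrightarrow> local_sol p \<in> B"
  using local_sol by (simp add: solves_def)

lemma solves_cong: "(\<And>v. v \<in> B \<Longrightarrow> L v = L' v) \<Longrightarrow> solves L w \<longleftrightarrow> solves L' w"
  by (auto simp: solves_def)

lemma local_sol_add: "local_sol (p + q) = local_sol p + local_sol q" if "p \<in> M" "q \<in> M"
  using solves_add[OF local_sol local_sol, OF that] that
  by (intro sol_eq) (simp add: t_add cong: solves_cong)

lemma local_sol_scale: "local_sol (scale c p) = scale c (local_sol p)" if "p \<in> M"
  using solves_scale[OF local_sol, OF that] that
  by (intro sol_eq) (simp add: t_scale cong: solves_cong)

subsection \<open>Scattering and exchange operators\<close>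

lemma scatter_mem [simp]: "p \<in> M \<Longrightarrow> scatter p \<in> M"
  by (simp add: scatter_def)

lemma scatter_add: "p \<in> M \<Longrightarrow> q \<in> M \<Longrightarrow> scatter (p + q) = scatter p + scatter q"
  by (simp add: scatter_def local_sol_add tr_add scale_right_distrib)

lemma scatter_scale: "p \<in> M \<Longrightarrow> scatter (scale c p) = scale c (scatter p)"
  by (simp add: scatter_def local_sol_scale tr_scale scale_right_distrib mult.commute)

text \<open>
  Energy balance: testing the local problem with its own solution shows that the outgoing
  energy is the incoming one plus \<open>4 Im a(w,w)\<close>, the (nonpositive) absorption.
\<close>

lemma tnorm_scatter_le:
  assumes p: "p \<in> M"
  shows "tnorm (scatter p) \<le> tnorm p"
proof -
  define w where "w = local_sol p"
  have w: "solves (\<lambda>v. t p (tr v)) w" "w \<in> B"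
    using local_sol[OF p] by (auto simp: w_def solves_def)
  have "Re (t p (scale (2 * \<i>) (tr w))) = 2 * Im (t p (tr w))"
    using p w by (simp add: t_scale_right)
  moreover have "Im (t p (tr w)) = Im (a w w) - (tnorm (tr w))\<^sup>2"
    using tr_solves_norm[OF p w(1)] by (metis Im_i_times Re_complex_of_real minus_complex.simps(2))
  ultimately have "(tnorm (scatter p))\<^sup>2 = (tnorm p)\<^sup>2 + 4 * Im (a w w)"
    using p w tnorm_scale[of "tr w" "2 * \<i>"]
    by (simp add: scatter_def tnorm_add_sq power_mult_distrib norm_mult flip: w_def)
  then have "(tnorm (scatter p))\<^sup>2 \<le> (tnorm p)\<^sup>2"
    using a_dissipative[OF w(2)] by simp
  then show ?thesis
    by (rule power2_le_imp_le) (use p in auto)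
qed

lemma proj_mem: "q \<in> M \<Longrightarrow> proj q \<in> S"
  using Pi_half by (simp add: proj_def)

lemma proj_orth: "q \<in> M \<Longrightarrow> s \<in> S \<Longrightarrow> t (q - proj q) s = 0"
  using Pi_orth by (simp add: proj_def)

lemma proj_orth': "q \<in> M \<Longrightarrow> s \<in> S \<Longrightarrow> t s (q - proj q) = 0"
  using proj_orth t_sym[of "q - proj q" s] by (simp add: proj_mem)

lemma Pi_eq: "Pi q = scale 2 (proj q) - q"
  by (simp add: proj_def)

text \<open>
  Uniqueness of the orthogonal decomposition is what makes \<open>proj\<close>, and with it \<open>Pi\<close>, linear.
\<close>

lemma proj_unique:
  assumes q: "q \<in> M" and s: "s \<in> S" and orth: "\<And>y. y \<in> S \<Longrightarrow> t (q - s) y = 0"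
  shows "proj q = s"
proof -
  have d: "proj q - s \<in> S" using subspace_diff[OF S] proj_mem[OF q] s by simp
  have "t (proj q - s) (proj q - s) = t (q - s) (proj q - s) - t (q - proj q) (proj q - s)"
    using q s d proj_mem[OF q] by (simp add: t_expand)
  also have "\<dots> = 0" using orth[OF d] proj_orth[OF q d] by simp
  finally have "proj q - s = 0"
    using t_pos[of "proj q - s"] d by fastforce
  then show ?thesis by simp
qed

lemma proj_add: "proj (p + q) = proj p + proj q" if "p \<in> M" "q \<in> M"
proof (rule proj_unique)
  show "t (p + q - (proj p + proj q)) y = 0" if "y \<in> S" for y
    using proj_orth[OF \<open>p \<in> M\<close> that] proj_orth[OF \<open>q \<in> M\<close> that] \<open>p \<in> M\<close> \<open>q \<in> M\<close> that
      proj_mem by (simp add: t_expand)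
qed (use that subspace_add[OF S] proj_mem in auto)

lemma proj_scale: "proj (scale c p) = scale c (proj p)" if "p \<in> M"
proof (rule proj_unique)
  show "t (scale c p - scale c (proj p)) y = 0" if "y \<in> S" for y
    using proj_orth[OF \<open>p \<in> M\<close> that] \<open>p \<in> M\<close> that proj_mem by (simp add: t_expand)
qed (use that subspace_scale[OF S] proj_mem in auto)

lemma Pi_add: "p \<in> M \<Longrightarrow> q \<in> M \<Longrightarrow> Pi (p + q) = Pi p + Pi q"
  by (simp add: Pi_eq proj_add scale_right_distrib)

lemma Pi_scale: "p \<in> M \<Longrightarrow> Pi (scale c p) = scale c (Pi p)"
  by (simp add: Pi_eq proj_scale scale_right_diff_distrib mult.commute)

lemma tnorm_Pi: "q \<in> M \<Longrightarrow> tnorm (Pi q) = tnorm q"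
proof -
  assume q: "q \<in> M"
  have P: "proj q \<in> M" using proj_mem[OF q] by simp
  have "t q (proj q) = t (proj q) (proj q)" "t (proj q) q = t (proj q) (proj q)"
    using proj_orth[OF q proj_mem[OF q]] proj_orth'[OF q proj_mem[OF q]] q P
    by (simp_all add: t_expand)
  then have "t (Pi q) (Pi q) = t q q"
    using q P by (simp add: Pi_eq t_expand)
  then show ?thesis by (simp add: tnorm_def)
qed

lemma tnorm_minus_proj_le: "tnorm (q - proj q) \<le> tnorm q" if q: "q \<in> M"
proof -
  have "q = proj q + (q - proj q)" by simp
  then have "(tnorm q)\<^sup>2 = (tnorm (proj q))\<^sup>2 + 2 * Re (t (proj q) (q - proj q)) + (tnorm (q - proj q))\<^sup>2"
    using tnorm_add_sq[of "proj q" "q - proj q"] q proj_mem by simp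
  then have "(tnorm (q - proj q))\<^sup>2 \<le> (tnorm q)\<^sup>2"
    using proj_orth'[OF q proj_mem[OF q]] by simp
  then show ?thesis by (rule power2_le_imp_le) (use q in auto)
qed

definition skel :: "'v \<Rightarrow> 'v" where "skel p = p + Pi (scatter p)"

lemma skel_mem [simp]: "p \<in> M \<Longrightarrow> skel p \<in> M"
  by (simp add: skel_def Pi_into)

lemma skel_add: "p \<in> M \<Longrightarrow> q \<in> M \<Longrightarrow> skel (p + q) = skel p + skel q"
  by (simp add: skel_def scatter_add Pi_add)

lemma skel_scale: "p \<in> M \<Longrightarrow> skel (scale c p) = scale c (skel p)"
  by (simp add: skel_def scatter_scale Pi_scale scale_right_distrib)

lemma tnorm_Pi_scatter_le: "p \<in> M \<Longrightarrow> tnorm (Pi (scatter p)) \<le> tnorm p"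
  by (simp add: tnorm_Pi tnorm_scatter_le)

lemma tnorm_skel_le: "tnorm (skel p) \<le> 2 * tnorm p" if p: "p \<in> M"
proof (rule power2_le_imp_le)
  define q where "q = Pi (scatter p)"
  have q: "q \<in> M" "tnorm q \<le> tnorm p"
    using p tnorm_Pi_scatter_le by (auto simp: q_def Pi_into)
  have "Re (t p q) \<le> tnorm p * tnorm q"
    using t_Cauchy_Schwarz[OF p q(1)] complex_Re_le_cmod[of "t p q"] by linarith
  then have "(tnorm (skel p))\<^sup>2 \<le> (tnorm p + tnorm q)\<^sup>2"
    using p q by (simp add: skel_def tnorm_add_sq power2_sum flip: q_def)
  also have "\<dots> \<le> (2 * tnorm p)\<^sup>2"
    using p q by (intro power_mono) auto
  finally show "(tnorm (skel p))\<^sup>2 \<le> (2 * tnorm p)\<^sup>2" .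
qed (use p in auto)

subsection \<open>Relaxed iteration\<close>

text \<open>
  For nonexpansive \<open>T\<close> the convex combination of \<open>e\<close> and \<open>- T e\<close> is strictly shorter than \<open>e\<close>, by uniform
  convexity, unless the two are close; their distance is \<open>\<parallel>(Id + T) e\<parallel>\<close>.
\<close>

lemma relaxation_step:
  assumes p: "p \<in> M" and r: "0 \<le> r" "r \<le> 1"
    and \<gamma>: "0 \<le> \<gamma>" "\<gamma> * tnorm p \<le> tnorm (skel p)"
  shows "(tnorm (p - scale (of_real r) (skel p)))\<^sup>2 \<le> (1 - r * (1 - r) * \<gamma>\<^sup>2) * (tnorm p)\<^sup>2"
proof -
  define q where "q = Pi (scatter p)"
  have q: "q \<in> M" "tnorm q \<le> tnorm p"
    using p tnorm_Pi_scatter_le by (auto simp: q_def Pi_into)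
  have eq: "p - scale (of_real r) (skel p) = scale (of_real (1 - r)) p + scale (of_real (- r)) q"
    by (simp add: skel_def scale_right_distrib scale_left_diff_distrib flip: q_def)
  have "(tnorm (p - scale (of_real r) (skel p)))\<^sup>2
      = ((1 - r) * tnorm p)\<^sup>2 - 2 * (1 - r) * r * Re (t p q) + (r * tnorm q)\<^sup>2"
    unfolding eq tnorm_real_combination[OF p q(1)] by (simp add: power_mult_distrib)
  also have "\<dots> = (1 - r) * (tnorm p)\<^sup>2 + r * (tnorm q)\<^sup>2 - r * (1 - r) * (tnorm (skel p))\<^sup>2"
  proof -
    have "(tnorm (skel p))\<^sup>2 = (tnorm p)\<^sup>2 + 2 * Re (t p q) + (tnorm q)\<^sup>2"
      using p q by (simp add: skel_def tnorm_add_sq flip: q_def)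
    then show ?thesis by algebra
  qed
  also have "\<dots> \<le> (1 - r) * (tnorm p)\<^sup>2 + r * (tnorm p)\<^sup>2 - r * (1 - r) * (\<gamma> * tnorm p)\<^sup>2"
  proof -
    have "r * (tnorm q)\<^sup>2 \<le> r * (tnorm p)\<^sup>2"
      using p q r by (intro mult_left_mono power_mono) auto
    moreover have "r * (1 - r) * (\<gamma> * tnorm p)\<^sup>2 \<le> r * (1 - r) * (tnorm (skel p))\<^sup>2"
      using p \<gamma> r by (intro mult_left_mono power_mono) auto
    ultimately show ?thesis by linarith
  qed
  finally show ?thesis by (simp add: algebra_simps power_mult_distrib)
qed

lemma relaxation_decay:
  assumes r: "0 \<le> r" "r \<le> 1" and \<gamma>: "0 \<le> \<gamma>" "\<And>p. p \<in> M \<Longrightarrow> \<gamma> * tnorm p \<le> tnorm (skel p)"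
    and factor: "0 \<le> 1 - r * (1 - r) * \<gamma>\<^sup>2"
    and e: "e 0 \<in> M" "\<And>n. e (Suc n) = e n - scale (of_real r) (skel (e n))"
  shows "e n \<in> M \<and> (tnorm (e n))\<^sup>2 \<le> (1 - r * (1 - r) * \<gamma>\<^sup>2) ^ n * (tnorm (e 0))\<^sup>2"
proof (induction n)
  case (Suc n)
  then have en: "e n \<in> M" by blast
  have "(tnorm (e (Suc n)))\<^sup>2 \<le> (1 - r * (1 - r) * \<gamma>\<^sup>2) * (tnorm (e n))\<^sup>2"
    unfolding e(2) by (rule relaxation_step[OF en r \<gamma>(1) \<gamma>(2)[OF en]])
  also have "\<dots> \<le> (1 - r * (1 - r) * \<gamma>\<^sup>2) * ((1 - r * (1 - r) * \<gamma>\<^sup>2) ^ n * (tnorm (e 0))\<^sup>2)"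
    using Suc factor by (intro mult_left_mono) auto
  finally show ?case using en by (simp add: e(2) mult.assoc)
qed (simp add: e)

text \<open>
  The local solutions are affine in the incoming trace, \<open>u = local_sol p + us\<close>, where \<open>us\<close> carries the
  source.  Its contribution is exactly the right-hand side of the skeleton equation, so it
  cancels in the error.
\<close>

lemma relaxation_error_step:
  assumes p: "p \<in> M" and x: "x \<in> M" and us: "solves L us"
    and skel_x: "skel x = scale (- 2 * \<i>) (Pi (tr us))"
    and u: "solves (\<lambda>v. t p (tr v) + L v) u"
    and p': "p' = scale (of_real (1 - r)) p - scale (of_real r) (Pi (p + scale (2 * \<i>) (tr u)))"
  shows "p' - x = (p - x) - scale (of_real r) (skel (p - x))"
proof -
  have usB: "us \<in> B" using us by (simp add: solves_def)
  have "u = local_sol p + us"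
    using solves_unique[OF u solves_add[OF local_sol[OF p] us]] .
  then have "Pi (p + scale (2 * \<i>) (tr u)) = Pi (scatter p + scale (2 * \<i>) (tr us))"
    using p usB by (simp add: scatter_def tr_add scale_right_distrib add.assoc)
  also have "\<dots> = Pi (scatter p) + scale (2 * \<i>) (Pi (tr us))"
    using p usB by (simp add: Pi_add Pi_scale)
  also have "\<dots> = Pi (scatter p) - skel x" by (simp add: skel_x)
  finally have "p' = p - scale (of_real r) (skel p - skel x)"
    by (simp add: p' skel_def scale_left_diff_distrib scale_right_diff_distrib scale_right_distrib)
  moreover have "skel (p - x) = skel p - skel x"
    using skel_add[of "p - x" x] p x by simp
  ultimately show ?thesis by simp
qed

lemma skel_bijective:
  assumes "\<And>p. p \<in> M \<Longrightarrow> skel p = 0 \<Longrightarrow> p = 0" and "x \<in> M"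
  shows "\<exists>!p. p \<in> M \<and> skel p = x"
proof -
  obtain G where G: "finite G" "B \<subseteq> span G" using fin_dim by blast
  obtain E where E: "finite E" "E \<subseteq> B" "independent E" "span E = B"
    using finite_basis_of_subspace[OF B G] .
  have "M \<subseteq> span (tr ` E)"
  proof
    fix q assume "q \<in> M"
    then obtain u where u: "u \<in> B" "q = tr u" unfolding tr_image[symmetric] by blast
    have "u \<in> span E" unfolding E(4) by (rule u(1))
    then obtain c where c: "u = (\<Sum>e\<in>E. scale (c e) e)"
      unfolding span_finite[OF E(1)] by blast
    have "q = (\<Sum>e\<in>E. scale (c e) (tr e))"
      unfolding u(2) c using sum_additive_on[OF B tr_add tr_scale tr_zero E(1,2), of c] .
    then show "q \<in> span (tr ` E)"
      by (simp add: span_base span_scale span_sum)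
  qed
  then have "skel ` M = M"
    using E(1) assms(1)
    by (intro injective_imp_surjective_on_subspace[OF M, of "tr ` E"])
      (simp_all add: skel_add skel_scale)
  then obtain p where p: "p \<in> M" "skel p = x" using assms(2) by (metis imageE)
  have "p' = p" if "p' \<in> M" "skel p' = x" for p'
  proof -
    have "skel (p' - p) + skel p = skel p'"
      using that p skel_add[of "p' - p" p] by simp
    then have "p' - p = 0" using assms(1)[of "p' - p"] that p by simp
    then show ?thesis by simp
  qed
  then show ?thesis using p by blast
qed

subsection \<open>Stability of the skeleton equation\<close>

text \<open>
  The jump of the local solution and its residual on conforming test functions are the two
  orthogonal components of \<open>skel p\<close>.  The norm \<open>nb\<close> enters only through a triangle inequality with
  constant 2, which is what adding squares gives without Minkowski's inequality.  Assumption \<open>lift\<close> asks for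
  one cheap lifting of each trace, not for a linear lifting operator.
\<close>

lemma skel_lower_bound:
  fixes nb :: "'v \<Rightarrow> real"
  assumes const: "0 < c" "0 \<le> C" "0 \<le> Ca" "0 < \<alpha>"
    and nb_nonneg: "\<And>v. v \<in> B \<Longrightarrow> 0 \<le> nb v"
    and nb_add: "\<And>u v. u \<in> B \<Longrightarrow> v \<in> B \<Longrightarrow> nb (u + v) \<le> 2 * (nb u + nb v)"
    and a_bound: "\<And>u v. u \<in> B \<Longrightarrow> v \<in> B \<Longrightarrow> cmod (a u v) \<le> Ca * nb u * nb v"
    and t_upper: "\<And>v. v \<in> B \<Longrightarrow> tnorm (tr v) \<le> C * nb v"
    and lift: "\<And>q. q \<in> M \<Longrightarrow> \<exists>v\<in>B. tr v = q \<and> c * nb v \<le> tnorm q"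
    and infsup: "\<And>u K. u \<in> V \<Longrightarrow> 0 \<le> K \<Longrightarrow> (\<And>v. v \<in> V \<Longrightarrow> cmod (a u v) \<le> K * nb v) \<Longrightarrow> \<alpha> * nb u \<le> K"
    and p: "p \<in> M"
  shows "tnorm p \<le> (Ca / c + C) * ((C + Ca / c) / \<alpha> + 1 / c) * tnorm (skel p)"
proof -
  define w where "w = local_sol p"
  have w: "solves (\<lambda>v. t p (tr v)) w" and wB [simp]: "w \<in> B"
    using local_sol[OF p] by (auto simp: w_def solves_def)
  have weq: "a w v = t (p + scale \<i> (tr w)) (tr v)" if "v \<in> B" for v
  proof -
    have "a w v = t p (tr v) + \<i> * t (tr w) (tr v)"
      using w that unfolding solves_def by (metis diff_eq_eq)
    then show ?thesis using that p by (simp add: t_expand)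
  qed
  define q where "q = p + scale (2 * \<i>) (tr w)"
  define F where "F = tnorm (skel p)"
  have q [simp]: "q \<in> M" using p by (simp add: q_def)
  have skel: "skel p = p + (scale 2 (proj q) - q)"
    by (simp add: skel_def scatter_def q_def Pi_eq flip: w_def)
  have F: "0 \<le> F" using p by (simp add: F_def)
  have proj_q: "proj q \<in> M" using proj_mem[of q] by simp
  \<comment> \<open>the jump of \<open>w\<close> across the skeleton\<close>
  define \<psi> where "\<psi> = tr w - proj (tr w)"
  have trw: "tr w \<in> M" "proj (tr w) \<in> M" using proj_mem[of "tr w"] by auto
  have \<psi>: "\<psi> \<in> M" using trw by (simp add: \<psi>_def)
  have single: "t (p + scale \<i> (tr w)) s = (1/2) * t (skel p) s" if "s \<in> S" for s
  proof -
    have "t (proj q) s = t q s"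
      using proj_orth[of q s] that proj_q by (simp add: t_expand)
    then have "t (skel p) s = t p s + t q s"
      using that p proj_q by (simp add: skel t_expand)
    then show ?thesis using that p trw by (simp add: q_def t_expand)
  qed
  have "tnorm \<psi> \<le> F / 2"
  proof -
    have pq: "proj q = proj p + scale (2 * \<i>) (proj (tr w))"
      using p by (simp add: q_def proj_add proj_scale)
    have idem: "proj (proj q) = proj q"
      by (rule proj_unique) (use proj_q proj_mem[of q] t_zero in auto)
    have "proj (skel p + q) = proj (skel p) + proj q"
      using p by (intro proj_add) auto
    moreover have "proj (skel p + q) = proj p + scale 2 (proj q)"
      using p proj_q idem by (simp add: skel proj_add proj_scale)
    ultimately have "proj (skel p) = proj p + scale 2 (proj q) - proj q"
      by (simp add: algebra_simps)
    then have "skel p - proj (skel p) = scale (- 2 * \<i>) \<psi>"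
      unfolding skel pq \<psi>_def by (simp add: q_def scale_right_diff_distrib)
    then have "2 * tnorm \<psi> = tnorm (skel p - proj (skel p))"
      using tnorm_scale[OF \<psi>, of "- 2 * \<i>"] by (simp add: norm_mult)
    also have "\<dots> \<le> F"
      unfolding F_def using p by (intro tnorm_minus_proj_le) auto
    finally show ?thesis by simp
  qed
  moreover obtain \<phi> where \<phi>: "\<phi> \<in> B" "tr \<phi> = \<psi>" "c * nb \<phi> \<le> tnorm \<psi>"
    using lift[OF \<psi>] by blast
  ultimately have nb\<phi>: "nb \<phi> \<le> F / (2 * c)"
    using const(1) by (simp add: field_simps)
  \<comment> \<open>without its jump, \<open>w\<close> has the single-valued trace \<open>proj (tr w)\<close>\<close>
  have "w - \<phi> \<in> V"
  proof (rule conforming)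
    show "tr (w - \<phi>) \<in> S"
      using \<phi> proj_mem[of "tr w"] by (simp add: tr_diff \<psi>_def)
  qed (use \<phi> in simp)
  then have "\<alpha> * nb (w - \<phi>) \<le> (C + Ca / c) * F / 2"
  proof (rule infsup)
    fix v assume v: "v \<in> V"
    then have vB: "v \<in> B" "tr v \<in> S" using V_subset by (auto simp: S_def)
    have "a (w - \<phi>) v = (1/2) * t (skel p) (tr v) - a \<phi> v"
      using vB \<phi> single[OF vB(2)] by (simp add: a_diff weq)
    then have "cmod (a (w - \<phi>) v) \<le> (1/2) * cmod (t (skel p) (tr v)) + cmod (a \<phi> v)"
      using norm_triangle_ineq4[of "(1/2) * t (skel p) (tr v)" "a \<phi> v"]
      by (simp add: norm_mult norm_divide)
    also have "\<dots> \<le> (1/2) * (F * (C * nb v)) + Ca * (F / (2 * c)) * nb v"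
    proof -
      have "cmod (t (skel p) (tr v)) \<le> F * tnorm (tr v)"
        unfolding F_def using p vB by (intro t_Cauchy_Schwarz) auto
      also have "\<dots> \<le> F * (C * nb v)"
        using t_upper[OF vB(1)] F by (rule mult_left_mono)
      finally have 1: "cmod (t (skel p) (tr v)) \<le> F * (C * nb v)" .
      have "cmod (a \<phi> v) \<le> Ca * nb \<phi> * nb v"
        by (rule a_bound) (use \<phi> vB in auto)
      also have "\<dots> \<le> Ca * (F / (2 * c)) * nb v"
        using nb\<phi> const nb_nonneg[OF vB(1)] by (intro mult_right_mono mult_left_mono) auto
      finally show ?thesis using 1 by linarith
    qed
    also have "\<dots> = (C + Ca / c) * F / 2 * nb v"
      using const by (simp add: field_simps)
    finally show "cmod (a (w - \<phi>) v) \<le> (C + Ca / c) * F / 2 * nb v" .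
  qed (use const F in auto)
  then have nbd: "nb (w - \<phi>) \<le> (C + Ca / c) / \<alpha> * F / 2"
    using const(4) by (simp add: field_simps)
  have "nb w \<le> 2 * (nb (w - \<phi>) + nb \<phi>)"
    using nb_add[of "w - \<phi>" \<phi>] \<phi> by simp
  also have "\<dots> \<le> 2 * ((C + Ca / c) / \<alpha> * F / 2 + F / (2 * c))"
    by (intro mult_left_mono add_mono nbd nb\<phi>) simp
  also have "\<dots> = ((C + Ca / c) / \<alpha> + 1 / c) * F"
    using const by (simp add: field_simps)
  finally have nbw: "nb w \<le> ((C + Ca / c) / \<alpha> + 1 / c) * F" .
  have "tnorm p \<le> (Ca / c + C) * nb w"
  proof (cases "p = 0")
    case True
    then show ?thesis
      using const nb_nonneg[OF wB] by (simp add: tnorm_def t_zero)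
  next
    case False
    obtain v where v: "v \<in> B" "tr v = p" "c * nb v \<le> tnorm p" using lift[OF p] by blast
    then have nbv: "nb v \<le> tnorm p / c" using const(1) by (simp add: field_simps)
    have "t p p = a w v - \<i> * t (tr w) p"
      using w v unfolding solves_def by auto
    then have "(tnorm p)\<^sup>2 \<le> cmod (a w v) + cmod (t (tr w) p)"
      using t_self(1)[OF p] norm_triangle_ineq4[of "a w v" "\<i> * t (tr w) p"]
        norm_of_real[of "(tnorm p)\<^sup>2", where 'a = complex]
      by (simp add: norm_mult del: of_real_power)
    also have "\<dots> \<le> Ca * nb w * nb v + tnorm (tr w) * tnorm p"
      using a_bound[OF wB v(1)] t_Cauchy_Schwarz[OF trw(1) p] by simp
    also have "\<dots> \<le> Ca * nb w * (tnorm p / c) + C * nb w * tnorm p"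
      using nbv t_upper[OF wB] const nb_nonneg[OF wB] p
      by (intro add_mono mult_left_mono mult_right_mono) auto
    also have "\<dots> = (Ca / c + C) * nb w * tnorm p"
      by (simp add: algebra_simps)
    finally have "tnorm p * tnorm p \<le> (Ca / c + C) * nb w * tnorm p"
      by (simp add: power2_eq_square)
    then show ?thesis using tnorm_pos[OF p False] by simp
  qed
  also have "\<dots> \<le> (Ca / c + C) * (((C + Ca / c) / \<alpha> + 1 / c) * F)"
    using nbw const by (intro mult_left_mono) auto
  finally show ?thesis by (simp add: F_def mult.assoc)
qed

end

section \<open>Surface measure of polyhedral boundaries\<close>

text \<open>
  On a hyperplane with \<open>a $ i \<noteq> 0\<close> the \<open>i\<close>-th coordinate is a Lipschitz function of the others.
\<close>

lemma norm_diff_le_on_hyperplane: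
  fixes a x y :: "real^'n"
  assumes i: "a $ i \<noteq> 0" and "0 \<le> \<epsilon>" and eq: "a \<bullet> x = a \<bullet> y"
    and \<epsilon>: "\<And>j. j \<noteq> i \<Longrightarrow> \<bar>x $ j - y $ j\<bar> \<le> \<epsilon>"
  shows "norm (x - y) \<le> ((\<Sum>j\<in>UNIV - {i}. \<bar>a $ j\<bar>) / \<bar>a $ i\<bar> + real CARD('n)) * \<epsilon>"
proof -
  define L where "L = (\<Sum>j\<in>UNIV - {i}. \<bar>a $ j\<bar>) / \<bar>a $ i\<bar>"
  have "(\<Sum>j\<in>UNIV. a $ j * (x - y) $ j) = 0"
    using eq by (simp add: inner_vec_def algebra_simps sum_subtractf)
  then have "a $ i * (x - y) $ i = - (\<Sum>j\<in>UNIV - {i}. a $ j * (x - y) $ j)"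
    by (simp add: sum.remove[of UNIV i] add_eq_0_iff)
  then have "\<bar>a $ i\<bar> * \<bar>(x - y) $ i\<bar> = \<bar>\<Sum>j\<in>UNIV - {i}. a $ j * (x - y) $ j\<bar>"
    by (simp flip: abs_mult)
  also have "\<dots> \<le> (\<Sum>j\<in>UNIV - {i}. \<bar>a $ j\<bar> * \<epsilon>)"
    using \<epsilon> by (intro order_trans[OF sum_abs] sum_mono) (auto simp: abs_mult intro!: mult_left_mono)
  finally have i_le: "\<bar>(x - y) $ i\<bar> \<le> L * \<epsilon>"
    using i by (simp add: L_def field_simps flip: sum_distrib_left)
  have "norm (x - y) \<le> (\<Sum>j\<in>UNIV. \<bar>(x - y) $ j\<bar>)"
    by (rule norm_le_l1_cart)
  also have "\<dots> = \<bar>(x - y) $ i\<bar> + (\<Sum>j\<in>UNIV - {i}. \<bar>(x - y) $ j\<bar>)"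
    by (simp add: sum.remove[of UNIV i])
  also have "\<dots> \<le> L * \<epsilon> + (\<Sum>j\<in>UNIV - {i}. \<epsilon>)"
    using i_le \<epsilon> by (intro add_mono sum_mono) auto
  also have "\<dots> = L * \<epsilon> + (real CARD('n) - 1) * \<epsilon>"
    by (simp add: card_Diff_singleton of_nat_diff)
  also have "\<dots> \<le> (L + real CARD('n)) * \<epsilon>"
    using \<open>0 \<le> \<epsilon>\<close> by (simp add: algebra_simps)
  finally show ?thesis by (simp add: L_def)
qed

text \<open>
  Cutting the coordinates other than \<open>i\<close> into intervals of length \<open>1/m\<close> covers \<open>K\<close> by a number of pieces of
  order \<open>m ^ (d - 1)\<close> whose diameters are of order \<open>1/m\<close>, so the covering sums stay below a bound
  independent of \<open>m\<close>.
\<close>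

lemma hausdorff_outer_hyperplane_finite:
  fixes K :: "(real^'n) set"
  assumes "bounded K" "a \<noteq> 0" and K: "K \<subseteq> {x. a \<bullet> x = b}"
  shows "hausdorff_outer (CARD('n) - 1) K < \<infinity>"
proof -
  obtain i where i: "a $ i \<noteq> 0" using \<open>a \<noteq> 0\<close> by (auto simp: vec_eq_iff)
  define s where "s = CARD('n) - 1"
  define c where "c = (\<Sum>j\<in>UNIV - {i}. \<bar>a $ j\<bar>) / \<bar>a $ i\<bar> + real CARD('n)"
  have c: "c \<ge> 0" by (auto simp: c_def intro!: add_nonneg_nonneg divide_nonneg_nonneg sum_nonneg)
  obtain B where B: "\<And>x. x \<in> K \<Longrightarrow> norm x \<le> B"
    using \<open>bounded K\<close> by (auto simp: bounded_iff)
  define R where "R = nat \<lceil>\<bar>B\<bar>\<rceil>"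
  have R: "norm x \<le> real R" if "x \<in> K" for x
    using B[OF that] unfolding R_def by linarith
  define Q where "Q = real (2 * R + 1)"
  define bound where "bound = unit_ball_vol (real s) * (Q * c / 2) ^ s"
  have "(INF U\<in>{U :: nat \<Rightarrow> (real^'n) set. K \<subseteq> (\<Union>i. U i) \<and> (\<forall>i. bounded (U i) \<and> diameter (U i) \<le> \<delta>)}.
          (\<Sum>i. if U i = {} then 0 else ennreal (unit_ball_vol (real s) * (diameter (U i) / 2) ^ s)))
        \<le> ennreal bound" if \<delta>: "\<delta> > 0" for \<delta>
  proof -
    obtain m :: nat where m: "m > 0" "c / \<delta> < m"
      using reals_Archimedean2[of "max 1 (c / \<delta>)"] by (metis less_trans max_less_iff_conj of_nat_0_less_iff zero_less_one)
    have cm: "c / m \<le> \<delta>" using m \<delta> by (simp add: field_simps)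
    define I where "I = PiE (UNIV - {i}) (\<lambda>_. {- int (R * m)..int (R * m)})"
    define P where "P = (\<lambda>\<phi>. {x \<in> K. \<forall>j\<in>UNIV - {i}. \<lfloor>x $ j * m\<rfloor> = \<phi> j})"
    have finI: "finite I" unfolding I_def by (intro finite_PiE) auto
    have cardI: "card I = (2 * R * m + 1) ^ s"
    proof -
      have "int (R * m) - - int (R * m) + 1 = int (2 * R * m + 1)" by simp
      then have "card {- int (R * m)..int (R * m)} = 2 * R * m + 1"
        by (metis card_atLeastAtMost_int nat_int diff_add_eq)
      then show ?thesis
        by (simp add: I_def card_PiE s_def card_Diff_singleton del: card_atLeastAtMost_int)
    qed
    have cover: "\<exists>\<phi>\<in>I. x \<in> P \<phi>" if x: "x \<in> K" for x
    proof (intro bexI)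
      show "x \<in> P (restrict (\<lambda>j. \<lfloor>x $ j * m\<rfloor>) (UNIV - {i}))"
        using x by (simp add: P_def)
      show "restrict (\<lambda>j. \<lfloor>x $ j * m\<rfloor>) (UNIV - {i}) \<in> I"
        unfolding I_def
      proof (rule restrict_PiE_iff[THEN iffD2], intro ballI)
        fix j
        have "\<bar>x $ j\<bar> * m \<le> real R * m"
          using R[OF x] component_le_norm_cart[of x j] by (intro mult_right_mono) auto
        then have "x $ j * m \<le> of_int (int (R * m))" "of_int (- int (R * m)) \<le> x $ j * m"
          using abs_le_iff[of "x $ j * m" "real R * m"] by (auto simp: abs_mult)
        then show "\<lfloor>x $ j * m\<rfloor> \<in> {- int (R * m)..int (R * m)}"
          by (simp add: le_floor_iff floor_le_iff del: of_int_minus of_int_of_nat_eq)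
      qed
    qed
    have dist: "dist x y \<le> c / m" if xy: "x \<in> P \<phi>" "y \<in> P \<phi>" for x y \<phi>
    proof -
      have "norm (x - y) \<le> c * (1 / m)"
        unfolding c_def
      proof (rule norm_diff_le_on_hyperplane[OF i])
        show "a \<bullet> x = a \<bullet> y" using xy K by (auto simp: P_def)
        show "0 \<le> 1 / real m" by simp
        fix j assume "j \<noteq> i"
        then have "\<lfloor>x $ j * m\<rfloor> = \<lfloor>y $ j * m\<rfloor>" using xy by (auto simp: P_def)
        then have "\<bar>x $ j * m - y $ j * m\<bar> \<le> 1" by linarith
        then have "\<bar>x $ j - y $ j\<bar> * m \<le> 1"
          by (metis abs_mult abs_of_nat left_diff_distrib)
        then show "\<bar>x $ j - y $ j\<bar> \<le> 1 / m" using m by (simp add: field_simps)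
      qed
      then show ?thesis by (simp add: dist_norm)
    qed
    have bP: "bounded (P \<phi>)" for \<phi>
      using \<open>bounded K\<close> by (rule bounded_subset) (auto simp: P_def)
    have diamP: "diameter (P \<phi>) \<le> c / m" for \<phi>
      using dist c by (intro diameter_le) (auto simp: dist_norm)
    obtain e where e: "bij_betw e {0..<card I} I"
      using ex_bij_betw_nat_finite[OF finI] by blast
    define U where "U = (\<lambda>k. if k < card I then P (e k) else {})"
    have "K \<subseteq> (\<Union>k. U k)"
    proof
      fix x assume "x \<in> K"
      then obtain \<phi> where \<phi>: "\<phi> \<in> I" "x \<in> P \<phi>" using cover by blast
      have "\<phi> \<in> e ` {0..<card I}" using e \<phi>(1) by (simp add: bij_betw_imp_surj_on)
      then obtain k where "k < card I" "e k = \<phi>" by auto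
      then show "x \<in> (\<Union>k. U k)" using \<phi> by (auto simp: U_def intro!: exI[of _ k])
    qed
    moreover have "bounded (U k) \<and> diameter (U k) \<le> \<delta>" for k
      using bP diamP[of "e k"] cm \<delta> by (auto simp: U_def)
    ultimately have U: "U \<in> {U. K \<subseteq> (\<Union>i. U i) \<and> (\<forall>i. bounded (U i) \<and> diameter (U i) \<le> \<delta>)}"
      by blast
    have "(\<Sum>k. if U k = {} then 0 else ennreal (unit_ball_vol (real s) * (diameter (U k) / 2) ^ s))
        = (\<Sum>k<card I. if U k = {} then 0 else ennreal (unit_ball_vol (real s) * (diameter (U k) / 2) ^ s))"
      by (rule suminf_finite) (auto simp: U_def)
    also have "\<dots> \<le> (\<Sum>k<card I. ennreal (unit_ball_vol (real s) * (c / m / 2) ^ s))"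
      using diamP diameter_ge_0[OF bP]
      by (intro sum_mono) (auto simp: U_def intro!: ennreal_leI mult_left_mono power_mono divide_right_mono)
    also have "\<dots> = ennreal (real (card I) * (unit_ball_vol (real s) * (c / m / 2) ^ s))"
      using c by (simp add: ennreal_mult ennreal_of_nat_eq_real_of_nat)
    also have "\<dots> \<le> ennreal bound"
    proof (rule ennreal_leI)
      have "real (card I) \<le> (Q * m) ^ s"
      proof -
        have "2 * R * m + 1 \<le> (2 * R + 1) * m" using m by (simp add: algebra_simps)
        then have "card I \<le> ((2 * R + 1) * m) ^ s"
          unfolding cardI by (intro power_mono) auto
        then show ?thesis unfolding Q_def by (metis of_nat_le_iff of_nat_mult of_nat_power)
      qed
      then have "real (card I) * (unit_ball_vol (real s) * (c / m / 2) ^ s)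
          \<le> (Q * m) ^ s * (unit_ball_vol (real s) * (c / m / 2) ^ s)"
        using c by (intro mult_right_mono) auto
      also have "\<dots> = unit_ball_vol (real s) * (Q * m * (c / m / 2)) ^ s"
        by (simp only: power_mult_distrib mult_ac)
      also have "\<dots> = bound" using m by (simp add: bound_def)
      finally show "real (card I) * (unit_ball_vol (real s) * (c / m / 2) ^ s) \<le> bound" .
    qed
    finally show ?thesis by (rule INF_lower2[OF U])
  qed
  then have "hausdorff_outer s K \<le> ennreal bound"
    unfolding hausdorff_outer_def by (intro SUP_least) auto
  then show ?thesis
    unfolding s_def by (rule le_less_trans) simp
qed

text \<open>
  An inequality suffices and avoids Caratheodory's theorem: \<^const>\<open>measure_of\<close> returns the zero measure
  if the set function it is given is not countably additive.
\<close>

lemma emeasure_surface_measure_le: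
  "emeasure surface_measure A \<le> hausdorff_outer (CARD('n) - 1) A" for A :: "(real^'n) set"
proof -
  have "sigma_sets UNIV (sets borel) = sets (borel :: (real^'n) measure)"
    by (metis sets.sigma_sets_eq space_borel)
  then show ?thesis
    unfolding surface_measure_def by (simp add: emeasure_measure_of_conv)
qed

lemma sets_surface_measure [simp]: "sets surface_measure = sets (borel :: (real^'n) measure)"
  unfolding surface_measure_def by (metis sets.sigma_sets_eq sets_measure_of space_borel subset_UNIV Pow_UNIV)

lemma frontier_polyhedral_subset:
  fixes \<Omega> :: "(real^'n) set"
  assumes "polyhedral \<Omega>"
  obtains \<F> where "finite \<F>" "frontier \<Omega> \<subseteq> \<Union>\<F>"
    "\<forall>F\<in>\<F>. compact F \<and> (\<exists>a b. a \<noteq> 0 \<and> F \<subseteq> {x. a \<bullet> x = b})"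
proof -
  obtain T where T: "finite T" "\<And>\<tau>. \<tau> \<in> T \<Longrightarrow> int CARD('n) simplex \<tau>" "\<Omega> = interior (\<Union>T)"
    using assms by (auto simp: polyhedral_def)
  have dim: "aff_dim \<tau> = int CARD('n)" if "\<tau> \<in> T" for \<tau>
    using T(2)[OF that] by (rule aff_dim_simplex)
  define \<F> where "\<F> = (\<Union>\<tau>\<in>T. {F. F facet_of \<tau>})"
  have "finite \<F>"
    unfolding \<F>_def using T finite_polyhedron_facets simplex_imp_polyhedron by blast
  moreover have "frontier \<Omega> \<subseteq> \<Union>\<F>"
  proof -
    have "frontier (\<Union>T) \<subseteq> (\<Union>\<tau>\<in>T. frontier \<tau>)"
      using T(1)
    proof (induction T)
      case (insert \<tau> T)
      then show ?case using frontier_Un_subset[of \<tau> "\<Union>T"] by auto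
    qed simp
    moreover have "frontier \<tau> \<subseteq> \<Union>{F. F facet_of \<tau>}" if \<tau>: "\<tau> \<in> T" for \<tau>
    proof -
      have "affine hull \<tau> = UNIV"
        using aff_dim_eq_full[of \<tau>] dim[OF \<tau>] by simp
      then have "frontier \<tau> = rel_frontier \<tau>"
        by (simp add: rel_frontier_frontier)
      then show ?thesis
        using rel_frontier_of_polyhedron simplex_imp_polyhedron T(2)[OF \<tau>] by blast
    qed
    ultimately show ?thesis
      unfolding T(3) \<F>_def using frontier_interior_subset[of "\<Union>T"] by blast
  qed
  moreover have "compact F \<and> (\<exists>a b. a \<noteq> 0 \<and> F \<subseteq> {x. a \<bullet> x = b})" if "F \<in> \<F>" for F
  proof -
    obtain \<tau> where \<tau>: "\<tau> \<in> T" "F facet_of \<tau>" using \<open>F \<in> \<F>\<close> by (auto simp: \<F>_def)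
    have "compact F"
      using \<tau> T(2) face_of_imp_compact compact_simplex convex_simplex facet_of_imp_face_of by blast
    moreover have "aff_dim F < DIM(real^'n)"
      using \<tau> dim[OF \<tau>(1)] by (simp add: facet_of_def)
    ultimately show ?thesis by (metis aff_lowdim_subset_hyperplane)
  qed
  ultimately show ?thesis using that[of \<F>] by simp
qed

lemma surface_measure_frontier_finite:
  fixes \<Omega> :: "(real^'n) set"
  assumes "polyhedral \<Omega>"
  shows "emeasure surface_measure (frontier \<Omega>) < \<infinity>"
proof -
  obtain \<F> where \<F>: "finite \<F>" "frontier \<Omega> \<subseteq> \<Union>\<F>"
    "\<forall>F\<in>\<F>. compact F \<and> (\<exists>a b. a \<noteq> 0 \<and> F \<subseteq> {x. a \<bullet> x = b})"
    using frontier_polyhedral_subset[OF assms] .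
  have sets: "F \<in> sets surface_measure" if "F \<in> \<F>" for F
    using \<F>(3) that by (simp add: borel_compact)
  have "emeasure surface_measure (frontier \<Omega>) \<le> emeasure surface_measure (\<Union>F\<in>\<F>. F)"
    using \<F>(1,2) sets by (intro emeasure_mono) auto
  also have "\<dots> \<le> (\<Sum>F\<in>\<F>. emeasure surface_measure F)"
    using \<F>(1) sets by (intro emeasure_subadditive_finite) auto
  also have "\<dots> < \<infinity>"
  proof -
    have "emeasure surface_measure F < \<infinity>" if F\<F>: "F \<in> \<F>" for F
    proof -
      obtain a b where F: "compact F" "a \<noteq> 0" "F \<subseteq> {x. a \<bullet> x = b}"
        using bspec[OF \<F>(3) F\<F>] by (elim conjE exE)
      show ?thesis
        using hausdorff_outer_hyperplane_finite[OF compact_imp_bounded[OF F(1)] F(2,3)]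
        by (rule le_less_trans[OF emeasure_surface_measure_le])
    qed
    then show ?thesis using \<F>(1) by (simp add: ennreal_sum_less_top)
  qed
  finally show ?thesis .
qed

section \<open>Piecewise smooth functions\<close>

definition C1 :: "(real^'n \<Rightarrow> complex) \<Rightarrow> bool" where
  "C1 p \<longleftrightarrow> (\<exists>p'. (\<forall>x. (p has_derivative p' x) (at x)) \<and> (\<forall>v. continuous_on UNIV (\<lambda>x. p' x v)))"

lemma C1_const: "C1 (\<lambda>_. c)"
  unfolding C1_def by (intro exI[of _ "\<lambda>_ _. 0"]) auto

lemma C1_coordinate: "C1 (\<lambda>x. complex_of_real (x $ i))"
  unfolding C1_def
  by (intro exI[of _ "\<lambda>_ v. complex_of_real (v $ i)"] conjI allI continuous_on_const)
    (intro has_derivative_of_real bounded_linear.has_derivative[OF bounded_linear_vec_nth] has_derivative_ident)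

lemma C1_continuous: "C1 p \<Longrightarrow> continuous_on UNIV p"
  unfolding C1_def by (meson continuous_at_imp_continuous_on has_derivative_continuous)

lemma C1_add: "C1 p \<Longrightarrow> C1 q \<Longrightarrow> C1 (\<lambda>x. p x + q x)"
  unfolding C1_def
  by (elim exE conjE, rule_tac x = "\<lambda>x v. p' x v + p'a x v" in exI)
    (auto intro!: has_derivative_add continuous_on_add)

lemma C1_mult:
  assumes "C1 p" "C1 q"
  shows "C1 (\<lambda>x. p x * q x)"
proof -
  obtain p' q' where *: "\<And>x. (p has_derivative p' x) (at x)" "\<And>v. continuous_on UNIV (\<lambda>x. p' x v)"
    "\<And>x. (q has_derivative q' x) (at x)" "\<And>v. continuous_on UNIV (\<lambda>x. q' x v)"
    using assms unfolding C1_def by blast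
  show ?thesis
    unfolding C1_def
    by (intro exI[of _ "\<lambda>x v. p x * q' x v + p' x v * q x"] conjI allI has_derivative_mult *
        continuous_on_add continuous_on_mult C1_continuous assms)
qed

lemma C1_power: "C1 p \<Longrightarrow> C1 (\<lambda>x. p x ^ n)"
  by (induction n) (simp_all add: C1_const C1_mult)

lemma C1_sum: "finite I \<Longrightarrow> (\<And>i. i \<in> I \<Longrightarrow> C1 (p i)) \<Longrightarrow> C1 (\<lambda>x. \<Sum>i\<in>I. p i x)"
  by (induction I rule: finite_induct) (simp_all add: C1_const C1_add)

lemma C1_prod: "finite I \<Longrightarrow> (\<And>i. i \<in> I \<Longrightarrow> C1 (p i)) \<Longrightarrow> C1 (\<lambda>x. \<Prod>i\<in>I. p i x)"
  by (induction I rule: finite_induct) (simp_all add: C1_const C1_mult)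

lemma finite_multiindices: "finite {\<alpha> :: 'n::finite \<Rightarrow> nat. sum \<alpha> UNIV \<le> k}"
proof (rule finite_subset)
  show "{\<alpha> :: 'n \<Rightarrow> nat. sum \<alpha> UNIV \<le> k} \<subseteq> PiE UNIV (\<lambda>_. {..k})"
  proof
    fix \<alpha> :: "'n \<Rightarrow> nat" assume "\<alpha> \<in> {\<alpha>. sum \<alpha> UNIV \<le> k}"
    then have "\<alpha> i \<le> k" for i using member_le_sum[of i UNIV \<alpha>] by simp
    then show "\<alpha> \<in> PiE UNIV (\<lambda>_. {..k})" by (intro PiE_I) auto
  qed
qed (simp add: finite_PiE)

lemma C1_polynomial: "poly_of_degree_le k p \<Longrightarrow> C1 p"
  unfolding poly_of_degree_le_def
  by (auto intro!: C1_sum C1_mult C1_const C1_prod C1_power C1_coordinate finite_multiindices)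

lemma C1_grad:
  assumes "C1 p"
  shows "p differentiable (at x)" "continuous_on UNIV (grad p)"
proof -
  obtain p' where p': "\<And>x. (p has_derivative p' x) (at x)" "\<And>v. continuous_on UNIV (\<lambda>x. p' x v)"
    using assms unfolding C1_def by blast
  show "p differentiable (at x)" using p'(1) by (auto simp: differentiable_def)
  have "frechet_derivative p (at x) = p' x" for x
    using frechet_derivative_at[OF p'(1)] by simp
  then show "continuous_on UNIV (grad p)"
    unfolding grad_def by (auto intro!: continuous_on_vec_lambda p'(2))
qed

lemma grad_cong_open:
  assumes "open W" "x \<in> W" "\<And>y. y \<in> W \<Longrightarrow> u y = v y"
  shows "grad u x = grad v x" "u differentiable (at x) \<longleftrightarrow> v differentiable (at x)"
proof -
  have *: "(u has_derivative d) (at x) \<longleftrightarrow> (v has_derivative d) (at x)" for d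
    using has_derivative_transform_within_open[of u d x UNIV W v]
      has_derivative_transform_within_open[of v d x UNIV W u] assms by auto
  show "grad u x = grad v x" by (simp add: grad_def frechet_derivative_def *)
  show "u differentiable (at x) \<longleftrightarrow> v differentiable (at x)" by (simp add: differentiable_def *)
qed

lemma grad_add:
  assumes "u differentiable (at x)" "v differentiable (at x)"
  shows "grad (\<lambda>x. u x + v x) x = grad u x + grad v x"
proof -
  have "((\<lambda>x. u x + v x) has_derivative (\<lambda>h. frechet_derivative u (at x) h + frechet_derivative v (at x) h)) (at x)"
    using assms by (intro has_derivative_add) (simp_all add: frechet_derivative_works)
  then have "frechet_derivative (\<lambda>x. u x + v x) (at x)
      = (\<lambda>h. frechet_derivative u (at x) h + frechet_derivative v (at x) h)"
    using frechet_derivative_at by metis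
  then show ?thesis by (simp add: grad_def vec_eq_iff)
qed

lemma grad_mult_const:
  assumes "v differentiable (at x)"
  shows "grad (\<lambda>x. c * v x) x = c *s grad v x"
proof -
  have "((\<lambda>x. c * v x) has_derivative (\<lambda>h. c * frechet_derivative v (at x) h)) (at x)"
    using assms by (intro has_derivative_mult_right) (simp add: frechet_derivative_works)
  then have "frechet_derivative (\<lambda>x. c * v x) (at x) = (\<lambda>h. c * frechet_derivative v (at x) h)"
    using frechet_derivative_at by metis
  then show ?thesis by (simp add: grad_def vec_eq_iff)
qed

text \<open>
  Sets of measure zero, here the faces of the cells, are discarded by means of the open set \<open>W\<close>.  Boundedness
  of the function and of its gradient makes every product in the forms integrable.
\<close>

definition pw_smooth :: "(real^'n) set \<Rightarrow> (real^'n \<Rightarrow> complex) \<Rightarrow> bool" where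
  "pw_smooth \<omega> v \<longleftrightarrow> continuous_on \<omega> v \<and> bounded (v ` \<omega>) \<and>
     (\<exists>W. open W \<and> W \<subseteq> \<omega> \<and> negligible (\<omega> - W) \<and>
        (\<forall>x\<in>W. v differentiable (at x)) \<and> continuous_on W (grad v) \<and> bounded (grad v ` W))"

lemma pw_smoothE:
  assumes "pw_smooth \<omega> v"
  obtains W C where "open W" "W \<subseteq> \<omega>" "negligible (\<omega> - W)"
    "\<And>x. x \<in> W \<Longrightarrow> v differentiable (at x)" "continuous_on W (grad v)"
    "\<And>x. x \<in> W \<Longrightarrow> norm (grad v x) \<le> C"
proof -
  obtain W where W: "open W" "W \<subseteq> \<omega>" "negligible (\<omega> - W)"
    "\<forall>x\<in>W. v differentiable (at x)" "continuous_on W (grad v)" "bounded (grad v ` W)"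
    using assms unfolding pw_smooth_def by blast
  then obtain C where "\<forall>y\<in>grad v ` W. norm y \<le> C" by (auto simp: bounded_iff)
  then show ?thesis using W that[of W C] by simp
qed

lemma AE_lebesgue_on_negligible:
  assumes "\<omega> \<in> sets lebesgue" "negligible (\<omega> - W)" "\<And>x. x \<in> W \<Longrightarrow> P x"
  shows "AE x in lebesgue_on \<omega>. P x"
proof -
  have "\<omega> - W \<in> null_sets lebesgue"
    using assms(2) by (simp add: negligible_iff_null_sets)
  then have "AE x in lebesgue. x \<notin> \<omega> - W" by (rule AE_not_in)
  then show ?thesis
    using assms by (subst AE_restrict_space_iff) (auto elim!: eventually_mono)
qed

text \<open>
  Applied to gradients, whose values off \<open>W\<close> are arbitrary; they do not affect measurability because Lebesgue
  measure is complete.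
\<close>

lemma borel_measurable_lebesgue_on_spike:
  fixes F :: "'a::euclidean_space \<Rightarrow> 'b::topological_space"
  assumes \<omega>: "\<omega> \<in> sets lebesgue" and W: "open W" "W \<subseteq> \<omega>" "negligible (\<omega> - W)"
    and F: "continuous_on W F"
  shows "F \<in> borel_measurable (lebesgue_on \<omega>)"
proof (rule measurableI)
  fix Y :: "'b set" assume Y: "Y \<in> sets borel"
  have "F \<in> borel_measurable (lebesgue_on W)"
    using F W by (intro continuous_imp_measurable_on_sets_lebesgue) auto
  then have "F -` Y \<inter> W \<in> sets (lebesgue_on W)"
    using measurable_sets[OF _ Y, of F "lebesgue_on W"] by (simp add: space_restrict_space)
  then have 1: "F -` Y \<inter> W \<in> sets lebesgue"
    using W(1) by (simp add: sets_restrict_space_iff)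
  have "negligible (F -` Y \<inter> (\<omega> - W))"
    using W(3) by (rule negligible_subset) auto
  then have "F -` Y \<inter> (\<omega> - W) \<in> sets lebesgue" by (rule negligible_imp_sets)
  with 1 have "(F -` Y \<inter> W) \<union> (F -` Y \<inter> (\<omega> - W)) \<in> sets lebesgue" by blast
  also have "(F -` Y \<inter> W) \<union> (F -` Y \<inter> (\<omega> - W)) = F -` Y \<inter> \<omega>" using W(2) by blast
  finally show "F -` Y \<inter> space (lebesgue_on \<omega>) \<in> sets (lebesgue_on \<omega>)"
    using \<omega> by (simp add: sets_restrict_space_iff space_restrict_space)
qed simp

lemma pw_smooth_add:
  assumes "open \<omega>" "pw_smooth \<omega> u" "pw_smooth \<omega> v"
  shows "pw_smooth \<omega> (\<lambda>x. u x + v x)"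
    and "AE x in lebesgue_on \<omega>. grad (\<lambda>x. u x + v x) x = grad u x + grad v x"
proof -
  obtain U C where U: "open U" "U \<subseteq> \<omega>" "negligible (\<omega> - U)"
    "\<And>x. x \<in> U \<Longrightarrow> u differentiable (at x)" "continuous_on U (grad u)"
    "\<And>x. x \<in> U \<Longrightarrow> norm (grad u x) \<le> C"
    using pw_smoothE[OF assms(2)] by blast
  obtain W B where W: "open W" "W \<subseteq> \<omega>" "negligible (\<omega> - W)"
    "\<And>x. x \<in> W \<Longrightarrow> v differentiable (at x)" "continuous_on W (grad v)"
    "\<And>x. x \<in> W \<Longrightarrow> norm (grad v x) \<le> B"
    using pw_smoothE[OF assms(3)] by blast
  have eq: "grad (\<lambda>x. u x + v x) x = grad u x + grad v x" if "x \<in> U \<inter> W" for x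
    using that U(4) W(4) by (intro grad_add) auto
  have neg: "negligible (\<omega> - U \<inter> W)"
    using negligible_Un[OF U(3) W(3)] by (rule negligible_subset) auto
  show "AE x in lebesgue_on \<omega>. grad (\<lambda>x. u x + v x) x = grad u x + grad v x"
    by (rule AE_lebesgue_on_negligible[OF _ neg eq]) (use assms(1) in auto)
  have "continuous_on (U \<inter> W) (grad (\<lambda>x. u x + v x))"
    by (subst continuous_on_cong[OF refl eq])
      (auto intro!: continuous_on_add continuous_on_subset[OF U(5)] continuous_on_subset[OF W(5)])
  moreover have "bounded (grad (\<lambda>x. u x + v x) ` (U \<inter> W))"
  proof -
    have "norm (grad (\<lambda>x. u x + v x) x) \<le> C + B" if "x \<in> U \<inter> W" for x
      unfolding eq[OF that] using U(6)[of x] W(6)[of x] that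
      by (intro order_trans[OF norm_triangle_ineq] add_mono) auto
    then show ?thesis unfolding bounded_iff by blast
  qed
  moreover have "\<forall>x\<in>U \<inter> W. (\<lambda>x. u x + v x) differentiable (at x)"
    using U(4) W(4) by (auto intro: differentiable_add)
  moreover have "bounded ((\<lambda>x. u x + v x) ` \<omega>)" "continuous_on \<omega> (\<lambda>x. u x + v x)"
    using assms(2,3) by (auto simp: pw_smooth_def intro: bounded_plus_comp continuous_on_add)
  ultimately show "pw_smooth \<omega> (\<lambda>x. u x + v x)"
    unfolding pw_smooth_def using U(1,2) W(1,2) neg by (meson Int_lower1 open_Int order_trans)
qed

lemma pw_smooth_mult_const:
  assumes "open \<omega>" "pw_smooth \<omega> v"
  shows "pw_smooth \<omega> (\<lambda>x. c * v x)"
    and "AE x in lebesgue_on \<omega>. grad (\<lambda>x. c * v x) x = c *s grad v x"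
proof -
  obtain W B where W: "open W" "W \<subseteq> \<omega>" "negligible (\<omega> - W)"
    "\<And>x. x \<in> W \<Longrightarrow> v differentiable (at x)" "continuous_on W (grad v)"
    "\<And>x. x \<in> W \<Longrightarrow> norm (grad v x) \<le> B"
    using pw_smoothE[OF assms(2)] by blast
  have eq: "grad (\<lambda>x. c * v x) x = c *s grad v x" if "x \<in> W" for x
    using that W(4) by (intro grad_mult_const) auto
  show "AE x in lebesgue_on \<omega>. grad (\<lambda>x. c * v x) x = c *s grad v x"
    by (rule AE_lebesgue_on_negligible[OF _ W(3) eq]) (use assms(1) in auto)
  have "continuous_on W (grad (\<lambda>x. c * v x))"
    by (subst continuous_on_cong[OF refl eq])
      (auto simp: vector_scalar_mult_def intro!: continuous_on_vec_lambda continuous_intros W(5))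
  moreover have "norm (c *s z) = cmod c * norm z" for z :: "complex^'a"
    by (simp add: norm_vec_def norm_mult L2_set_right_distrib)
  then have "bounded (grad (\<lambda>x. c * v x) ` W)"
    unfolding bounded_iff using eq W(6)
    by (intro exI[of _ "cmod c * B"]) (auto intro: mult_left_mono)
  moreover have "\<forall>x\<in>W. (\<lambda>x. c * v x) differentiable (at x)"
    using W(4) by (auto intro: differentiable_mult)
  moreover have "bounded ((\<lambda>x. c * v x) ` \<omega>)"
  proof -
    obtain C where "\<forall>x\<in>\<omega>. norm (v x) \<le> C" using assms(2) by (auto simp: pw_smooth_def bounded_iff)
    then show ?thesis unfolding bounded_iff
      by (intro exI[of _ "cmod c * C"]) (auto simp: norm_mult intro: mult_left_mono)
  qed
  moreover have "continuous_on \<omega> (\<lambda>x. c * v x)"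
    using assms(2) by (auto simp: pw_smooth_def intro!: continuous_intros)
  ultimately show "pw_smooth \<omega> (\<lambda>x. c * v x)"
    unfolding pw_smooth_def using W(1-3) by blast
qed

lemma pw_smooth_measurable:
  assumes \<omega>: "open \<omega>" and v: "pw_smooth \<omega> v"
  shows "v \<in> borel_measurable (lebesgue_on \<omega>)"
    and "(\<lambda>x. grad v x $ i) \<in> borel_measurable (lebesgue_on \<omega>)"
    and "\<exists>C. AE x in lebesgue_on \<omega>. cmod (v x) \<le> C"
    and "\<exists>C. AE x in lebesgue_on \<omega>. norm (grad v x) \<le> C"
proof -
  obtain W B where W: "open W" "W \<subseteq> \<omega>" "negligible (\<omega> - W)"
    "\<And>x. x \<in> W \<Longrightarrow> v differentiable (at x)" "continuous_on W (grad v)"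
    "\<And>x. x \<in> W \<Longrightarrow> norm (grad v x) \<le> B"
    using pw_smoothE[OF v] by blast
  have \<omega>': "\<omega> \<in> sets lebesgue" using \<omega> by auto
  show "v \<in> borel_measurable (lebesgue_on \<omega>)"
    using v \<omega> by (intro continuous_imp_measurable_on_sets_lebesgue) (auto simp: pw_smooth_def)
  show "(\<lambda>x. grad v x $ i) \<in> borel_measurable (lebesgue_on \<omega>)"
    by (rule borel_measurable_lebesgue_on_spike[OF \<omega>' W(1-3)]) (intro continuous_intros W)
  show "\<exists>C. AE x in lebesgue_on \<omega>. norm (grad v x) \<le> C"
    by (rule exI[of _ B], rule AE_lebesgue_on_negligible[OF \<omega>' W(3)]) (rule W(6))
  obtain C where "\<forall>x\<in>\<omega>. cmod (v x) \<le> C" using v by (auto simp: pw_smooth_def bounded_iff)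
  then show "\<exists>C. AE x in lebesgue_on \<omega>. cmod (v x) \<le> C"
    by (intro exI[of _ C] AE_I2) (auto simp: space_restrict_space)
qed

section \<open>The energy norm\<close>

lemma set_integral_eq_lebesgue_on:
  fixes F :: "'a::euclidean_space \<Rightarrow> 'b::{banach, second_countable_topology}"
  assumes "\<omega> \<in> sets lebesgue"
  shows "(LINT x:\<omega>|lebesgue. F x) = integral\<^sup>L (lebesgue_on \<omega>) F"
  using assms by (simp add: set_lebesgue_integral_def integral_restrict_space)

lemma integrable_lebesgue_on_bounded:
  fixes F :: "'a::euclidean_space \<Rightarrow> 'b::{banach, second_countable_topology}"
  assumes "open \<omega>" "bounded \<omega>" "F \<in> borel_measurable (lebesgue_on \<omega>)"
    and "AE x in lebesgue_on \<omega>. norm (F x) \<le> C"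
  shows "integrable (lebesgue_on \<omega>) F"
proof -
  have "\<omega> \<in> lmeasurable" using assms by (intro bounded_set_imp_lmeasurable) auto
  then interpret finite_measure "lebesgue_on \<omega>"
    by (rule finite_measure_lebesgue_on)
  show ?thesis using assms(3,4) by (intro integrable_const_bound)
qed

lemma norm_vec_sq: "(norm z)\<^sup>2 = (\<Sum>i\<in>UNIV. (cmod (z $ i))\<^sup>2)" for z :: "complex^'n"
  by (simp add: norm_vec_def L2_set_def sum_nonneg)

definition h1_density :: "real \<Rightarrow> (real^'n \<Rightarrow> complex) \<Rightarrow> real^'n \<Rightarrow> real" where
  "h1_density K v x = (norm (grad v x))\<^sup>2 + K\<^sup>2 * (cmod (v x))\<^sup>2"

lemma h1_density_nonneg: "0 \<le> h1_density K v x"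
  by (simp add: h1_density_def)

lemma pw_smooth_sq_integrable:
  assumes "open \<omega>" "bounded \<omega>" "pw_smooth \<omega> v"
  shows "integrable (lebesgue_on \<omega>) (\<lambda>x. (norm (grad v x))\<^sup>2)"
    and "integrable (lebesgue_on \<omega>) (\<lambda>x. (cmod (v x))\<^sup>2)"
proof -
  note [measurable] = pw_smooth_measurable(1,2)[OF assms(1,3)]
  obtain C where C: "AE x in lebesgue_on \<omega>. cmod (v x) \<le> C"
    using pw_smooth_measurable(3)[OF assms(1,3)] by blast
  obtain C' where C': "AE x in lebesgue_on \<omega>. norm (grad v x) \<le> C'"
    using pw_smooth_measurable(4)[OF assms(1,3)] by blast
  show "integrable (lebesgue_on \<omega>) (\<lambda>x. (cmod (v x))\<^sup>2)"
  proof (rule integrable_lebesgue_on_bounded[OF assms(1,2)])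
    show "AE x in lebesgue_on \<omega>. norm ((cmod (v x))\<^sup>2) \<le> C\<^sup>2"
      using C by eventually_elim (simp add: power_mono)
  qed measurable
  show "integrable (lebesgue_on \<omega>) (\<lambda>x. (norm (grad v x))\<^sup>2)"
  proof (rule integrable_lebesgue_on_bounded[OF assms(1,2)])
    show "AE x in lebesgue_on \<omega>. norm ((norm (grad v x))\<^sup>2) \<le> C'\<^sup>2"
      using C' by eventually_elim (simp add: power_mono)
    show "(\<lambda>x. (norm (grad v x))\<^sup>2) \<in> borel_measurable (lebesgue_on \<omega>)"
      unfolding norm_vec_sq by measurable
  qed
qed

lemma h1_density_integrable:
  assumes "open \<omega>" "bounded \<omega>" "pw_smooth \<omega> v"
  shows "integrable (lebesgue_on \<omega>) (h1_density K v)"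
  unfolding h1_density_def using pw_smooth_sq_integrable[OF assms] by simp

lemma h1_norm_sq:
  assumes "open \<omega>" "bounded \<omega>" "pw_smooth \<omega> v"
  shows "(h1_norm K \<omega> v)\<^sup>2 = integral\<^sup>L (lebesgue_on \<omega>) (h1_density K v)"
proof -
  have \<omega>: "\<omega> \<in> sets lebesgue" using assms(1) by auto
  have "integral\<^sup>L (lebesgue_on \<omega>) (h1_density K v)
      = integral\<^sup>L (lebesgue_on \<omega>) (\<lambda>x. (norm (grad v x))\<^sup>2)
        + K\<^sup>2 * integral\<^sup>L (lebesgue_on \<omega>) (\<lambda>x. (cmod (v x))\<^sup>2)"
    unfolding h1_density_def using pw_smooth_sq_integrable[OF assms] by simp
  then show ?thesis
    by (simp add: h1_norm_def set_integral_eq_lebesgue_on[OF \<omega>])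
qed

lemma h1_norm_nonneg: "0 \<le> h1_norm K \<omega> v"
  unfolding h1_norm_def set_lebesgue_integral_def
  by (intro real_sqrt_ge_zero add_nonneg_nonneg mult_nonneg_nonneg integral_nonneg) auto

text \<open>
  The pointwise inequality between squares replaces the triangle inequality of the norm, which would need
  Minkowski's inequality; the constant 2 is harmless in the stability estimate.
\<close>

lemma h1_norm_add_sq:
  assumes "open \<omega>" "bounded \<omega>" "pw_smooth \<omega> u" "pw_smooth \<omega> v"
  shows "(h1_norm K \<omega> (\<lambda>x. u x + v x))\<^sup>2 \<le> 2 * (h1_norm K \<omega> u)\<^sup>2 + 2 * (h1_norm K \<omega> v)\<^sup>2"
proof -
  note uv = pw_smooth_add[OF assms(1,3,4)]
  note int = h1_density_integrable[OF assms(1,2)]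
  have par: "(norm (x + y))\<^sup>2 \<le> 2 * (norm x)\<^sup>2 + 2 * (norm y)\<^sup>2" for x y :: "'b::real_normed_vector"
  proof -
    have "(norm (x + y))\<^sup>2 \<le> (norm x + norm y)\<^sup>2"
      by (intro power_mono norm_triangle_ineq) auto
    also have "\<dots> \<le> 2 * (norm x)\<^sup>2 + 2 * (norm y)\<^sup>2"
      using zero_le_power2[of "norm x - norm y"] by (simp add: power2_sum power2_diff)
    finally show ?thesis .
  qed
  have "integral\<^sup>L (lebesgue_on \<omega>) (h1_density K (\<lambda>x. u x + v x))
      \<le> integral\<^sup>L (lebesgue_on \<omega>) (\<lambda>x. 2 * h1_density K u x + 2 * h1_density K v x)"
  proof (rule integral_mono_AE)
    show "AE x in lebesgue_on \<omega>. h1_density K (\<lambda>x. u x + v x) x \<le> 2 * h1_density K u x + 2 * h1_density K v x"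
      using uv(2)
    proof eventually_elim
      case (elim x)
      have "K\<^sup>2 * (cmod (u x + v x))\<^sup>2 \<le> K\<^sup>2 * (2 * (cmod (u x))\<^sup>2 + 2 * (cmod (v x))\<^sup>2)"
        by (intro mult_left_mono par) auto
      then show ?case
        using par[of "grad u x" "grad v x"] by (simp add: h1_density_def elim algebra_simps)
    qed
  qed (use int assms(3,4) uv(1) in simp_all)
  then show ?thesis
    using int[OF assms(3)] int[OF assms(4)] uv(1) assms by (simp add: h1_norm_sq)
qed

text \<open>
  The zeroth-order term makes the function vanish almost everywhere, and continuity everywhere.
\<close>

lemma h1_norm_definite:
  assumes "open \<omega>" "bounded \<omega>" "pw_smooth \<omega> v" "0 < K" "h1_norm K \<omega> v = 0" "x \<in> \<omega>"
  shows "v x = 0"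
proof -
  have "integral\<^sup>L (lebesgue_on \<omega>) (h1_density K v) = 0"
    using h1_norm_sq[OF assms(1-3), of K] assms(5) by simp
  then have "AE x in lebesgue_on \<omega>. h1_density K v x = 0"
    using h1_density_integrable[OF assms(1-3)]
    by (subst (asm) integral_nonneg_eq_0_iff_AE) (simp_all add: h1_density_nonneg)
  then have "AE x in lebesgue_on \<omega>. v x = 0"
  proof eventually_elim
    case (elim x)
    then show ?case
      using assms(4) by (simp add: h1_density_def add_nonneg_eq_0_iff)
  qed
  then have "AE x in lebesgue. x \<in> \<omega> \<longrightarrow> v x = 0"
    using assms(1) by (subst (asm) AE_restrict_space_iff) auto
  then have neg: "negligible {x \<in> \<omega>. v x \<noteq> 0}"
    by (simp add: negligible_iff_null_sets completion.AE_iff_null_sets)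
  have "open {x \<in> \<omega>. v x \<noteq> 0}"
  proof -
    have "open (\<omega> \<inter> v -` (- {0}))"
      using assms(1,3) by (intro continuous_open_preimage) (auto simp: pw_smooth_def)
    also have "\<omega> \<inter> v -` (- {0}) = {x \<in> \<omega>. v x \<noteq> 0}" by auto
    finally show ?thesis .
  qed
  then have "{x \<in> \<omega>. v x \<noteq> 0} = {}"
    using neg open_not_negligible by blast
  then show ?thesis using assms(6) by blast
qed

lemma pw_smooth_subset:
  assumes v: "pw_smooth \<Omega> v" and \<omega>: "open \<omega>" "\<omega> \<subseteq> \<Omega>" and eq: "\<And>x. x \<in> \<omega> \<Longrightarrow> u x = v x"
  shows "pw_smooth \<omega> u"
proof -
  obtain W C where W: "open W" "W \<subseteq> \<Omega>" "negligible (\<Omega> - W)"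
    "\<And>x. x \<in> W \<Longrightarrow> v differentiable (at x)" "continuous_on W (grad v)"
    "\<And>x. x \<in> W \<Longrightarrow> norm (grad v x) \<le> C"
    using pw_smoothE[OF v] by blast
  have 1: "negligible (\<omega> - W \<inter> \<omega>)"
    using W(3) by (rule negligible_subset) (use \<omega> in auto)
  have 2: "u differentiable (at x)" "grad u x = grad v x" if "x \<in> W \<inter> \<omega>" for x
    using grad_cong_open[OF \<omega>(1) _ eq] W(4) that by auto
  have 3: "continuous_on (W \<inter> \<omega>) (grad u)"
    by (subst continuous_on_cong[OF refl 2(2)]) (auto intro: continuous_on_subset[OF W(5)])
  have 4: "bounded (grad u ` (W \<inter> \<omega>))"
    unfolding bounded_iff using 2(2) W(6) by (intro exI[of _ C]) auto
  have 5: "continuous_on \<omega> u"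
    using v \<omega> by (subst continuous_on_cong[OF refl eq]) (auto simp: pw_smooth_def intro: continuous_on_subset)
  have "u ` \<omega> \<subseteq> v ` \<Omega>" using eq \<omega> by auto
  then have 6: "bounded (u ` \<omega>)"
    using v unfolding pw_smooth_def by (meson bounded_subset)
  show ?thesis
    unfolding pw_smooth_def using 1 2(1) 3 4 5 6 W(1) \<omega>(1)
    by (intro conjI exI[of _ "W \<inter> \<omega>"]) auto
qed

text \<open>
  This turns the inf-sup condition in the norm of the whole domain into one in
  the broken norm.
\<close>

lemma sum_h1_norm_sq_le:
  assumes \<Omega>: "open \<Omega>" "bounded \<Omega>" and v: "pw_smooth \<Omega> v" and "finite J"
    and \<omega>: "\<And>j. j \<in> J \<Longrightarrow> open (\<omega> j) \<and> \<omega> j \<subseteq> \<Omega>"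
    and disj: "\<And>i j. i \<in> J \<Longrightarrow> j \<in> J \<Longrightarrow> i \<noteq> j \<Longrightarrow> \<omega> i \<inter> \<omega> j = {}"
    and eq: "\<And>j x. j \<in> J \<Longrightarrow> x \<in> \<omega> j \<Longrightarrow> u j x = v x"
  shows "(\<Sum>j\<in>J. (h1_norm K (\<omega> j) (u j))\<^sup>2) \<le> (h1_norm K \<Omega> v)\<^sup>2"
proof -
  let ?F = "\<lambda>A x. indicator A x *\<^sub>R h1_density K v x"
  have \<Omega>': "\<Omega> \<in> sets lebesgue" using \<Omega>(1) by auto
  have int: "integrable lebesgue (?F \<Omega>)"
    using h1_density_integrable[OF \<Omega> v] \<Omega>' by (simp add: integrable_restrict_space)
  have 1: "(h1_norm K (\<omega> j) (u j))\<^sup>2 = integral\<^sup>L lebesgue (?F (\<omega> j)) \<and> integrable lebesgue (?F (\<omega> j))"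
    if j: "j \<in> J" for j
  proof -
    have b: "open (\<omega> j)" "bounded (\<omega> j)" "\<omega> j \<in> sets lebesgue" "\<omega> j \<subseteq> \<Omega>"
      using \<omega>[OF j] bounded_subset[OF \<Omega>(2)] by auto
    have s: "pw_smooth (\<omega> j) (u j)" "pw_smooth (\<omega> j) v"
      using pw_smooth_subset[OF v b(1,4)] eq[OF j] by auto
    have eq': "h1_density K (u j) x = h1_density K v x" if "x \<in> \<omega> j" for x
      unfolding h1_density_def using grad_cong_open(1)[OF b(1) that eq[OF j]] eq[OF j that] by simp
    have "(h1_norm K (\<omega> j) (u j))\<^sup>2 = integral\<^sup>L (lebesgue_on (\<omega> j)) (h1_density K (u j))"
      by (rule h1_norm_sq[OF b(1,2) s(1)])
    also have "\<dots> = integral\<^sup>L (lebesgue_on (\<omega> j)) (h1_density K v)"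
      using eq' by (intro Bochner_Integration.integral_cong) (auto simp: space_restrict_space)
    also have "\<dots> = integral\<^sup>L lebesgue (?F (\<omega> j))"
      using b(3) by (simp add: integral_restrict_space)
    finally show ?thesis
      using h1_density_integrable[OF b(1,2) s(2), of K] b(3) by (simp add: integrable_restrict_space)
  qed
  have "(\<Sum>j\<in>J. (h1_norm K (\<omega> j) (u j))\<^sup>2) = (\<Sum>j\<in>J. integral\<^sup>L lebesgue (?F (\<omega> j)))"
    using 1 by simp
  also have "\<dots> = integral\<^sup>L lebesgue (\<lambda>x. \<Sum>j\<in>J. ?F (\<omega> j) x)"
    using 1 by (intro Bochner_Integration.integral_sum[symmetric]) auto
  also have "\<dots> \<le> integral\<^sup>L lebesgue (?F \<Omega>)"
  proof (rule integral_mono)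
    show "integrable lebesgue (\<lambda>x. \<Sum>j\<in>J. ?F (\<omega> j) x)"
      using 1 by (intro Bochner_Integration.integrable_sum) auto
    fix x
    have "(\<Sum>j\<in>J. indicator (\<omega> j) x :: real) = indicator (\<Union>j\<in>J. \<omega> j) x"
      using \<open>finite J\<close> disj by (intro indicator_UN_disjoint[symmetric]) (auto simp: disjoint_family_on_def)
    also have "\<dots> \<le> indicator \<Omega> x"
      using \<omega> by (auto simp: indicator_def)
    finally have "(\<Sum>j\<in>J. indicator (\<omega> j) x) * h1_density K v x \<le> indicator \<Omega> x * h1_density K v x"
      by (intro mult_right_mono h1_density_nonneg)
    then show "(\<Sum>j\<in>J. ?F (\<omega> j) x) \<le> ?F \<Omega> x"
      by (simp add: sum_distrib_right)
  qed (rule int)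
  also have "\<dots> = (h1_norm K \<Omega> v)\<^sup>2"
    unfolding h1_norm_sq[OF \<Omega> v] using \<Omega>' by (simp add: integral_restrict_space)
  finally show ?thesis .
qed

section \<open>The sesquilinear form on one subdomain\<close>

definition volume_form ::
    "(real^'n) set \<Rightarrow> (real^'n \<Rightarrow> complex) \<Rightarrow> (real^'n \<Rightarrow> real) \<Rightarrow>
     (real^'n \<Rightarrow> complex) \<Rightarrow> (real^'n \<Rightarrow> complex) \<Rightarrow> complex" where
  "volume_form \<omega> \<kappa> \<mu> u v = (LINT x:\<omega>|lebesgue.
     complex_of_real (\<mu> x) * (\<Sum>i\<in>UNIV. grad u x $ i * cnj (grad v x $ i))
     - (\<kappa> x)\<^sup>2 * u x * cnj (v x))"

definition surface_form ::
    "(real^'n) set \<Rightarrow> (real^'n \<Rightarrow> complex) \<Rightarrow> (real^'n \<Rightarrow> complex) \<Rightarrow> (real^'n \<Rightarrow> complex) \<Rightarrow> complex" where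
  "surface_form A \<kappa> u v = (LINT x:A|surface_measure. \<kappa> x * u x * cnj (v x))"

lemma form_a_eq:
  "form_a \<Omega> \<kappa> \<mu> D u v = (\<Sum>j=1..num_sub D. volume_form (subdom D j) \<kappa> \<mu> (u j) (v j)
     - \<i> * surface_form (frontier (subdom D j) \<inter> frontier \<Omega>) \<kappa> (u j) (v j))"
  by (simp add: form_a_def volume_form_def surface_form_def)

definition volume_density ::
    "(real^'n \<Rightarrow> complex) \<Rightarrow> (real^'n \<Rightarrow> real) \<Rightarrow>
     (real^'n \<Rightarrow> complex) \<Rightarrow> (real^'n \<Rightarrow> complex) \<Rightarrow> real^'n \<Rightarrow> complex" where
  "volume_density \<kappa> \<mu> u v x =
     complex_of_real (\<mu> x) * (\<Sum>i\<in>UNIV. grad u x $ i * cnj (grad v x $ i)) - (\<kappa> x)\<^sup>2 * u x * cnj (v x)"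

lemma AE_lebesgue_on_subset:
  assumes "open \<omega>" "open \<Omega>" "\<omega> \<subseteq> \<Omega>" "AE x in lebesgue_on \<Omega>. P x"
  shows "AE x in lebesgue_on \<omega>. P x"
proof -
  have "AE x in lebesgue. x \<in> \<Omega> \<longrightarrow> P x"
    using assms(2,4) by (subst (asm) AE_restrict_space_iff) auto
  then have "AE x in lebesgue. x \<in> \<omega> \<longrightarrow> P x"
    by eventually_elim (use assms(3) in auto)
  then show ?thesis using assms(1) by (subst AE_restrict_space_iff) auto
qed

lemma esssup_finite_bound:
  assumes "esssup M (\<lambda>x. ereal (f x)) < \<infinity>"
  obtains C where "AE x in M. f x \<le> C"
proof -
  obtain C where C: "esssup M (\<lambda>x. ereal (f x)) \<le> ereal C"
    using assms by (metis ereal_dense2 less_imp_le)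
  have "AE x in M. f x \<le> C"
    using esssup_AE[of "\<lambda>x. ereal (f x)" M]
  proof eventually_elim
    case (elim x)
    then have "ereal (f x) \<le> ereal C" using C by (rule order_trans)
    then show ?case by simp
  qed
  then show ?thesis by (rule that)
qed

lemma measurable_cnj [measurable]: "cnj \<in> borel_measurable borel"
  by (intro borel_measurable_continuous_onI continuous_intros)

lemma integral_cong_AE_integrable:
  assumes "integrable M f" "integrable M g" "AE x in M. f x = g x"
  shows "integral\<^sup>L M f = integral\<^sup>L M g"
  using assms by (intro integral_cong_AE) auto

text \<open>
  The coefficients are prescribed on the whole domain \<open>\<Omega>\<close>; the open set \<open>\<omega>\<close> is a subdomain.
\<close>

locale coefficients_on =
  fixes \<Omega> \<omega> :: "(real^'n) set" and \<kappa> \<mu>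
  assumes adm: "admissible_coefficients \<Omega> \<kappa> \<mu>"
    and \<Omega>: "open \<Omega>" and \<omega>: "open \<omega>" "bounded \<omega>" "\<omega> \<subseteq> \<Omega>"
begin

lemma coefficients_measurable [measurable]:
  "\<kappa> \<in> borel_measurable (lebesgue_on \<omega>)" "\<mu> \<in> borel_measurable (lebesgue_on \<omega>)"
  using adm \<omega>(3) by (auto simp: admissible_coefficients_def intro: measurable_restrict_mono)

lemma coefficients_bounded:
  obtains C where "0 \<le> C" "AE x in lebesgue_on \<omega>. cmod (\<kappa> x) \<le> C" "AE x in lebesgue_on \<omega>. \<bar>\<mu> x\<bar> \<le> C"
proof -
  obtain C where C: "AE x in lebesgue_on \<Omega>. cmod (\<kappa> x) \<le> C"
    using esssup_finite_bound[of "lebesgue_on \<Omega>" "\<lambda>x. cmod (\<kappa> x)"] adm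
    unfolding admissible_coefficients_def by blast
  obtain B where B: "AE x in lebesgue_on \<Omega>. \<mu> x \<le> B"
    using esssup_finite_bound[of "lebesgue_on \<Omega>" \<mu>] adm
    unfolding admissible_coefficients_def by blast
  have "AE x in lebesgue_on \<omega>. \<mu> x \<le> B" "AE x in lebesgue_on \<omega>. cmod (\<kappa> x) \<le> C"
    using AE_lebesgue_on_subset[OF \<omega>(1) \<Omega> \<omega>(3)] B C by auto
  moreover have "AE x in lebesgue_on \<omega>. \<mu> x > 0"
    using adm \<omega>(3) by (intro AE_I2) (auto simp: admissible_coefficients_def space_restrict_space)
  ultimately have "AE x in lebesgue_on \<omega>. cmod (\<kappa> x) \<le> max 0 (max B C) \<and> \<bar>\<mu> x\<bar> \<le> max 0 (max B C)"
    by eventually_elim auto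
  then show ?thesis by (intro that[of "max 0 (max B C)"]) (auto elim: eventually_mono)
qed

lemma volume_density_integrable:
  assumes u: "pw_smooth \<omega> u" and v: "pw_smooth \<omega> v"
  shows "integrable (lebesgue_on \<omega>) (volume_density \<kappa> \<mu> u v)"
proof -
  note [measurable] = pw_smooth_measurable(1,2)[OF \<omega>(1) u] pw_smooth_measurable(1,2)[OF \<omega>(1) v]
  obtain C where C: "0 \<le> C" "AE x in lebesgue_on \<omega>. cmod (\<kappa> x) \<le> C" "AE x in lebesgue_on \<omega>. \<bar>\<mu> x\<bar> \<le> C"
    by (rule coefficients_bounded)
  obtain Cu where Cu: "AE x in lebesgue_on \<omega>. cmod (u x) \<le> Cu"
    using pw_smooth_measurable(3)[OF \<omega>(1) u] by blast
  obtain Cv where Cv: "AE x in lebesgue_on \<omega>. cmod (v x) \<le> Cv"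
    using pw_smooth_measurable(3)[OF \<omega>(1) v] by blast
  obtain Gu where Gu: "AE x in lebesgue_on \<omega>. norm (grad u x) \<le> Gu"
    using pw_smooth_measurable(4)[OF \<omega>(1) u] by blast
  obtain Gv where Gv: "AE x in lebesgue_on \<omega>. norm (grad v x) \<le> Gv"
    using pw_smooth_measurable(4)[OF \<omega>(1) v] by blast
  show ?thesis
  proof (rule integrable_lebesgue_on_bounded[OF \<omega>(1,2)])
    show "volume_density \<kappa> \<mu> u v \<in> borel_measurable (lebesgue_on \<omega>)"
      unfolding volume_density_def by measurable
    show "AE x in lebesgue_on \<omega>. norm (volume_density \<kappa> \<mu> u v x)
        \<le> C * (\<Sum>i\<in>(UNIV::'n set). Gu * Gv) + C\<^sup>2 * Cu * Cv"
      using C(2,3) Cu Cv Gu Gv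
    proof eventually_elim
      case (elim x)
      have "cmod (\<Sum>i\<in>UNIV. grad u x $ i * cnj (grad v x $ i)) \<le> (\<Sum>i\<in>(UNIV::'n set). Gu * Gv)"
      proof (rule order_trans[OF norm_sum], rule sum_mono)
        fix i :: 'n
        have "cmod (grad u x $ i) \<le> Gu" "cmod (grad v x $ i) \<le> Gv"
          using elim order_trans[OF Finite_Cartesian_Product.norm_nth_le] by blast+
        then show "cmod (grad u x $ i * cnj (grad v x $ i)) \<le> Gu * Gv"
          by (simp add: norm_mult mult_mono')
      qed
      then have 1: "cmod (of_real (\<mu> x) * (\<Sum>i\<in>UNIV. grad u x $ i * cnj (grad v x $ i)))
          \<le> C * (\<Sum>i\<in>(UNIV::'n set). Gu * Gv)"
        unfolding norm_mult norm_of_real using elim C(1) by (intro mult_mono) auto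
      have "cmod ((\<kappa> x)\<^sup>2 * u x * cnj (v x)) = (cmod (\<kappa> x))\<^sup>2 * cmod (u x) * cmod (v x)"
        by (simp add: norm_mult norm_power)
      also have "\<dots> \<le> C\<^sup>2 * Cu * Cv"
        using elim by (intro mult_mono power_mono mult_nonneg_nonneg) (auto intro: order_trans[OF norm_ge_zero])
      finally show ?case
        unfolding volume_density_def using 1 by (intro order_trans[OF norm_triangle_ineq4]) linarith
    qed
  qed
qed

lemma volume_form_eq: "volume_form \<omega> \<kappa> \<mu> u v = integral\<^sup>L (lebesgue_on \<omega>) (volume_density \<kappa> \<mu> u v)"
proof -
  have "\<omega> \<in> sets lebesgue" using \<omega>(1) by auto
  then show ?thesis
    unfolding volume_form_def volume_density_def by (rule set_integral_eq_lebesgue_on)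
qed

lemma volume_form_add:
  assumes u: "pw_smooth \<omega> u" and v: "pw_smooth \<omega> v" and w: "pw_smooth \<omega> w"
  shows "volume_form \<omega> \<kappa> \<mu> (\<lambda>x. u x + v x) w = volume_form \<omega> \<kappa> \<mu> u w + volume_form \<omega> \<kappa> \<mu> v w" (is ?left)
    and "volume_form \<omega> \<kappa> \<mu> w (\<lambda>x. u x + v x) = volume_form \<omega> \<kappa> \<mu> w u + volume_form \<omega> \<kappa> \<mu> w v" (is ?right)
proof -
  note uv = pw_smooth_add[OF \<omega>(1) u v]
  note int = volume_density_integrable
  have "integral\<^sup>L (lebesgue_on \<omega>) (volume_density \<kappa> \<mu> (\<lambda>x. u x + v x) w)
      = integral\<^sup>L (lebesgue_on \<omega>) (\<lambda>x. volume_density \<kappa> \<mu> u w x + volume_density \<kappa> \<mu> v w x)"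
  proof (rule integral_cong_AE_integrable)
    show "AE x in lebesgue_on \<omega>. volume_density \<kappa> \<mu> (\<lambda>x. u x + v x) w x
        = volume_density \<kappa> \<mu> u w x + volume_density \<kappa> \<mu> v w x"
      using uv(2) by eventually_elim (simp add: volume_density_def algebra_simps sum.distrib)
  qed (simp_all add: int u v w uv(1))
  then show ?left
    unfolding volume_form_eq by (simp add: int u v w)
  have "integral\<^sup>L (lebesgue_on \<omega>) (volume_density \<kappa> \<mu> w (\<lambda>x. u x + v x))
      = integral\<^sup>L (lebesgue_on \<omega>) (\<lambda>x. volume_density \<kappa> \<mu> w u x + volume_density \<kappa> \<mu> w v x)"
  proof (rule integral_cong_AE_integrable)
    show "AE x in lebesgue_on \<omega>. volume_density \<kappa> \<mu> w (\<lambda>x. u x + v x) x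
        = volume_density \<kappa> \<mu> w u x + volume_density \<kappa> \<mu> w v x"
      using uv(2) by eventually_elim (simp add: volume_density_def algebra_simps sum.distrib)
  qed (simp_all add: int u v w uv(1))
  then show ?right
    unfolding volume_form_eq by (simp add: int u v w)
qed

lemma volume_form_mult_const:
  assumes u: "pw_smooth \<omega> u" and w: "pw_smooth \<omega> w"
  shows "volume_form \<omega> \<kappa> \<mu> (\<lambda>x. c * u x) w = c * volume_form \<omega> \<kappa> \<mu> u w" (is ?left)
    and "volume_form \<omega> \<kappa> \<mu> w (\<lambda>x. c * u x) = cnj c * volume_form \<omega> \<kappa> \<mu> w u" (is ?right)
proof -
  note cu = pw_smooth_mult_const[OF \<omega>(1) u, of c]
  note int = volume_density_integrable
  have "integral\<^sup>L (lebesgue_on \<omega>) (volume_density \<kappa> \<mu> (\<lambda>x. c * u x) w)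
      = integral\<^sup>L (lebesgue_on \<omega>) (\<lambda>x. c * volume_density \<kappa> \<mu> u w x)"
  proof (rule integral_cong_AE_integrable)
    show "AE x in lebesgue_on \<omega>. volume_density \<kappa> \<mu> (\<lambda>x. c * u x) w x = c * volume_density \<kappa> \<mu> u w x"
      using cu(2) by eventually_elim (simp add: volume_density_def algebra_simps sum_distrib_left)
  qed (simp_all add: int u w cu(1))
  then show ?left
    unfolding volume_form_eq by (simp add: int u w)
  have "integral\<^sup>L (lebesgue_on \<omega>) (volume_density \<kappa> \<mu> w (\<lambda>x. c * u x))
      = integral\<^sup>L (lebesgue_on \<omega>) (\<lambda>x. cnj c * volume_density \<kappa> \<mu> w u x)"
  proof (rule integral_cong_AE_integrable)
    show "AE x in lebesgue_on \<omega>. volume_density \<kappa> \<mu> w (\<lambda>x. c * u x) x = cnj c * volume_density \<kappa> \<mu> w u x"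
      using cu(2) by eventually_elim (simp add: volume_density_def algebra_simps sum_distrib_left)
  qed (simp_all add: int u w cu(1))
  then show ?right
    unfolding volume_form_eq by (simp add: int u w)
qed

text \<open>
  The gradient term is real, and \<open>Im (\<kappa>\<^sup>2) = 2 Re \<kappa> Im \<kappa> \<ge> 0\<close>.
\<close>

lemma Im_volume_form_le:
  assumes u: "pw_smooth \<omega> u"
  shows "Im (volume_form \<omega> \<kappa> \<mu> u u) \<le> 0"
proof -
  have "Im (volume_density \<kappa> \<mu> u u x) \<le> 0" if "x \<in> \<omega>" for x
  proof -
    have \<kappa>: "0 \<le> Re (\<kappa> x)" "0 \<le> Im (\<kappa> x)"
      using adm \<omega>(3) that by (auto simp: admissible_coefficients_def)
    have sq: "z * cnj z = of_real ((cmod z)\<^sup>2)" for z by (rule complex_norm_square[symmetric])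
    have "volume_density \<kappa> \<mu> u u x
        = of_real (\<mu> x * (\<Sum>i\<in>UNIV. (cmod (grad u x $ i))\<^sup>2)) - (\<kappa> x)\<^sup>2 * of_real ((cmod (u x))\<^sup>2)"
      unfolding volume_density_def mult.assoc sq by simp
    then have "Im (volume_density \<kappa> \<mu> u u x) = - (2 * Re (\<kappa> x) * Im (\<kappa> x)) * (cmod (u x))\<^sup>2"
      by (simp add: power2_eq_square del: of_real_mult of_real_sum of_real_power)
    then show ?thesis using \<kappa> by (simp add: mult_nonneg_nonneg)
  qed
  then have "integral\<^sup>L (lebesgue_on \<omega>) (\<lambda>x. Im (volume_density \<kappa> \<mu> u u x))
      \<le> integral\<^sup>L (lebesgue_on \<omega>) (\<lambda>_. 0)"
    using volume_density_integrable[OF u u] integral_mono[of "lebesgue_on \<omega>"]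
    by (intro integral_mono) (auto simp: space_restrict_space)
  then show ?thesis
    unfolding volume_form_eq using volume_density_integrable[OF u u] by simp
qed

end

text \<open>
  \<open>\<Gamma>\<close> is the boundary of the domain and \<open>A\<close> the part of it that belongs to one subdomain.
\<close>

locale surface_coefficient =
  fixes A \<Gamma> :: "(real^'n) set" and \<kappa>
  assumes A: "A \<in> sets borel" "A \<subseteq> \<Gamma>" and fin: "emeasure surface_measure \<Gamma> < \<infinity>" and \<Gamma>: "\<Gamma> \<in> sets borel"
    and \<kappa>: "set_borel_measurable borel \<Gamma> \<kappa>" "bounded (\<kappa> ` \<Gamma>)"
    and sign: "\<And>x. x \<in> \<Gamma> \<Longrightarrow> 0 \<le> Re (\<kappa> x)"
begin

lemma surface_integrable:
  assumes u: "u \<in> borel_measurable borel" "bounded (u ` A)" and v: "v \<in> borel_measurable borel" "bounded (v ` A)"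
  shows "set_integrable surface_measure A (\<lambda>x. \<kappa> x * u x * cnj (v x))"
proof -
  obtain C where C: "\<And>x. x \<in> \<Gamma> \<Longrightarrow> cmod (\<kappa> x) \<le> C" using \<kappa>(2) by (auto simp: bounded_iff)
  obtain Cu where Cu: "\<And>x. x \<in> A \<Longrightarrow> cmod (u x) \<le> Cu" using u(2) by (auto simp: bounded_iff)
  obtain Cv where Cv: "\<And>x. x \<in> A \<Longrightarrow> cmod (v x) \<le> Cv" using v(2) by (auto simp: bounded_iff)
  have finA: "emeasure surface_measure A < \<infinity>"
    by (rule le_less_trans[OF emeasure_mono[OF A(2)] fin]) (simp add: \<Gamma>)
  have "integrable surface_measure (\<lambda>x. C * Cu * Cv * indicator A x)"
    using A(1) finA by (intro integrable_mult_right integrable_real_indicator) auto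
  then show ?thesis
    unfolding set_integrable_def
  proof (rule Bochner_Integration.integrable_bound)
    have "(\<lambda>x. indicator A x *\<^sub>R (\<kappa> x * u x * cnj (v x)))
        = (\<lambda>x. indicator A x *\<^sub>R ((indicator \<Gamma> x *\<^sub>R \<kappa> x) * u x * cnj (v x)))"
      using A(2) by (intro ext) (auto simp: indicator_def of_bool_def)
    also have "\<dots> \<in> borel_measurable borel"
      using \<kappa>(1) u(1) v(1) A(1) unfolding set_borel_measurable_def by measurable
    finally show "(\<lambda>x. indicator A x *\<^sub>R (\<kappa> x * u x * cnj (v x))) \<in> borel_measurable surface_measure"
      by (simp add: measurable_cong_sets[OF sets_surface_measure refl])
    have "cmod (\<kappa> x * u x * cnj (v x)) \<le> C * Cu * Cv" if x: "x \<in> A" for x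
    proof -
      have "cmod (\<kappa> x) \<le> C" "cmod (u x) \<le> Cu" "cmod (v x) \<le> Cv" using C Cu Cv A(2) x by auto
      then show ?thesis
        unfolding norm_mult complex_mod_cnj
        by (intro mult_mono mult_nonneg_nonneg) (auto intro: order_trans[OF norm_ge_zero])
    qed
    then show "AE x in surface_measure. norm (indicator A x *\<^sub>R (\<kappa> x * u x * cnj (v x)))
        \<le> norm (C * Cu * Cv * indicator A x)"
      by (intro AE_I2) (auto simp: indicator_def intro: order_trans[OF _ abs_ge_self])
  qed
qed

lemma surface_form_add:
  assumes "u \<in> borel_measurable borel" "bounded (u ` A)" "v \<in> borel_measurable borel" "bounded (v ` A)"
    "w \<in> borel_measurable borel" "bounded (w ` A)"
  shows "surface_form A \<kappa> (\<lambda>x. u x + v x) w = surface_form A \<kappa> u w + surface_form A \<kappa> v w"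
    and "surface_form A \<kappa> w (\<lambda>x. u x + v x) = surface_form A \<kappa> w u + surface_form A \<kappa> w v"
proof -
  note int = surface_integrable[OF assms(1,2,5,6)] surface_integrable[OF assms(3,4,5,6)]
    surface_integrable[OF assms(5,6,1,2)] surface_integrable[OF assms(5,6,3,4)]
  show "surface_form A \<kappa> (\<lambda>x. u x + v x) w = surface_form A \<kappa> u w + surface_form A \<kappa> v w"
    unfolding surface_form_def set_integral_add(2)[OF int(1,2), symmetric] by (simp add: algebra_simps)
  show "surface_form A \<kappa> w (\<lambda>x. u x + v x) = surface_form A \<kappa> w u + surface_form A \<kappa> w v"
    unfolding surface_form_def set_integral_add(2)[OF int(3,4), symmetric] by (simp add: algebra_simps)
qed

lemma surface_form_mult_const:
  "surface_form A \<kappa> (\<lambda>x. c * u x) w = c * surface_form A \<kappa> u w"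
  "surface_form A \<kappa> w (\<lambda>x. c * u x) = cnj c * surface_form A \<kappa> w u"
  unfolding surface_form_def
  by (subst set_integral_mult_right[symmetric], simp add: mult_ac)+

lemma Re_surface_form_nonneg:
  assumes "u \<in> borel_measurable borel" "bounded (u ` A)"
  shows "0 \<le> Re (surface_form A \<kappa> u u)"
proof -
  have int: "integrable surface_measure (\<lambda>x. indicator A x *\<^sub>R (\<kappa> x * u x * cnj (u x)))"
    using surface_integrable[OF assms assms] by (simp add: set_integrable_def)
  have nn: "0 \<le> Re (indicator A x *\<^sub>R (\<kappa> x * u x * cnj (u x)))" for x
  proof -
    have "Re (\<kappa> x * u x * cnj (u x)) = Re (\<kappa> x) * (cmod (u x))\<^sup>2"
      by (simp add: cmod_power2) (simp add: algebra_simps power2_eq_square)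
    then show ?thesis using sign[of x] A(2) by (auto simp: indicator_def)
  qed
  have "0 \<le> integral\<^sup>L surface_measure (\<lambda>x. Re (indicator A x *\<^sub>R (\<kappa> x * u x * cnj (u x))))"
    using nn by (rule Bochner_Integration.integral_nonneg)
  also have "\<dots> = Re (surface_form A \<kappa> u u)"
    unfolding surface_form_def set_lebesgue_integral_def by (rule integral_Re[OF int])
  finally show ?thesis .
qed

end

section \<open>The finite element spaces\<close>

lemma simplex_full_dim:
  fixes \<tau> :: "(real^'n) set"
  assumes "int CARD('n) simplex \<tau>"
  shows "aff_dim \<tau> = int CARD('n)" "interior \<tau> \<noteq> {}" "convex \<tau>" "compact \<tau>"
proof -
  show dim: "aff_dim \<tau> = int CARD('n)" using assms by (rule aff_dim_simplex)
  show cv: "convex \<tau>" using assms by (rule convex_simplex)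
  show "compact \<tau>" using assms by (rule compact_simplex)
  have "affine hull \<tau> = UNIV" using aff_dim_eq_full[of \<tau>] dim by simp
  moreover have "\<tau> \<noteq> {}" using dim by auto
  ultimately show "interior \<tau> \<noteq> {}"
    using rel_interior_eq_empty[OF cv] rel_interior_interior[of \<tau>] by simp
qed

lemma polyhedral_topology:
  fixes S :: "(real^'n) set"
  assumes "polyhedral S"
  shows "open S" "bounded S" "interior (closure S) = S"
proof -
  obtain F where F: "finite F" "\<And>\<tau>. \<tau> \<in> F \<Longrightarrow> int CARD('n) simplex \<tau>" "S = interior (\<Union>F)"
    using assms by (auto simp: polyhedral_def)
  show S: "open S" using F(3) by simp
  have comp: "compact (\<Union>F)" using F(1,2) simplex_full_dim(4) by (intro compact_Union) auto
  show "bounded S"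
    using bounded_subset[OF compact_imp_bounded[OF comp]] interior_subset unfolding F(3) by blast
  have "closure S \<subseteq> \<Union>F"
    unfolding F(3) using comp interior_subset by (intro closure_minimal) (auto simp: compact_imp_closed)
  then have "interior (closure S) \<subseteq> S" unfolding F(3) by (rule interior_mono)
  moreover have "S \<subseteq> interior (closure S)" using S closure_subset by (intro interior_maximal)
  ultimately show "interior (closure S) = S" by blast
qed

lemma poly_of_degree_le_zero: "poly_of_degree_le k (\<lambda>_. 0)"
  unfolding poly_of_degree_le_def by (rule exI[of _ "\<lambda>_. 0"]) simp

lemma poly_of_degree_le_add:
  assumes "poly_of_degree_le k p" "poly_of_degree_le k q"
  shows "poly_of_degree_le k (\<lambda>x. p x + q x)"
proof -
  obtain c d :: "('a \<Rightarrow> nat) \<Rightarrow> complex" where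
    "p = (\<lambda>x. \<Sum>\<alpha> | sum \<alpha> UNIV \<le> k. c \<alpha> * (\<Prod>i\<in>UNIV. complex_of_real (x $ i) ^ \<alpha> i))"
    "q = (\<lambda>x. \<Sum>\<alpha> | sum \<alpha> UNIV \<le> k. d \<alpha> * (\<Prod>i\<in>UNIV. complex_of_real (x $ i) ^ \<alpha> i))"
    using assms unfolding poly_of_degree_le_def by blast
  then show ?thesis
    unfolding poly_of_degree_le_def
    by (intro exI[of _ "\<lambda>\<alpha>. c \<alpha> + d \<alpha>"]) (simp add: sum.distrib distrib_right)
qed

lemma poly_of_degree_le_mult_const:
  assumes "poly_of_degree_le k p"
  shows "poly_of_degree_le k (\<lambda>x. c * p x)"
proof -
  obtain d :: "('a \<Rightarrow> nat) \<Rightarrow> complex" where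
    "p = (\<lambda>x. \<Sum>\<alpha> | sum \<alpha> UNIV \<le> k. d \<alpha> * (\<Prod>i\<in>UNIV. complex_of_real (x $ i) ^ \<alpha> i))"
    using assms unfolding poly_of_degree_le_def by blast
  then show ?thesis
    unfolding poly_of_degree_le_def
    by (intro exI[of _ "\<lambda>\<alpha>. c * d \<alpha>"]) (simp add: sum_distrib_left mult.assoc)
qed

lemma vector_space_cmul: "vector_space (cmul :: complex \<Rightarrow> (nat \<Rightarrow> 'a \<Rightarrow> complex) \<Rightarrow> nat \<Rightarrow> 'a \<Rightarrow> complex)"
  by unfold_locales (auto simp: cmul_def fun_eq_iff algebra_simps)

lemma restr_add: "restr A (\<lambda>x. u x + v x) = (\<lambda>x. restr A u x + restr A v x)"
  by (auto simp: restr_def)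

lemma restr_mult: "restr A (\<lambda>x. c * u x) = (\<lambda>x. c * restr A u x)"
  by (auto simp: restr_def)

locale fe_mesh =
  fixes \<Omega> :: "(real^'n) set" and k :: nat and D :: "(real^'n) decomposition" and h :: real
  assumes poly\<Omega>: "polyhedral \<Omega>" and mesh: "mesh_decomposition \<Omega> h D"
begin

abbreviation "J \<equiv> {1..num_sub D}"

sublocale cm: vector_space "cmul :: complex \<Rightarrow> (nat \<Rightarrow> real^'n \<Rightarrow> complex) \<Rightarrow> nat \<Rightarrow> real^'n \<Rightarrow> complex"
  by (rule vector_space_cmul)

subsection \<open>Geometry of the mesh\<close>

lemma \<Omega>_topology: "open \<Omega>" "bounded \<Omega>" "interior (closure \<Omega>) = \<Omega>"
  using polyhedral_topology[OF poly\<Omega>] by auto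

lemma cells: "finite (cells D)" "\<tau> \<in> cells D \<Longrightarrow> int CARD('n) simplex \<tau>" "\<Union>(cells D) = closure \<Omega>"
  using mesh by (auto simp: mesh_decomposition_def triangulation_def)

lemma cell_inter_face:
  assumes "\<sigma> \<in> cells D" "\<tau> \<in> cells D"
  shows "(\<sigma> \<inter> \<tau>) face_of \<sigma>"
  using mesh assms by (simp add: mesh_decomposition_def triangulation_def)

lemma subdom:
  assumes j: "j \<in> J"
  shows "open (subdom D j)" "bounded (subdom D j)" "subdom D j \<subseteq> \<Omega>"
    "closure (subdom D j) \<subseteq> closure \<Omega>" "frontier (subdom D j) \<subseteq> closure (subdom D j)"
    "\<exists>C\<subseteq>cells D. closure (subdom D j) = \<Union>C"
proof -
  have p: "polyhedral (subdom D j)" using mesh j by (simp add: mesh_decomposition_def)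
  show o: "open (subdom D j)" using polyhedral_topology[OF p] by simp
  show cl: "closure (subdom D j) \<subseteq> closure \<Omega>"
    using mesh j by (auto simp: mesh_decomposition_def)
  have "subdom D j \<subseteq> interior (closure \<Omega>)"
    using o cl closure_subset by (intro interior_maximal) auto
  then show "subdom D j \<subseteq> \<Omega>" using \<Omega>_topology(3) by simp
  show "bounded (subdom D j)" using polyhedral_topology[OF p] by simp
  show "frontier (subdom D j) \<subseteq> closure (subdom D j)" by (auto simp: frontier_def)
  show "\<exists>C\<subseteq>cells D. closure (subdom D j) = \<Union>C"
    using mesh j by (auto simp: mesh_decomposition_def)
qed

lemma closure_\<Omega>_cover: "(\<Union>j\<in>J. closure (subdom D j)) = closure \<Omega>"
  using mesh by (simp add: mesh_decomposition_def)

lemma subdom_disjoint: "i \<in> J \<Longrightarrow> j \<in> J \<Longrightarrow> i \<noteq> j \<Longrightarrow> subdom D i \<inter> subdom D j = {}"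
  using mesh by (simp add: mesh_decomposition_def)

lemma closures_meet_on_frontiers:
  assumes "i \<in> J" "j \<in> J" "i \<noteq> j" "x \<in> closure (subdom D i)" "x \<in> closure (subdom D j)"
  shows "x \<in> frontier (subdom D i)"
proof -
  have "subdom D i \<inter> closure (subdom D j) = {}"
    using subdom_disjoint[OF assms(1-3)] subdom(1)[OF assms(1)]
    by (simp add: open_Int_closure_eq_empty)
  then show ?thesis
    using assms(4,5) subdom(1)[OF assms(1)] by (auto simp: frontier_def interior_open)
qed

text \<open>
  The cell is covered by the cells of the subdomain closures.  If it belonged to none of these families, it would be
  covered by its intersections with other cells, which are proper faces and hence negligible.
\<close>

lemma cell_in_subdomain:
  assumes \<tau>: "\<tau> \<in> cells D"
  shows "\<exists>j\<in>J. \<tau> \<subseteq> closure (subdom D j)"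
proof (rule ccontr)
  assume "\<not> (\<exists>j\<in>J. \<tau> \<subseteq> closure (subdom D j))"
  then have no: "\<not> \<tau> \<subseteq> closure (subdom D j)" if "j \<in> J" for j using that by blast
  have neg: "negligible (\<tau> \<inter> \<sigma>)" if \<sigma>: "\<sigma> \<in> cells D" "\<sigma> \<noteq> \<tau>" for \<sigma>
  proof -
    note dim = simplex_full_dim(1)[OF cells(2)]
    have "\<tau> \<inter> \<sigma> \<noteq> \<tau>"
    proof
      assume eq: "\<tau> \<inter> \<sigma> = \<tau>"
      then have "\<tau> face_of \<sigma>"
        using cell_inter_face[OF \<sigma>(1) \<tau>] by (simp add: Int_commute)
      then have "aff_dim \<tau> < aff_dim \<sigma>"
        using \<sigma> simplex_full_dim(3)[OF cells(2)[OF \<sigma>(1)]] by (intro face_of_aff_dim_lt) auto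
      then show False using dim[OF \<tau>] dim[OF \<sigma>(1)] by simp
    qed
    then have "aff_dim (\<tau> \<inter> \<sigma>) < aff_dim \<tau>"
      using cell_inter_face[OF \<tau> \<sigma>(1)] simplex_full_dim(3)[OF cells(2)[OF \<tau>]]
      by (intro face_of_aff_dim_lt) auto
    then have "aff_dim (\<tau> \<inter> \<sigma>) < DIM(real^'n)" using dim[OF \<tau>] by simp
    then obtain a b where ab: "a \<noteq> 0" "\<tau> \<inter> \<sigma> \<subseteq> {x. a \<bullet> x = b}"
      by (rule aff_lowdim_subset_hyperplane)
    then show ?thesis using negligible_hyperplane[of a b] negligible_subset by blast
  qed
  have "\<tau> \<subseteq> (\<Union>\<sigma>\<in>cells D - {\<tau>}. \<tau> \<inter> \<sigma>)"
  proof
    fix x assume x: "x \<in> \<tau>"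
    then have "x \<in> closure \<Omega>" using \<tau> cells(3) by blast
    then obtain j where j: "j \<in> J" "x \<in> closure (subdom D j)" using closure_\<Omega>_cover by blast
    then obtain C where C: "C \<subseteq> cells D" "closure (subdom D j) = \<Union>C" using subdom(6) by blast
    then obtain \<sigma> where \<sigma>: "\<sigma> \<in> C" "x \<in> \<sigma>" using j by blast
    have "\<sigma> \<noteq> \<tau>" using no[OF j(1)] C(2) \<sigma>(1) by blast
    then show "x \<in> (\<Union>\<sigma>\<in>cells D - {\<tau>}. \<tau> \<inter> \<sigma>)" using x \<sigma> C(1) by blast
  qed
  moreover have "negligible (\<Union>\<sigma>\<in>cells D - {\<tau>}. \<tau> \<inter> \<sigma>)"
    using cells(1) neg by (intro negligible_Union) auto
  ultimately have "negligible \<tau>" by (rule negligible_subset[rotated])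
  then have "negligible (interior \<tau>)" using interior_subset by (rule negligible_subset)
  then show False
    using open_not_negligible[of "interior \<tau>"] simplex_full_dim(2)[OF cells(2)[OF \<tau>]] by simp
qed

subsection \<open>Finite element functions\<close>

lemma Vh_D:
  assumes "v \<in> Vh \<Omega> k D"
  shows "continuous_on (closure \<Omega>) v" "\<tau> \<in> cells D \<Longrightarrow> \<exists>p. poly_of_degree_le k p \<and> (\<forall>x\<in>\<tau>. v x = p x)"
    "x \<notin> closure \<Omega> \<Longrightarrow> v x = 0"
  using assms by (auto simp: Vh_def)

lemma Vh_zero: "(\<lambda>_. 0) \<in> Vh \<Omega> k D"
  using poly_of_degree_le_zero by (fastforce simp: Vh_def)

lemma Vh_add:
  assumes "u \<in> Vh \<Omega> k D" "v \<in> Vh \<Omega> k D"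
  shows "(\<lambda>x. u x + v x) \<in> Vh \<Omega> k D"
proof -
  have "\<exists>p. poly_of_degree_le k p \<and> (\<forall>x\<in>\<tau>. u x + v x = p x)" if \<tau>: "\<tau> \<in> cells D" for \<tau>
  proof -
    obtain p q where "poly_of_degree_le k p" "\<forall>x\<in>\<tau>. u x = p x" "poly_of_degree_le k q" "\<forall>x\<in>\<tau>. v x = q x"
      using Vh_D(2)[OF assms(1) \<tau>] Vh_D(2)[OF assms(2) \<tau>] by blast
    then show ?thesis by (intro exI[of _ "\<lambda>x. p x + q x"]) (simp add: poly_of_degree_le_add)
  qed
  then show ?thesis
    unfolding Vh_def using Vh_D(1,3)[OF assms(1)] Vh_D(1,3)[OF assms(2)] by (auto intro: continuous_on_add)
qed

lemma Vh_mult_const: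
  assumes "v \<in> Vh \<Omega> k D"
  shows "(\<lambda>x. c * v x) \<in> Vh \<Omega> k D"
proof -
  have "\<exists>p. poly_of_degree_le k p \<and> (\<forall>x\<in>\<tau>. c * v x = p x)" if \<tau>: "\<tau> \<in> cells D" for \<tau>
  proof -
    obtain p where "poly_of_degree_le k p" "\<forall>x\<in>\<tau>. v x = p x"
      using Vh_D(2)[OF assms \<tau>] by blast
    then show ?thesis by (intro exI[of _ "\<lambda>x. c * p x"]) (simp add: poly_of_degree_le_mult_const)
  qed
  then show ?thesis
    unfolding Vh_def using Vh_D(1,3)[OF assms] by (auto intro: continuous_on_mult_left)
qed

text \<open>
  On the interior of a cell the function is a polynomial; the union of the frontiers of the cells
  is negligible.
\<close>

lemma Vh_pw_smooth:
  assumes v: "v \<in> Vh \<Omega> k D"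
  shows "pw_smooth \<Omega> v"
proof -
  define W where "W = (\<Union>\<tau>\<in>cells D. interior \<tau> \<inter> \<Omega>)"
  have oW: "open (interior \<tau> \<inter> \<Omega>)" for \<tau> using \<Omega>_topology(1) by auto
  have W: "open W" "W \<subseteq> \<Omega>" unfolding W_def by (intro open_UN ballI oW) auto
  have "\<Omega> - W \<subseteq> (\<Union>\<tau>\<in>cells D. frontier \<tau>)"
  proof
    fix x assume x: "x \<in> \<Omega> - W"
    then obtain \<tau> where \<tau>: "\<tau> \<in> cells D" "x \<in> \<tau>" using cells(3) closure_subset by blast
    then have "x \<notin> interior \<tau>" using x by (auto simp: W_def)
    then show "x \<in> (\<Union>\<tau>\<in>cells D. frontier \<tau>)"
      using \<tau> closure_subset by (auto simp: frontier_def)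
  qed
  moreover have "negligible (\<Union>\<tau>\<in>cells D. frontier \<tau>)"
    using cells(1,2) simplex_full_dim(3) by (intro negligible_Union) (auto intro: negligible_convex_frontier)
  ultimately have neg: "negligible (\<Omega> - W)" by (rule negligible_subset[rotated])
  have local: "(\<forall>x\<in>interior \<tau> \<inter> \<Omega>. v differentiable (at x)) \<and> continuous_on (interior \<tau> \<inter> \<Omega>) (grad v)
      \<and> bounded (grad v ` (interior \<tau> \<inter> \<Omega>))" if \<tau>: "\<tau> \<in> cells D" for \<tau>
  proof -
    obtain p where p: "poly_of_degree_le k p" "\<forall>x\<in>\<tau>. v x = p x" using Vh_D(2)[OF v \<tau>] by blast
    note C1 = C1_grad[OF C1_polynomial[OF p(1)]]
    have int: "x \<in> \<tau>" if "x \<in> interior \<tau> \<inter> \<Omega>" for x using that interior_subset by auto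
    have eq: "grad v x = grad p x" "v differentiable (at x) \<longleftrightarrow> p differentiable (at x)"
      if "x \<in> interior \<tau> \<inter> \<Omega>" for x
      using grad_cong_open[OF oW that, of v p] p(2) int by auto
    have "continuous_on (interior \<tau> \<inter> \<Omega>) (grad v)"
      by (subst continuous_on_cong[OF refl eq(1)]) (auto intro: continuous_on_subset[OF C1(2)])
    moreover have "bounded (grad p ` \<tau>)"
      using simplex_full_dim(4)[OF cells(2)[OF \<tau>]] C1(2)
      by (intro compact_imp_bounded compact_continuous_image) (auto intro: continuous_on_subset)
    then have "bounded (grad v ` (interior \<tau> \<inter> \<Omega>))"
      by (rule bounded_subset) (use eq(1) int in auto)
    ultimately show ?thesis using eq(2) C1(1) by auto
  qed
  have "continuous_on W (grad v)"
    unfolding W_def using local oW by (intro continuous_on_open_UN) auto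
  moreover have "bounded (grad v ` W)"
    unfolding W_def image_UN using local cells(1) by (intro bounded_UN) auto
  moreover have "\<forall>x\<in>W. v differentiable (at x)" using local by (auto simp: W_def)
  moreover have "continuous_on \<Omega> v"
    using Vh_D(1)[OF v] closure_subset by (rule continuous_on_subset)
  moreover have "bounded (v ` \<Omega>)"
  proof -
    have "compact (v ` closure \<Omega>)"
      using Vh_D(1)[OF v] \<Omega>_topology(2) by (intro compact_continuous_image) (auto simp: compact_closure)
    then show ?thesis
      using closure_subset by (meson bounded_subset compact_imp_bounded image_mono)
  qed
  ultimately show ?thesis unfolding pw_smooth_def using W neg by blast
qed

lemma Vh_sub_props:
  assumes j: "j \<in> J" and u: "u \<in> Vh_sub \<Omega> k D j"
  shows "pw_smooth (subdom D j) u" "u \<in> borel_measurable borel" "bounded (range u)"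
    "continuous_on (closure (subdom D j)) u" "x \<notin> closure (subdom D j) \<Longrightarrow> u x = 0"
proof -
  obtain w where w: "w \<in> Vh \<Omega> k D" "u = restr (closure (subdom D j)) w"
    using u by (auto simp: Vh_sub_def)
  have eq: "u x = w x" if "x \<in> closure (subdom D j)" for x using that by (simp add: w restr_def)
  show "pw_smooth (subdom D j) u"
    by (rule pw_smooth_subset[OF Vh_pw_smooth[OF w(1)] subdom(1,3)[OF j]])
      (use eq closure_subset in auto)
  show cont: "continuous_on (closure (subdom D j)) u"
    by (subst continuous_on_cong[OF refl eq])
      (auto intro: continuous_on_subset[OF Vh_D(1)[OF w(1)] subdom(4)[OF j]])
  have "(\<lambda>x. indicator (closure (subdom D j)) x *\<^sub>R u x) \<in> borel_measurable borel"
    using cont by (intro borel_measurable_continuous_on_indicator) auto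
  moreover have "(\<lambda>x. indicator (closure (subdom D j)) x *\<^sub>R u x) = u"
    by (auto simp: w restr_def indicator_def fun_eq_iff)
  ultimately show "u \<in> borel_measurable borel" by simp
  have "compact (u ` closure (subdom D j))"
    using cont subdom(2)[OF j] by (intro compact_continuous_image) (auto simp: compact_closure)
  then have "bounded (insert 0 (u ` closure (subdom D j)))" by (simp add: compact_imp_bounded)
  then show "bounded (range u)"
    by (rule bounded_subset) (auto simp: w restr_def)
  show "x \<notin> closure (subdom D j) \<Longrightarrow> u x = 0" by (simp add: w restr_def)
qed

lemma broken_D:
  assumes "u \<in> broken_Vh \<Omega> k D"
  shows "j \<in> J \<Longrightarrow> u j \<in> Vh_sub \<Omega> k D j" "j \<notin> J \<Longrightarrow> u j = (\<lambda>_. 0)"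
  using assms by (auto simp: broken_Vh_def zero_fun_def)

lemma subspace_broken: "cm.subspace (broken_Vh \<Omega> k D)"
proof (rule cm.subspaceI)
  have z: "(\<lambda>_. 0) \<in> Vh_sub \<Omega> k D j" for j
    unfolding Vh_sub_def using Vh_zero by (intro image_eqI[of _ _ "\<lambda>_. 0"]) (auto simp: restr_def)
  then show "0 \<in> broken_Vh \<Omega> k D" by (simp add: broken_Vh_def zero_fun_def)
  show "u + v \<in> broken_Vh \<Omega> k D" if uv: "u \<in> broken_Vh \<Omega> k D" "v \<in> broken_Vh \<Omega> k D" for u v
  proof -
    have "(\<lambda>x. u j x + v j x) \<in> Vh_sub \<Omega> k D j" if j: "j \<in> J" for j
    proof -
      obtain a b where "a \<in> Vh \<Omega> k D" "b \<in> Vh \<Omega> k D"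
        "u j = restr (closure (subdom D j)) a" "v j = restr (closure (subdom D j)) b"
        using broken_D(1)[OF uv(1) j] broken_D(1)[OF uv(2) j] by (auto simp: Vh_sub_def)
      then show ?thesis
        unfolding Vh_sub_def by (intro image_eqI[where x = "\<lambda>x. a x + b x"]) (simp_all add: restr_add Vh_add)
    qed
    then show ?thesis using broken_D(2)[OF uv(1)] broken_D(2)[OF uv(2)]
      by (auto simp: broken_Vh_def plus_fun_def zero_fun_def)
  qed
  show "cmul c u \<in> broken_Vh \<Omega> k D" if u: "u \<in> broken_Vh \<Omega> k D" for c u
  proof -
    have "(\<lambda>x. c * u j x) \<in> Vh_sub \<Omega> k D j" if j: "j \<in> J" for j
    proof -
      obtain a where "a \<in> Vh \<Omega> k D" "u j = restr (closure (subdom D j)) a"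
        using broken_D(1)[OF u j] by (auto simp: Vh_sub_def)
      then show ?thesis
        unfolding Vh_sub_def by (intro image_eqI[where x = "\<lambda>x. c * a x"]) (simp_all add: restr_mult Vh_mult_const)
    qed
    then show ?thesis using broken_D(2)[OF u]
      by (auto simp: broken_Vh_def cmul_def zero_fun_def)
  qed
qed

lemma to_broken_add: "to_broken D (\<lambda>x. u x + v x) = to_broken D u + to_broken D v"
  by (auto simp: to_broken_def restr_def fun_eq_iff)

lemma to_broken_mult: "to_broken D (\<lambda>x. c * u x) = cmul c (to_broken D u)"
  by (auto simp: to_broken_def restr_def cmul_def fun_eq_iff)

lemma to_broken_zero: "to_broken D (\<lambda>_. 0) = 0"
  by (auto simp: to_broken_def restr_def fun_eq_iff)

lemma to_broken_mem: "v \<in> Vh \<Omega> k D \<Longrightarrow> to_broken D v \<in> broken_Vh \<Omega> k D"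
  by (auto simp: to_broken_def broken_Vh_def Vh_sub_def)

lemma subspace_conforming: "cm.subspace (to_broken D ` Vh \<Omega> k D)"
proof (rule cm.subspaceI)
  show "0 \<in> to_broken D ` Vh \<Omega> k D" using to_broken_zero Vh_zero by (metis imageI)
  show "x + y \<in> to_broken D ` Vh \<Omega> k D" if "x \<in> to_broken D ` Vh \<Omega> k D" "y \<in> to_broken D ` Vh \<Omega> k D" for x y
    using that by (auto simp flip: to_broken_add intro: Vh_add)
  show "cmul c x \<in> to_broken D ` Vh \<Omega> k D" if "x \<in> to_broken D ` Vh \<Omega> k D" for c x
    using that by (auto simp flip: to_broken_mult intro: Vh_mult_const)
qed

lemma trace_add: "trace_on D (u + v) = trace_on D u + trace_on D v"
  by (auto simp: trace_on_def restr_def fun_eq_iff)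

lemma trace_mult: "trace_on D (cmul c u) = cmul c (trace_on D u)"
  by (auto simp: trace_on_def restr_def cmul_def fun_eq_iff)

lemma trace_image: "trace_on D ` broken_Vh \<Omega> k D = multi_trace \<Omega> k D"
proof
  have restr2: "restr (frontier (subdom D j)) (restr (closure (subdom D j)) w)
      = restr (frontier (subdom D j)) w" if "j \<in> J" for j w
    using subdom(5)[OF that] by (auto simp: restr_def fun_eq_iff)
  show "trace_on D ` broken_Vh \<Omega> k D \<subseteq> multi_trace \<Omega> k D"
  proof (rule image_subsetI)
    fix u assume u: "u \<in> broken_Vh \<Omega> k D"
    have "restr (frontier (subdom D j)) (u j) \<in> Vh_bd \<Omega> k D j" if j: "j \<in> J" for j
      using broken_D(1)[OF u j] restr2[OF j] by (auto simp: Vh_sub_def Vh_bd_def)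
    then show "trace_on D u \<in> multi_trace \<Omega> k D"
      by (simp add: multi_trace_def trace_on_def)
  qed
  show "multi_trace \<Omega> k D \<subseteq> trace_on D ` broken_Vh \<Omega> k D"
  proof
    fix q assume q: "q \<in> multi_trace \<Omega> k D"
    then have "\<forall>j\<in>J. \<exists>w\<in>Vh \<Omega> k D. q j = restr (frontier (subdom D j)) w"
      by (auto simp: multi_trace_def Vh_bd_def)
    then obtain w where w: "\<And>j. j \<in> J \<Longrightarrow> w j \<in> Vh \<Omega> k D \<and> q j = restr (frontier (subdom D j)) (w j)"
      by (metis (no_types))
    define u where "u = (\<lambda>j. if j \<in> J then restr (closure (subdom D j)) (w j) else 0)"
    have "u \<in> broken_Vh \<Omega> k D" using w by (auto simp: u_def broken_Vh_def Vh_sub_def)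
    moreover have "trace_on D u = q"
    proof
      fix j show "trace_on D u j = q j"
        using w[of j] restr2[of j] q by (auto simp: trace_on_def u_def multi_trace_def)
    qed
    ultimately show "q \<in> trace_on D ` broken_Vh \<Omega> k D" by blast
  qed
qed

text \<open>
  The components of \<open>b\<close> agree with \<open>v\<close> on the skeleton, and two closed subdomains meet only there.  So they
  paste to a continuous function, which is polynomial on each cell because a cell lies in
  one closed subdomain.
\<close>

lemma gluing:
  assumes b: "b \<in> broken_Vh \<Omega> k D" and v: "v \<in> Vh \<Omega> k D"
    and tr: "trace_on D b = trace_on D (to_broken D v)"
  shows "b \<in> to_broken D ` Vh \<Omega> k D"
proof -
  have on_frontier: "b j x = v x" if "j \<in> J" "x \<in> frontier (subdom D j)" for j x
  proof -
    have "trace_on D b j x = trace_on D (to_broken D v) j x" using tr by simp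
    then show ?thesis
      using that subdom(5)[OF that(1)] by (auto simp: trace_on_def to_broken_def restr_def)
  qed
  define sel where "sel = (\<lambda>x. SOME j. j \<in> J \<and> x \<in> closure (subdom D j))"
  define w where "w = (\<lambda>x. if x \<in> closure \<Omega> then b (sel x) x else 0)"
  have w: "w x = b j x" if j: "j \<in> J" and x: "x \<in> closure (subdom D j)" for j x
  proof -
    have sel: "sel x \<in> J" "x \<in> closure (subdom D (sel x))"
      using someI[of "\<lambda>j. j \<in> J \<and> x \<in> closure (subdom D j)" j] j x by (auto simp: sel_def)
    have "b (sel x) x = b j x"
    proof (cases "sel x = j")
      case False
      then show ?thesis
        using on_frontier[OF sel(1) closures_meet_on_frontiers[OF sel(1) j False sel(2) x]]
          on_frontier[OF j closures_meet_on_frontiers[OF j sel(1) _ x sel(2)]] by simp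
    qed simp
    then show ?thesis using x subdom(4)[OF j] by (auto simp: w_def)
  qed
  have "w \<in> Vh \<Omega> k D"
    unfolding Vh_def
  proof (intro CollectI conjI ballI allI impI)
    show "continuous_on (closure \<Omega>) w"
      unfolding closure_\<Omega>_cover[symmetric]
    proof (rule continuous_on_closed_Union)
      show "continuous_on (closure (subdom D j)) w" if j: "j \<in> J" for j
        using Vh_sub_props(4)[OF j broken_D(1)[OF b j]] w[OF j] by (simp cong: continuous_on_cong)
    qed auto
    show "\<exists>p. poly_of_degree_le k p \<and> (\<forall>x\<in>\<tau>. w x = p x)" if \<tau>: "\<tau> \<in> cells D" for \<tau>
    proof -
      obtain j where j: "j \<in> J" "\<tau> \<subseteq> closure (subdom D j)" using cell_in_subdomain[OF \<tau>] by blast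
      obtain z where z: "z \<in> Vh \<Omega> k D" "b j = restr (closure (subdom D j)) z"
        using broken_D(1)[OF b j(1)] by (auto simp: Vh_sub_def)
      obtain p where p: "poly_of_degree_le k p" "\<forall>x\<in>\<tau>. z x = p x" using Vh_D(2)[OF z(1) \<tau>] by blast
      have "w x = p x" if "x \<in> \<tau>" for x
        using w[OF j(1), of x] z(2) p(2) that j(2) by (auto simp: restr_def)
      then show ?thesis using p(1) by blast
    qed
    show "w x = 0" if "x \<notin> closure \<Omega>" for x using that by (simp add: w_def)
  qed
  moreover have "b = to_broken D w"
  proof (intro ext)
    fix j x
    show "b j x = to_broken D w j x"
    proof (cases "j \<in> J \<and> x \<in> closure (subdom D j)")
      case True
      then show ?thesis using w[of j x] by (simp add: to_broken_def restr_def)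
    next
      case False
      then show ?thesis
        using broken_D(2)[OF b, of j] Vh_sub_props(5)[OF _ broken_D(1)[OF b], of j x]
        by (cases "j \<in> J") (auto simp: to_broken_def restr_def)
    qed
  qed
  ultimately show ?thesis by blast
qed

text \<open>
  The generators are the monomials cut off to one cell in one subdomain.  Cells overlap on
  their faces, so each point is first assigned to a single cell by the choice function \<open>sel\<close>; the generators
  are then discontinuous and lie outside the space, which does no harm.
\<close>

lemma finite_dimensional: "\<exists>G. finite G \<and> broken_Vh \<Omega> k D \<subseteq> cm.span G"
proof -
  define sel where "sel = (\<lambda>x. SOME \<tau>. \<tau> \<in> cells D \<and> x \<in> \<tau>)"
  define A where "A = {\<alpha> :: 'n \<Rightarrow> nat. sum \<alpha> UNIV \<le> k}"
  define mono where "mono = (\<lambda>(\<alpha> :: 'n \<Rightarrow> nat) x. \<Prod>i\<in>UNIV. complex_of_real (x $ i :: real) ^ \<alpha> i)"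
  define gen where "gen = (\<lambda>(j, \<tau>, \<alpha>) i x. if i = j \<and> x \<in> closure (subdom D j) \<and> sel x = \<tau> then mono \<alpha> x else 0)"
  define I where "I = J \<times> cells D \<times> A"
  have fin: "finite I" "finite A"
    unfolding I_def A_def using cells(1) finite_multiindices by auto
  have sum_apply: "sum F X i x = (\<Sum>y\<in>X. F y i x)" for F :: "'z \<Rightarrow> nat \<Rightarrow> real^'n \<Rightarrow> complex" and X i x
    by (induction X rule: infinite_finite_induct) auto
  have "u \<in> cm.span (gen ` I)" if u: "u \<in> broken_Vh \<Omega> k D" for u
  proof -
    have "\<exists>c. \<forall>x\<in>\<tau> \<inter> closure (subdom D j). u j x = (\<Sum>\<alpha>\<in>A. c \<alpha> * mono \<alpha> x)"
      if j: "j \<in> J" and \<tau>: "\<tau> \<in> cells D" for j \<tau>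
    proof -
      obtain z where z: "z \<in> Vh \<Omega> k D" "u j = restr (closure (subdom D j)) z"
        using broken_D(1)[OF u j] by (auto simp: Vh_sub_def)
      obtain p where p: "poly_of_degree_le k p" "\<forall>x\<in>\<tau>. z x = p x" using Vh_D(2)[OF z(1) \<tau>] by blast
      then obtain c where "p = (\<lambda>x. \<Sum>\<alpha>\<in>A. c \<alpha> * mono \<alpha> x)"
        unfolding poly_of_degree_le_def A_def mono_def by blast
      then show ?thesis using z(2) p(2) by (intro exI[of _ c]) (auto simp: restr_def)
    qed
    then obtain c where c: "\<And>j \<tau> x. j \<in> J \<Longrightarrow> \<tau> \<in> cells D \<Longrightarrow> x \<in> \<tau> \<Longrightarrow> x \<in> closure (subdom D j) \<Longrightarrow>
        u j x = (\<Sum>\<alpha>\<in>A. c j \<tau> \<alpha> * mono \<alpha> x)"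
      by (metis (no_types) IntI)
    have "u i x = (\<Sum>y\<in>I. cmul (case y of (j, \<tau>, \<alpha>) \<Rightarrow> c j \<tau> \<alpha>) (gen y)) i x" for i x
    proof -
      have "(\<Sum>y\<in>I. cmul (case y of (j, \<tau>, \<alpha>) \<Rightarrow> c j \<tau> \<alpha>) (gen y)) i x
          = (\<Sum>j\<in>J. \<Sum>\<tau>\<in>cells D. \<Sum>\<alpha>\<in>A. c j \<tau> \<alpha> * gen (j, \<tau>, \<alpha>) i x)"
        unfolding sum_apply I_def by (simp add: sum.cartesian_product cmul_def case_prod_beta)
      also have "\<dots> = (\<Sum>j\<in>J. if j = i then \<Sum>\<tau>\<in>cells D. if \<tau> = sel x then
            if x \<in> closure (subdom D j) then \<Sum>\<alpha>\<in>A. c j \<tau> \<alpha> * mono \<alpha> x else 0 else 0 else 0)"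
        by (intro sum.cong refl) (auto simp: gen_def intro!: sum.cong sum.neutral)
      also have "\<dots> = (if i \<in> J then if sel x \<in> cells D then if x \<in> closure (subdom D i) then
            \<Sum>\<alpha>\<in>A. c i (sel x) \<alpha> * mono \<alpha> x else 0 else 0 else 0)"
        using cells(1) by (simp add: sum.delta)
      also have "\<dots> = u i x"
      proof (cases "i \<in> J \<and> x \<in> closure (subdom D i)")
        case True
        then have "x \<in> \<Union>(cells D)" using subdom(4) cells(3) by auto
        then have "sel x \<in> cells D" "x \<in> sel x"
          using someI_ex[of "\<lambda>\<tau>. \<tau> \<in> cells D \<and> x \<in> \<tau>"] by (auto simp: sel_def)
        then show ?thesis using True c[of i "sel x" x] by simp
      next
        case False
        then show ?thesis
          using broken_D(2)[OF u, of i] Vh_sub_props(5)[OF _ broken_D(1)[OF u], of i x]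
          by (cases "i \<in> J") auto
      qed
      finally show ?thesis by simp
    qed
    then have "u = (\<Sum>y\<in>I. cmul (case y of (j, \<tau>, \<alpha>) \<Rightarrow> c j \<tau> \<alpha>) (gen y))" by (intro ext)
    also have "\<dots> \<in> cm.span (gen ` I)"
      by (intro cm.span_sum cm.span_scale cm.span_base imageI)
    finally show ?thesis .
  qed
  then show ?thesis using fin(1) by (intro exI[of _ "gen ` I"]) auto
qed

end

section \<open>The discrete Helmholtz problem\<close>

locale fe_helmholtz = fe_mesh \<Omega> k D h
  for \<Omega> :: "(real^'n) set" and k D h +
  fixes \<kappa> :: "real^'n \<Rightarrow> complex" and \<mu> :: "real^'n \<Rightarrow> real"
  assumes adm: "admissible_coefficients \<Omega> \<kappa> \<mu>"
begin

abbreviation "B \<equiv> broken_Vh \<Omega> k D"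
abbreviation "M \<equiv> multi_trace \<Omega> k D"
abbreviation "K \<equiv> kappa_inf \<Omega> \<kappa>"
abbreviation "a \<equiv> form_a \<Omega> \<kappa> \<mu> D"
abbreviation "bnorm \<equiv> broken_h1_norm K D"

lemma K_pos: "0 < K"
  by (simp add: kappa_inf_def)

lemma coefficients: "j \<in> J \<Longrightarrow> coefficients_on \<Omega> (subdom D j) \<kappa> \<mu>"
  using adm \<Omega>_topology(1) subdom(1-3)[of j] by unfold_locales auto

lemma surface: "surface_coefficient (frontier (subdom D j) \<inter> frontier \<Omega>) (frontier \<Omega>) \<kappa>"
  using adm surface_measure_frontier_finite[OF poly\<Omega>]
  by unfold_locales (auto simp: admissible_coefficients_def)

lemma broken_pw_smooth: "u \<in> B \<Longrightarrow> j \<in> J \<Longrightarrow> pw_smooth (subdom D j) (u j)"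
  using Vh_sub_props(1) broken_D(1) by blast

lemma broken_surface:
  assumes "u \<in> B" "j \<in> J"
  shows "u j \<in> borel_measurable borel" "bounded (u j ` A)"
  using Vh_sub_props(2,3)[OF assms(2) broken_D(1)[OF assms]] by (auto intro: bounded_subset)

lemma form_a_add:
  assumes "u \<in> B" "v \<in> B" "w \<in> B"
  shows "a (u + v) w = a u w + a v w" "a w (u + v) = a w u + a w v"
  unfolding form_a_eq sum.distrib[symmetric] plus_fun_def
  by (intro sum.cong refl,
      simp add: coefficients_on.volume_form_add[OF coefficients] surface_coefficient.surface_form_add[OF surface]
        broken_pw_smooth broken_surface assms algebra_simps)+

lemma form_a_mult:
  assumes "u \<in> B" "w \<in> B"
  shows "a (cmul c u) w = c * a u w" "a w (cmul c u) = cnj c * a w u"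
  unfolding form_a_eq sum_distrib_left cmul_def
  by (intro sum.cong refl,
      simp add: coefficients_on.volume_form_mult_const[OF coefficients] surface_coefficient.surface_form_mult_const[OF surface]
        broken_pw_smooth assms algebra_simps)+

lemma form_a_dissipative:
  assumes u: "u \<in> B"
  shows "Im (a u u) \<le> 0"
proof -
  have "Im (volume_form (subdom D j) \<kappa> \<mu> (u j) (u j)
      - \<i> * surface_form (frontier (subdom D j) \<inter> frontier \<Omega>) \<kappa> (u j) (u j)) \<le> 0" if j: "j \<in> J" for j
    using coefficients_on.Im_volume_form_le[OF coefficients[OF j] broken_pw_smooth[OF u j]]
      surface_coefficient.Re_surface_form_nonneg[OF surface[of j] broken_surface[OF u j]] by simp
  then show ?thesis unfolding form_a_eq Im_sum by (rule sum_nonpos)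
qed

lemma form_a_zero: "v \<in> B \<Longrightarrow> a 0 v = 0" "v \<in> B \<Longrightarrow> a v 0 = 0"
  using form_a_mult[of v v 0] by (simp_all add: cmul_def zero_fun_def)

lemma bnorm_sq: "(bnorm u)\<^sup>2 = (\<Sum>j\<in>J. (h1_norm K (subdom D j) (u j))\<^sup>2)"
  by (simp add: broken_h1_norm_def sum_nonneg)

lemma bnorm_nonneg: "0 \<le> bnorm u"
  by (simp add: broken_h1_norm_def sum_nonneg)

lemma bnorm_zero [simp]: "bnorm 0 = 0"
proof -
  have "grad 0 x = 0" for x :: "real^'n"
    by (simp add: grad_def zero_fun_def vec_eq_iff)
  then show ?thesis by (simp add: broken_h1_norm_def h1_norm_def)
qed

lemma bnorm_add:
  assumes "u \<in> B" "v \<in> B"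
  shows "bnorm (u + v) \<le> 2 * (bnorm u + bnorm v)"
proof (rule power2_le_imp_le)
  have "(bnorm (u + v))\<^sup>2
      \<le> (\<Sum>j\<in>J. 2 * (h1_norm K (subdom D j) (u j))\<^sup>2 + 2 * (h1_norm K (subdom D j) (v j))\<^sup>2)"
    unfolding bnorm_sq plus_fun_def
    using assms by (intro sum_mono h1_norm_add_sq subdom(1,2) broken_pw_smooth)
  also have "\<dots> = 2 * (bnorm u)\<^sup>2 + 2 * (bnorm v)\<^sup>2"
    by (simp add: bnorm_sq sum.distrib sum_distrib_left)
  also have "\<dots> \<le> (2 * (bnorm u + bnorm v))\<^sup>2"
    using mult_nonneg_nonneg[OF bnorm_nonneg bnorm_nonneg, of u v]
    by (simp add: power2_eq_square algebra_simps)
  finally show "(bnorm (u + v))\<^sup>2 \<le> (2 * (bnorm u + bnorm v))\<^sup>2" .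
qed (simp add: bnorm_nonneg)

text \<open>
  Quotients by the norm appear in the continuity modulus; as \<open>x / 0 = 0\<close>, they carry information
  only when the norm is positive on nonzero functions.
\<close>

lemma bnorm_pos:
  assumes u: "u \<in> B" "u \<noteq> 0"
  shows "0 < bnorm u"
proof (rule ccontr)
  assume "\<not> 0 < bnorm u"
  then have "(bnorm u)\<^sup>2 = 0"
    using bnorm_nonneg[of u] by simp
  then have "\<forall>j\<in>J. (h1_norm K (subdom D j) (u j))\<^sup>2 = 0"
    unfolding bnorm_sq by (subst (asm) sum_nonneg_eq_0_iff) auto
  then have z: "h1_norm K (subdom D j) (u j) = 0" if "j \<in> J" for j
    using that by simp
  have "u j x = 0" for j x
  proof (cases "j \<in> J \<and> x \<in> closure (subdom D j)")
    case True
    then have j: "j \<in> J" by blast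
    have "u j y = 0" if "y \<in> subdom D j" for y
      by (rule h1_norm_definite[OF subdom(1,2)[OF j] broken_pw_smooth[OF u(1) j] K_pos z[OF j] that])
    then show ?thesis
      using continuous_constant_on_closure[OF Vh_sub_props(4)[OF j broken_D(1)[OF u(1) j]]] True by blast
  next
    case False
    then show ?thesis
      using broken_D(2)[OF u(1), of j] Vh_sub_props(5)[OF _ broken_D(1)[OF u(1)], of j x]
      by (cases "j \<in> J") auto
  qed
  then have "u = 0" by (auto simp: fun_eq_iff)
  then show False using u(2) by blast
qed

lemma bnorm_to_broken_le:
  assumes v: "v \<in> Vh \<Omega> k D"
  shows "bnorm (to_broken D v) \<le> h1_norm K \<Omega> v"
proof (rule power2_le_imp_le)
  show "(bnorm (to_broken D v))\<^sup>2 \<le> (h1_norm K \<Omega> v)\<^sup>2"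
    unfolding bnorm_sq
  proof (rule sum_h1_norm_sq_le[OF \<Omega>_topology(1,2) Vh_pw_smooth[OF v]])
    show "to_broken D v j x = v x" if "j \<in> J" "x \<in> subdom D j" for j x
      using that closure_subset by (auto simp: to_broken_def restr_def)
  qed (use subdom(1,3) subdom_disjoint in auto)
qed (rule h1_norm_nonneg)

lemma form_a_bounded:
  assumes C: "cont_modulus \<Omega> \<kappa> \<mu> k D \<le> ereal C" and u: "u \<in> B" and v: "v \<in> B"
  shows "cmod (a u v) \<le> C * bnorm u * bnorm v"
proof (cases "u = 0 \<or> v = 0")
  case True
  then show ?thesis using form_a_zero u v by auto
next
  case False
  then have pos: "0 < bnorm u" "0 < bnorm v" using bnorm_pos u v by auto
  have "ereal (cmod (a u v) / (bnorm u * bnorm v)) \<le> cont_modulus \<Omega> \<kappa> \<mu> k D"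
    unfolding cont_modulus_def
  proof (rule SUP_upper2[of u])
    show "ereal (cmod (a u v) / (bnorm u * bnorm v))
        \<le> (SUP v\<in>B - {0}. ereal (cmod (a u v) / (bnorm u * bnorm v)))"
      by (rule SUP_upper) (use v False in auto)
  qed (use u False in auto)
  then have "cmod (a u v) / (bnorm u * bnorm v) \<le> C" using C by (metis ereal_less_eq(3) order_trans)
  then show ?thesis using pos by (simp add: divide_le_eq mult.assoc)
qed

lemma infsup_witness:
  assumes "ereal \<alpha> < infsup_alpha \<Omega> \<kappa> \<mu> k D" "u \<in> Vh \<Omega> k D" "u \<noteq> 0"
  shows "\<exists>v\<in>Vh \<Omega> k D. \<alpha> < cmod (a (to_broken D u) (to_broken D v)) / (h1_norm K \<Omega> u * h1_norm K \<Omega> v)"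
proof -
  have "ereal \<alpha> < (SUP v\<in>Vh \<Omega> k D - {0}.
      ereal (cmod (a (to_broken D u) (to_broken D v)) / (h1_norm K \<Omega> u * h1_norm K \<Omega> v)))"
    using assms(1) unfolding infsup_alpha_def
    by (rule less_le_trans) (use assms(2,3) in \<open>auto intro: INF_lower\<close>)
  then show ?thesis by (auto simp: less_SUP_iff)
qed

lemma form_a_injective:
  assumes "0 < infsup_alpha \<Omega> \<kappa> \<mu> k D" "u \<in> to_broken D ` Vh \<Omega> k D"
    and zero: "\<And>v. v \<in> to_broken D ` Vh \<Omega> k D \<Longrightarrow> a u v = 0"
  shows "u = 0"
proof (rule ccontr)
  assume "u \<noteq> 0"
  obtain w where w: "w \<in> Vh \<Omega> k D" "u = to_broken D w" using assms(2) by blast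
  then have "w \<noteq> 0" using \<open>u \<noteq> 0\<close> to_broken_zero by (auto simp: zero_fun_def)
  then obtain v where "v \<in> Vh \<Omega> k D" "0 < cmod (a u (to_broken D v)) / (h1_norm K \<Omega> w * h1_norm K \<Omega> v)"
    using infsup_witness[of 0 w] assms(1) w by (auto simp: zero_ereal_def)
  then show False using zero by auto
qed

text \<open>
  Dual form of the inf-sup condition, without suprema: a bound for the functional \<open>a u\<close> on
  conforming test functions bounds \<open>u\<close>.
\<close>

lemma infsup_bound:
  assumes \<alpha>: "0 < \<alpha>" "ereal \<alpha> < infsup_alpha \<Omega> \<kappa> \<mu> k D" and u: "u \<in> to_broken D ` Vh \<Omega> k D" and C: "0 \<le> C"
    and bound: "\<And>v. v \<in> to_broken D ` Vh \<Omega> k D \<Longrightarrow> cmod (a u v) \<le> C * bnorm v"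
  shows "\<alpha> * bnorm u \<le> C"
proof -
  obtain w where w: "w \<in> Vh \<Omega> k D" "u = to_broken D w" using u by blast
  show ?thesis
  proof (cases "w = 0")
    case True
    then have "u = 0" using w to_broken_zero by (simp add: zero_fun_def)
    then show ?thesis using C by simp
  next
    case False
    then obtain v where v: "v \<in> Vh \<Omega> k D"
      "\<alpha> < cmod (a u (to_broken D v)) / (h1_norm K \<Omega> w * h1_norm K \<Omega> v)"
      using infsup_witness[OF \<alpha>(2) w(1)] w(2) by blast
    have "h1_norm K \<Omega> w \<noteq> 0" "h1_norm K \<Omega> v \<noteq> 0" using v(2) \<alpha>(1) by auto
    then have pos: "0 < h1_norm K \<Omega> w" "0 < h1_norm K \<Omega> v"
      using h1_norm_nonneg[of K \<Omega>] by (auto simp: less_le)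
    have "\<alpha> * h1_norm K \<Omega> w * h1_norm K \<Omega> v < cmod (a u (to_broken D v))"
      using v(2) pos by (simp add: less_divide_eq mult.assoc)
    also have "\<dots> \<le> C * bnorm (to_broken D v)" using v(1) by (intro bound) blast
    also have "\<dots> \<le> C * h1_norm K \<Omega> v"
      using bnorm_to_broken_le[OF v(1)] C by (rule mult_left_mono)
    finally have "\<alpha> * h1_norm K \<Omega> w \<le> C" using pos by simp
    moreover have "\<alpha> * bnorm u \<le> \<alpha> * h1_norm K \<Omega> w"
      using bnorm_to_broken_le[OF w(1)] \<alpha>(1) w(2) by simp
    ultimately show ?thesis by linarith
  qed
qed

subsection \<open>The minimal extension norm\<close>

abbreviation "liftings q j \<equiv> {v \<in> Vh_sub \<Omega> k D j. restr (frontier (subdom D j)) v = q j}"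

lemma INF_lifting_nonneg: "liftings q j \<noteq> {} \<Longrightarrow> 0 \<le> (INF v\<in>liftings q j. (h1_norm K (subdom D j) v)\<^sup>2)"
  by (intro cINF_greatest) auto

lemma rho_trace_le:
  assumes u: "u \<in> B"
  shows "rho_norm \<Omega> \<kappa> k D (trace_on D u) \<le> bnorm u"
proof -
  have "(INF v\<in>liftings (trace_on D u) j. (h1_norm K (subdom D j) v)\<^sup>2) \<le> (h1_norm K (subdom D j) (u j))\<^sup>2"
    if j: "j \<in> J" for j
    using broken_D(1)[OF u j] j
    by (intro cINF_lower bdd_belowI[of _ 0]) (auto simp: trace_on_def)
  then show ?thesis
    unfolding rho_norm_def broken_h1_norm_def by (intro real_sqrt_le_mono sum_mono)
qed

text \<open>
  The factor 2 leaves room to take an almost minimal lifting on each subdomain instead of showing that the minimum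
  is attained.
\<close>

lemma lifting_exists:
  assumes q: "q \<in> M" and pos: "0 < rho_norm \<Omega> \<kappa> k D q"
  shows "\<exists>v\<in>B. trace_on D v = q \<and> bnorm v \<le> 2 * rho_norm \<Omega> \<kappa> k D q"
proof -
  let ?I = "\<lambda>j. INF v\<in>liftings q j. (h1_norm K (subdom D j) v)\<^sup>2"
  let ?\<rho> = "rho_norm \<Omega> \<kappa> k D q"
  have "q \<in> trace_on D ` B" unfolding trace_image by (rule q)
  then obtain w where w: "w \<in> B" "trace_on D w = q" by blast
  have ne: "liftings q j \<noteq> {}" if j: "j \<in> J" for j
  proof -
    have "w j \<in> liftings q j"
      using broken_D(1)[OF w(1) j] j unfolding w(2)[symmetric] by (simp add: trace_on_def)
    then show ?thesis by blast
  qed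
  have \<rho>: "?\<rho>\<^sup>2 = (\<Sum>j\<in>J. ?I j)"
    unfolding rho_norm_def using ne by (intro real_sqrt_pow2 sum_nonneg INF_lifting_nonneg) auto
  \<comment> \<open>summed over the subdomains, the errors stay below \<open>3 \<rho>\<^sup>2 = (2 \<rho>)\<^sup>2 - \<rho>\<^sup>2\<close>\<close>
  define \<epsilon> where "\<epsilon> = 3 * ?\<rho>\<^sup>2 / (real (num_sub D) + 1)"
  have \<epsilon>: "0 < \<epsilon>" using pos by (simp add: \<epsilon>_def)
  have "\<exists>v\<in>liftings q j. (h1_norm K (subdom D j) v)\<^sup>2 < ?I j + \<epsilon>" if j: "j \<in> J" for j
  proof -
    have "\<exists>y\<in>(\<lambda>v. (h1_norm K (subdom D j) v)\<^sup>2) ` liftings q j. y < ?I j + \<epsilon>"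
      using ne[OF j] \<epsilon> by (intro cInf_lessD) auto
    then show ?thesis by blast
  qed
  then have "\<forall>j\<in>J. \<exists>v. v \<in> liftings q j \<and> (h1_norm K (subdom D j) v)\<^sup>2 < ?I j + \<epsilon>" by blast
  from bchoice[OF this] obtain z
    where z: "\<forall>j\<in>J. z j \<in> liftings q j \<and> (h1_norm K (subdom D j) (z j))\<^sup>2 < ?I j + \<epsilon>" ..
  define v where "v = (\<lambda>j. if j \<in> J then z j else 0)"
  have v: "v \<in> B" using z by (auto simp: v_def broken_Vh_def)
  have "trace_on D v = q"
    using z q by (auto simp: v_def trace_on_def multi_trace_def fun_eq_iff)
  moreover have "bnorm v \<le> 2 * ?\<rho>"
  proof (rule power2_le_imp_le)
    have "(bnorm v)\<^sup>2 \<le> (\<Sum>j\<in>J. ?I j + \<epsilon>)"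
      unfolding bnorm_sq using z by (intro sum_mono) (auto simp: v_def intro: less_imp_le)
    also have "\<dots> = ?\<rho>\<^sup>2 + real (num_sub D) * \<epsilon>" by (simp add: sum.distrib \<rho>)
    also have "\<dots> \<le> ?\<rho>\<^sup>2 + 3 * ?\<rho>\<^sup>2"
      by (simp add: \<epsilon>_def divide_le_eq algebra_simps)
    finally show "(bnorm v)\<^sup>2 \<le> (2 * ?\<rho>)\<^sup>2" by (simp add: power_mult_distrib)
  qed (use pos in simp)
  ultimately show ?thesis using v by blast
qed

end

section \<open>The skeleton equation\<close>

locale fe_skeleton = fe_helmholtz \<Omega> k D h \<kappa> \<mu>
  for \<Omega> :: "(real^'n) set" and k D h \<kappa> \<mu> +
  fixes t :: "(nat \<Rightarrow> real^'n \<Rightarrow> complex) \<Rightarrow> (nat \<Rightarrow> real^'n \<Rightarrow> complex) \<Rightarrow> complex"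
    and Pih :: "(nat \<Rightarrow> real^'n \<Rightarrow> complex) \<Rightarrow> (nat \<Rightarrow> real^'n \<Rightarrow> complex)"
  assumes alpha: "0 < infsup_alpha \<Omega> \<kappa> \<mu> k D"
    and t: "is_scalar_product (multi_trace \<Omega> k D) t"
    and Pih: "exchange_operator \<Omega> k D t Pih"
begin

sublocale ic: impedance_coupling "cmul :: complex \<Rightarrow> (nat \<Rightarrow> real^'n \<Rightarrow> complex) \<Rightarrow> nat \<Rightarrow> real^'n \<Rightarrow> complex"
  B M "to_broken D ` Vh \<Omega> k D" "single_trace \<Omega> k D" "trace_on D" a t Pih
proof (unfold_locales, goal_cases)
  case 1 show ?case by (rule subspace_broken)
next
  case 2 show ?case by (rule subspace_conforming)
next
  case 3 show ?case by (rule finite_dimensional)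
next
  case 4 show ?case by (rule trace_add)
next
  case 5 show ?case by (rule trace_mult)
next
  case 6 show ?case by (rule trace_image)
next
  case 7 show ?case by (simp add: single_trace_def image_image)
next
  case 8 show ?case by (auto intro: to_broken_mem)
next
  case (9 b)
  from 9(2) obtain v where "v \<in> Vh \<Omega> k D" "trace_on D b = trace_on D (to_broken D v)"
    unfolding single_trace_def by (rule imageE)
  then show ?case by (rule gluing[OF 9(1)])
next
  case 10 then show ?case by (rule form_a_add(1))
next
  case 11 then show ?case by (rule form_a_mult(1))
next
  case (12 u v w) then show ?case by (intro form_a_add(2))
next
  case 13 then show ?case by (intro form_a_mult(2))
next
  case 14 then show ?case by (rule form_a_dissipative)
next
  case (15 u) then show ?case by (intro form_a_injective[OF alpha])
next
  case 16 then show ?case using t unfolding is_scalar_product_def by metis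
next
  case 17 then show ?case using t unfolding is_scalar_product_def by metis
next
  case 18 then show ?case using t unfolding is_scalar_product_def by metis
next
  case 19 then show ?case using t unfolding is_scalar_product_def by metis
next
  case 20 then show ?case using Pih unfolding exchange_operator_def by blast
next
  case 21 then show ?case
    using Pih unfolding exchange_operator_def orthogonal_projector_def by blast
next
  case 22 then show ?case
    using Pih unfolding exchange_operator_def orthogonal_projector_def by blast
qed

lemma t_norm_eq: "t_norm t = ic.tnorm"
  by (simp add: t_norm_def ic.tnorm_def fun_eq_iff)

lemma solves_local_eq: "solves_local \<Omega> \<kappa> \<mu> k D t L = ic.solves L"
  by (simp add: solves_local_def ic.solves_def fun_eq_iff)

lemma local_solution_eq: "local_solution \<Omega> \<kappa> \<mu> k D t L = ic.sol L"
  by (simp add: local_solution_def ic.sol_def solves_local_eq)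

lemma scattering_eq: "scattering \<Omega> \<kappa> \<mu> k D t = ic.scatter"
  by (simp add: scattering_def ic.scatter_def local_solution_eq fun_eq_iff)

lemma gamma_h_eq: "gamma_h \<Omega> \<kappa> \<mu> k D t Pih = (INF w\<in>M - {0}. ereal (ic.tnorm (ic.skel w) / ic.tnorm w))"
  by (simp add: gamma_h_def t_norm_eq scattering_eq ic.skel_def)

text \<open>
  That the minimal extension norm is positive comes for free: the quotient exceeds \<open>c > 0\<close>, and a quotient
  with denominator 0 would be 0.
\<close>

lemma lambda_minus_bound:
  assumes c: "0 < c" "ereal c < lambda_minus \<Omega> \<kappa> k D t" and q: "q \<in> M" "q \<noteq> 0"
  shows "0 < rho_norm \<Omega> \<kappa> k D q" "c * rho_norm \<Omega> \<kappa> k D q \<le> ic.tnorm q"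
proof -
  have "ereal c < ereal (ic.tnorm q / rho_norm \<Omega> \<kappa> k D q)"
    using c(2) by (rule less_le_trans) (use q in \<open>auto simp: lambda_minus_def t_norm_eq intro: INF_lower\<close>)
  then have lt: "c < ic.tnorm q / rho_norm \<Omega> \<kappa> k D q" by simp
  then have "0 < ic.tnorm q / rho_norm \<Omega> \<kappa> k D q" using c(1) by linarith
  then show pos: "0 < rho_norm \<Omega> \<kappa> k D q" using ic.tnorm_pos[OF q] by (simp add: zero_less_divide_iff)
  then show "c * rho_norm \<Omega> \<kappa> k D q \<le> ic.tnorm q" using lt by (simp add: less_divide_eq)
qed

lemma lambda_plus_bound:
  assumes C: "lambda_plus \<Omega> \<kappa> k D t \<le> ereal C" and q: "q \<in> M" "q \<noteq> 0" and pos: "0 < rho_norm \<Omega> \<kappa> k D q"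
  shows "ic.tnorm q \<le> C * rho_norm \<Omega> \<kappa> k D q"
proof -
  have "ereal (ic.tnorm q / rho_norm \<Omega> \<kappa> k D q) \<le> lambda_plus \<Omega> \<kappa> k D t"
    unfolding lambda_plus_def t_norm_eq using q by (intro SUP_upper) auto
  then have "ereal (ic.tnorm q / rho_norm \<Omega> \<kappa> k D q) \<le> ereal C" using C by (rule order_trans)
  then show ?thesis using pos by (simp add: divide_le_eq)
qed

text \<open>
  The constant \<open>c / 2\<close> in place of \<open>c\<close> pays for liftings that are minimal only up to the factor 2.
\<close>

lemma skel_bounded_below:
  assumes \<alpha>: "0 < \<alpha>" "ereal \<alpha> < infsup_alpha \<Omega> \<kappa> \<mu> k D"
    and c: "0 < c" "ereal c < lambda_minus \<Omega> \<kappa> k D t"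
    and C: "0 \<le> C" "lambda_plus \<Omega> \<kappa> k D t \<le> ereal C"
    and Ca: "0 \<le> Ca" "cont_modulus \<Omega> \<kappa> \<mu> k D \<le> ereal Ca"
    and p: "p \<in> M"
  shows "ic.tnorm p \<le> (Ca / (c / 2) + C) * ((C + Ca / (c / 2)) / \<alpha> + 1 / (c / 2)) * ic.tnorm (ic.skel p)"
proof (rule ic.skel_lower_bound[where nb = bnorm])
  show "\<exists>v\<in>B. trace_on D v = q \<and> c / 2 * bnorm v \<le> ic.tnorm q" if q: "q \<in> M" for q
  proof (cases "q = 0")
    case True
    then show ?thesis
      using cm.subspace_0[OF subspace_broken] ic.tr_zero
      by (intro bexI[of _ 0]) auto
  next
    case False
    note \<rho> = lambda_minus_bound[OF c q False]
    obtain v where v: "v \<in> B" "trace_on D v = q" "bnorm v \<le> 2 * rho_norm \<Omega> \<kappa> k D q"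
      using lifting_exists[OF q \<rho>(1)] by blast
    have "c / 2 * bnorm v \<le> c / 2 * (2 * rho_norm \<Omega> \<kappa> k D q)"
      using v(3) c(1) by (intro mult_left_mono) auto
    then show ?thesis using v \<rho>(2) by (intro bexI[of _ v]) auto
  qed
  show "ic.tnorm (trace_on D v) \<le> C * bnorm v" if v: "v \<in> B" for v
  proof (cases "trace_on D v = 0")
    case True
    then show ?thesis using C(1) bnorm_nonneg by simp
  next
    case False
    have q: "trace_on D v \<in> M" using v by simp
    have "ic.tnorm (trace_on D v) \<le> C * rho_norm \<Omega> \<kappa> k D (trace_on D v)"
      using lambda_plus_bound[OF C(2) q False lambda_minus_bound(1)[OF c q False]] .
    also have "\<dots> \<le> C * bnorm v" using rho_trace_le[OF v] C(1) by (rule mult_left_mono)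
    finally show ?thesis .
  qed
  show "\<alpha> * bnorm u \<le> C'" if "u \<in> to_broken D ` Vh \<Omega> k D" "0 \<le> C'"
    "\<And>v. v \<in> to_broken D ` Vh \<Omega> k D \<Longrightarrow> cmod (a u v) \<le> C' * bnorm v" for u C'
    by (rule infsup_bound[OF \<alpha> that])
qed (use assms bnorm_nonneg bnorm_add form_a_bounded[OF Ca(2)] in auto)

lemma gamma_h_lower_bound:
  assumes "0 < \<alpha>" "ereal \<alpha> < infsup_alpha \<Omega> \<kappa> \<mu> k D"
    and "0 < c" "ereal c < lambda_minus \<Omega> \<kappa> k D t"
    and "0 < C" "lambda_plus \<Omega> \<kappa> k D t \<le> ereal C"
    and "0 \<le> Ca" "cont_modulus \<Omega> \<kappa> \<mu> k D \<le> ereal Ca"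
  shows "ereal (1 / ((Ca / (c / 2) + C) * ((C + Ca / (c / 2)) / \<alpha> + 1 / (c / 2)))) \<le> gamma_h \<Omega> \<kappa> \<mu> k D t Pih"
  unfolding gamma_h_eq
proof (rule INF_greatest)
  fix w assume w: "w \<in> M - {0}"
  let ?K = "(Ca / (c / 2) + C) * ((C + Ca / (c / 2)) / \<alpha> + 1 / (c / 2))"
  have le: "1 / b \<le> y / x" if "0 < b" "0 < x" "x \<le> b * y" for b x y :: real
    using that by (simp add: divide_simps mult.commute)
  have K: "0 < ?K" using assms(1,3,5,7) by (intro mult_pos_pos add_nonneg_pos add_pos_nonneg) auto
  have "ic.tnorm w \<le> ?K * ic.tnorm (ic.skel w)"
    by (rule skel_bounded_below) (use assms w in auto)
  then show "ereal (1 / ?K) \<le> ereal (ic.tnorm (ic.skel w) / ic.tnorm w)"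
    using le[OF K _] ic.tnorm_pos[of w] w by simp
qed

lemma gamma_h_bound:
  assumes "ereal \<gamma> < gamma_h \<Omega> \<kappa> \<mu> k D t Pih" "p \<in> M" "p \<noteq> 0"
  shows "\<gamma> * ic.tnorm p < ic.tnorm (ic.skel p)"
proof -
  have "ereal \<gamma> < ereal (ic.tnorm (ic.skel p) / ic.tnorm p)"
    using assms(1) by (rule less_le_trans) (use assms(2,3) in \<open>auto simp: gamma_h_eq intro: INF_lower\<close>)
  then show ?thesis using ic.tnorm_pos[OF assms(2,3)] by (simp add: less_divide_eq)
qed

text \<open>
  Solvability of the local problem with the source term alone is read off from the given iterates: \<open>u 0\<close>
  minus the local solution with data \<open>p 0\<close> solves it.
  The factor must be positive, not only nonnegative, since \<open>0 powr 0 = 0\<close> would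
  spoil \<open>n = 0\<close>; it is, because \<open>\<gamma> < 2\<close> strictly and \<open>r (1 - r) \<le> 1/4\<close>.
\<close>

lemma iteration_converges:
  assumes \<gamma>: "0 < \<gamma>" "ereal \<gamma> < gamma_h \<Omega> \<kappa> \<mu> k D t Pih" and r: "0 < r" "r < 1"
    and p: "\<And>n. p n \<in> M" and u: "\<And>n. u n \<in> B"
    and p0: "p 0 \<noteq> skeleton_solution \<Omega> \<kappa> \<mu> f g k D t Pih"
    and local_step: "\<And>n v. v \<in> B \<Longrightarrow>
       a (u n) v - \<i> * t (trace_on D (u n)) (trace_on D v) = t (p n) (trace_on D v) + form_l \<Omega> f g D v"
    and exchange_step: "\<And>n. p (Suc n) = cmul (complex_of_real (1 - r)) (p n)
         - cmul (complex_of_real r) (Pih (p n + cmul (2 * \<i>) (trace_on D (u n))))"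
  shows "t_norm t (p n - skeleton_solution \<Omega> \<kappa> \<mu> f g k D t Pih)
      / t_norm t (p 0 - skeleton_solution \<Omega> \<kappa> \<mu> f g k D t Pih)
    \<le> (1 - r * (1 - r) * \<gamma>\<^sup>2) powr (real n / 2)"
proof -
  define L where "L = form_l \<Omega> f g D"
  define us where "us = ic.sol L"
  define x where "x = skeleton_solution \<Omega> \<kappa> \<mu> f g k D t Pih"
  have un: "ic.solves (\<lambda>v. t (p n) (trace_on D v) + L v) (u n)" for n
    using local_step u by (simp add: ic.solves_def L_def)
  have "ic.solves L (u 0 - ic.local_sol (p 0))"
    using ic.solves_diff[OF un[of 0] ic.local_sol[OF p[of 0]]] by simp
  then have us: "ic.solves L us" unfolding us_def by (metis ic.sol_eq)
  have inj: "q = 0" if "q \<in> M" "ic.skel q = 0" for q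
  proof (rule ccontr)
    assume "q \<noteq> 0"
    then have "\<gamma> * ic.tnorm q < 0" "0 < ic.tnorm q"
      using gamma_h_bound[OF \<gamma>(2) that(1)] that(2) ic.tnorm_pos[OF that(1)] by auto
    then show False using \<gamma>(1) by (simp add: mult_less_0_iff)
  qed
  define rhs where "rhs = cmul (- 2 * \<i>) (Pih (trace_on D us))"
  have "rhs \<in> M"
    unfolding rhs_def using us
    by (intro cm.subspace_scale[OF ic.M] ic.Pi_into ic.tr_mem) (simp add: ic.solves_def)
  then have "\<exists>!q. q \<in> M \<and> ic.skel q = rhs"
    using inj by (intro ic.skel_bijective)
  moreover have "x = (THE q. q \<in> M \<and> ic.skel q = rhs)"
    by (simp add: x_def skeleton_solution_def skeleton_rhs_def scattering_eq local_solution_eq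
        ic.skel_def rhs_def us_def L_def)
  ultimately have "x \<in> M \<and> ic.skel x = rhs"
    using theI'[of "\<lambda>q. q \<in> M \<and> ic.skel q = rhs"] by simp
  then have x: "x \<in> M" "ic.skel x = rhs" by auto
  define e where "e = (\<lambda>n. p n - x)"
  have e0: "e 0 \<in> M" "e 0 \<noteq> 0" using p x p0 by (auto simp: e_def x_def)
  have step: "e (Suc n) = e n - cmul (of_real r) (ic.skel (e n))" for n
    unfolding e_def
    by (rule ic.relaxation_error_step[OF p x(1) us x(2)[unfolded rhs_def] un exchange_step])
  \<comment> \<open>\<open>Id + T\<close> has norm at most 2 since \<open>T\<close> is nonexpansive\<close>
  have "\<gamma> * ic.tnorm (e 0) < 2 * ic.tnorm (e 0)"
    using gamma_h_bound[OF \<gamma>(2) e0] ic.tnorm_skel_le[OF e0(1)] by linarith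
  then have "\<gamma> < 2" using ic.tnorm_pos[OF e0] by simp
  then have "\<gamma>\<^sup>2 < 2\<^sup>2" using \<gamma>(1) by (intro power_strict_mono) auto
  have "r * (1 - r) \<le> 1 / 4"
    using zero_le_power2[of "2 * r - 1"] by (simp add: power2_eq_square algebra_simps)
  then have "r * (1 - r) * \<gamma>\<^sup>2 \<le> 1 / 4 * \<gamma>\<^sup>2" by (intro mult_right_mono) auto
  then have factor_pos: "0 < 1 - r * (1 - r) * \<gamma>\<^sup>2"
    using \<open>\<gamma>\<^sup>2 < 2\<^sup>2\<close> by simp
  have \<gamma>_le: "\<gamma> * ic.tnorm q \<le> ic.tnorm (ic.skel q)" if "q \<in> M" for q
  proof (cases "q = 0")
    case False
    then show ?thesis using gamma_h_bound[OF \<gamma>(2) that] by simp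
  qed (use ic.skel_mem[OF that] in simp)
  let ?q = "1 - r * (1 - r) * \<gamma>\<^sup>2"
  have decay: "e n \<in> M" "(ic.tnorm (e n))\<^sup>2 \<le> ?q ^ n * (ic.tnorm (e 0))\<^sup>2"
    using ic.relaxation_decay[of r \<gamma> e n, OF _ _ _ \<gamma>_le _ e0(1) step] r \<gamma>(1) factor_pos by auto
  have "(?q powr (real n / 2))\<^sup>2 = ?q ^ n"
    using factor_pos by (simp add: power2_eq_square powr_realpow flip: powr_add)
  then have "(ic.tnorm (e n))\<^sup>2 \<le> (?q powr (real n / 2) * ic.tnorm (e 0))\<^sup>2"
    using decay(2) by (simp add: power_mult_distrib)
  then have "ic.tnorm (e n) \<le> ?q powr (real n / 2) * ic.tnorm (e 0)"
    by (rule power2_le_imp_le) (use e0(1) in auto)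
  then show ?thesis
    using ic.tnorm_pos[OF e0] by (simp add: t_norm_eq divide_le_eq e_def flip: x_def)
qed

end

section \<open>Convergence uniformly in the mesh width\<close>

theorem corollary10p7:
  fixes \<Omega> :: "(real^'n) set" and \<kappa> :: "real^'n \<Rightarrow> complex" and \<mu> :: "real^'n \<Rightarrow> real"
    and f g :: "real^'n \<Rightarrow> complex" and k :: nat
    and H :: "real set" and D :: "real \<Rightarrow> (real^'n) decomposition"
    and t :: "real \<Rightarrow> (nat \<Rightarrow> real^'n \<Rightarrow> complex) \<Rightarrow> (nat \<Rightarrow> real^'n \<Rightarrow> complex) \<Rightarrow> complex"
    and Pih :: "real \<Rightarrow> (nat \<Rightarrow> real^'n \<Rightarrow> complex) \<Rightarrow> (nat \<Rightarrow> real^'n \<Rightarrow> complex)"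
    and r :: real
    and u p :: "real \<Rightarrow> nat \<Rightarrow> (nat \<Rightarrow> real^'n \<Rightarrow> complex)"
  assumes dim: "CARD('n) \<in> {1, 2, 3}"
    and dom: "polyhedral_domain \<Omega>"
    and coeff: "admissible_coefficients \<Omega> \<kappa> \<mu>"
    and f: "L2_on lebesgue \<Omega> f"
    and g: "L2_on surface_measure (frontier \<Omega>) g"
    and k: "k \<ge> 1"
    and H: "H \<subseteq> {0<..}" "0 islimpt H"
    and mesh: "\<And>h. h \<in> H \<Longrightarrow> mesh_decomposition \<Omega> h (D h)"
    and alpha: "\<And>h. h \<in> H \<Longrightarrow> infsup_alpha \<Omega> \<kappa> \<mu> k (D h) > 0"
    and alpha_uniform: "Liminf (at 0 within H) (\<lambda>h. infsup_alpha \<Omega> \<kappa> \<mu> k (D h)) > 0"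
    and a_uniform: "Limsup (at 0 within H) (\<lambda>h. cont_modulus \<Omega> \<kappa> \<mu> k (D h)) < \<infinity>"
    and t: "\<And>h. h \<in> H \<Longrightarrow> is_scalar_product (multi_trace \<Omega> k (D h)) (t h)"
    and lambda_minus: "Liminf (at 0 within H) (\<lambda>h. lambda_minus \<Omega> \<kappa> k (D h) (t h)) > 0"
    and lambda_plus: "Limsup (at 0 within H) (\<lambda>h. lambda_plus \<Omega> \<kappa> k (D h) (t h)) < \<infinity>"
    and Pi: "\<And>h. h \<in> H \<Longrightarrow> exchange_operator \<Omega> k (D h) (t h) (Pih h)"
    and r: "0 < r" "r < 1"
    and u: "\<And>h n. h \<in> H \<Longrightarrow> u h n \<in> broken_Vh \<Omega> k (D h)"
    and p: "\<And>h n. h \<in> H \<Longrightarrow> p h n \<in> multi_trace \<Omega> k (D h)"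
    and p0: "\<And>h. h \<in> H \<Longrightarrow> p h 0 \<noteq> skeleton_solution \<Omega> \<kappa> \<mu> f g k (D h) (t h) (Pih h)"
    and local_step: "\<And>h n v. h \<in> H \<Longrightarrow> v \<in> broken_Vh \<Omega> k (D h) \<Longrightarrow>
       form_a \<Omega> \<kappa> \<mu> (D h) (u h n) v - \<i> * t h (trace_on (D h) (u h n)) (trace_on (D h) v)
         = t h (p h n) (trace_on (D h) v) + form_l \<Omega> f g (D h) v"
    and exchange_step: "\<And>h n. h \<in> H \<Longrightarrow>
       p h (Suc n) = cmul (complex_of_real (1 - r)) (p h n)
         - cmul (complex_of_real r) (Pih h (p h n + cmul (2 * \<i>) (trace_on (D h) (u h n))))"
  shows "0 < Liminf (at 0 within H) (\<lambda>h. gamma_h \<Omega> \<kappa> \<mu> k (D h) (t h) (Pih h)) \<and>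
    (\<forall>\<gamma>::real. 0 < \<gamma> \<and>
        ereal \<gamma> < Liminf (at 0 within H) (\<lambda>h. gamma_h \<Omega> \<kappa> \<mu> k (D h) (t h) (Pih h)) \<longrightarrow>
      (\<exists>h\<^sub>0>0. \<forall>h\<in>H. h < h\<^sub>0 \<longrightarrow> (\<forall>n.
         t_norm (t h) (p h n - skeleton_solution \<Omega> \<kappa> \<mu> f g k (D h) (t h) (Pih h)) /
         t_norm (t h) (p h 0 - skeleton_solution \<Omega> \<kappa> \<mu> f g k (D h) (t h) (Pih h))
         \<le> (1 - r * (1 - r) * \<gamma>\<^sup>2) powr (real n / 2))))"
proof -
  let ?F = "at 0 within H"
  let ?gamma = "\<lambda>h. gamma_h \<Omega> \<kappa> \<mu> k (D h) (t h) (Pih h)"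
  have inst: "fe_skeleton \<Omega> k (D h) h \<kappa> \<mu> (t h) (Pih h)" if "h \<in> H" for h
    using dom coeff mesh[OF that] alpha[OF that] t[OF that] Pi[OF that]
    by unfold_locales (auto simp: polyhedral_domain_def)
  obtain \<alpha> where \<alpha>: "0 < \<alpha>" "ereal \<alpha> < Liminf ?F (\<lambda>h. infsup_alpha \<Omega> \<kappa> \<mu> k (D h))"
    using ereal_dense2[OF alpha_uniform] by (auto simp: zero_ereal_def)
  obtain c where c: "0 < c" "ereal c < Liminf ?F (\<lambda>h. lambda_minus \<Omega> \<kappa> k (D h) (t h))"
    using ereal_dense2[OF lambda_minus] by (auto simp: zero_ereal_def)
  obtain C\<^sub>0 where C\<^sub>0: "Limsup ?F (\<lambda>h. lambda_plus \<Omega> \<kappa> k (D h) (t h)) < ereal C\<^sub>0"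
    using ereal_dense2[OF lambda_plus] by blast
  obtain A\<^sub>0 where A\<^sub>0: "Limsup ?F (\<lambda>h. cont_modulus \<Omega> \<kappa> \<mu> k (D h)) < ereal A\<^sub>0"
    using ereal_dense2[OF a_uniform] by blast
  define C where "C = max 1 C\<^sub>0"
  define A where "A = max 0 A\<^sub>0"
  define N where "N = (A / (c / 2) + C) * ((C + A / (c / 2)) / \<alpha> + 1 / (c / 2))"
  have pos: "0 < C" "0 \<le> A" by (auto simp: C_def A_def)
  then have "0 < N"
    unfolding N_def using \<alpha>(1) c(1) by (intro mult_pos_pos add_nonneg_pos add_pos_nonneg) auto
  have "\<forall>\<^sub>F h in ?F. h \<in> H"
    by (simp add: eventually_at_filter)
  moreover have "\<forall>\<^sub>F h in ?F. ereal \<alpha> < infsup_alpha \<Omega> \<kappa> \<mu> k (D h)"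
    by (rule less_LiminfD[OF \<alpha>(2)])
  moreover have "\<forall>\<^sub>F h in ?F. ereal c < lambda_minus \<Omega> \<kappa> k (D h) (t h)"
    by (rule less_LiminfD[OF c(2)])
  moreover have "\<forall>\<^sub>F h in ?F. lambda_plus \<Omega> \<kappa> k (D h) (t h) < ereal C\<^sub>0"
    by (rule Limsup_lessD[OF C\<^sub>0])
  moreover have "\<forall>\<^sub>F h in ?F. cont_modulus \<Omega> \<kappa> \<mu> k (D h) < ereal A\<^sub>0"
    by (rule Limsup_lessD[OF A\<^sub>0])
  ultimately have "\<forall>\<^sub>F h in ?F. ereal (1 / N) \<le> ?gamma h"
  proof eventually_elim
    case (elim h)
    have le: "ereal C\<^sub>0 \<le> ereal C" "ereal A\<^sub>0 \<le> ereal A" by (simp_all add: C_def A_def)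
    show ?case
      unfolding N_def
      by (rule fe_skeleton.gamma_h_lower_bound[OF inst[OF elim(1)] \<alpha>(1) elim(2) c(1) elim(3) pos(1) _ pos(2)])
        (use elim(4,5) le in \<open>auto intro: order_trans less_imp_le\<close>)
  qed
  then have "ereal (1 / N) \<le> Liminf ?F ?gamma"
    by (rule Liminf_bounded)
  moreover have "0 < ereal (1 / N)" using \<open>0 < N\<close> by simp
  ultimately have "0 < Liminf ?F ?gamma" by (rule less_le_trans[rotated])
  moreover have "\<exists>h\<^sub>0>0. \<forall>h\<in>H. h < h\<^sub>0 \<longrightarrow> (\<forall>n.
         t_norm (t h) (p h n - skeleton_solution \<Omega> \<kappa> \<mu> f g k (D h) (t h) (Pih h)) /
         t_norm (t h) (p h 0 - skeleton_solution \<Omega> \<kappa> \<mu> f g k (D h) (t h) (Pih h))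
         \<le> (1 - r * (1 - r) * \<gamma>\<^sup>2) powr (real n / 2))"
    if \<gamma>: "0 < \<gamma>" "ereal \<gamma> < Liminf ?F ?gamma" for \<gamma>
  proof -
    obtain h\<^sub>0 where h\<^sub>0: "0 < h\<^sub>0" "\<And>h. h \<in> H \<Longrightarrow> h \<noteq> 0 \<Longrightarrow> dist h 0 < h\<^sub>0 \<Longrightarrow> ereal \<gamma> < ?gamma h"
      using less_LiminfD[OF \<gamma>(2)] unfolding eventually_at by blast
    show ?thesis
    proof (intro exI[of _ h\<^sub>0] conjI ballI impI allI)
      fix h n assume h: "h \<in> H" "h < h\<^sub>0"
      have "0 < h" using H(1) h(1) by auto
      then have \<gamma>h: "ereal \<gamma> < ?gamma h" using h by (intro h\<^sub>0(2)) (auto simp: dist_real_def)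
      show "t_norm (t h) (p h n - skeleton_solution \<Omega> \<kappa> \<mu> f g k (D h) (t h) (Pih h)) /
         t_norm (t h) (p h 0 - skeleton_solution \<Omega> \<kappa> \<mu> f g k (D h) (t h) (Pih h))
         \<le> (1 - r * (1 - r) * \<gamma>\<^sup>2) powr (real n / 2)"
        by (rule fe_skeleton.iteration_converges[where u = "u h", OF inst[OF h(1)] \<gamma>(1) \<gamma>h r p[OF h(1)] u[OF h(1)] p0[OF h(1)]
              local_step[OF h(1)] exchange_step[OF h(1)]])
    qed (rule h\<^sub>0(1))
  qed
  ultimately show ?thesis by blast
qed

end
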